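(* Let $\theta\ne0$ be a fixed real number and let $\Delta(x)$ be the error term for the twisted divisor function defined in the context. For $c>0$ let $\alpha(x)=\frac38-\frac{c}{(\log x)^{1/8}}$. Let $\delta,\delta'$ satisfy $0<\delta<\delta'<\frac18$. Then either $$\Delta(x)=\Omega\left(x^{\alpha(x)+\frac\delta2}\right)\qquad\text{or}\qquad\Delta(x)=\Omega_\pm\left(x^{\frac38-\delta'}\right).$$
   Context: For $\theta\ne0$ real, $\tau(n,\theta)=\sum_{d\mid n}d^{i\theta}$, and $D(s)=\sum_{n\ge1}\frac{|\tau(n,\theta)|^2}{n^s}=\frac{\zeta^2(s)\zeta(s+i\theta)\zeta(s-i\theta)}{\zeta(2s)}$ for $\Re(s)>1$. The error term $\Delta(x)$ is defined by $$\sum_{n\le x}^*|\tau(n,\theta)|^2=\omega_1(\theta)x\log x+\omega_2(\theta)x\cos(\theta\log x)+\omega_3(\theta)x+\Delta(x),$$ where the main term (with constants $\omega_i(\theta)$ depending only on $\theta$) is the sum of the residues of $D(s)x^s/s$ at $s=1$, $1+i\theta$, $1-i\theta$, and $\sum^*_{n\le x}a_n=\sum_{n\le x}a_n$ if $x\notin\mathbb N$, $\sum_{n\le x}a_n-\frac12a_x$ if $x\in\mathbb N$. For positive $g$: $f=\Omega(g)$ means $\limsup_{x\to\infty}|f(x)|/g(x)>0$; $f=\Omega_\pm(g)$ means $\limsup_{x\to\infty}f(x)/g(x)>0$ and $\liminf_{x\to\infty}f(x)/g(x)<0$. *)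

theory Defs
  imports "HOL-Complex_Analysis.Complex_Analysis"
begin

section \<open>The Riemann zeta function\<close>

definition is_zeta :: "(complex \<Rightarrow> complex) \<Rightarrow> bool" where
  "is_zeta f \<longleftrightarrow> f holomorphic_on (- {1})
     \<and> (\<forall>s. Re s > 1 \<longrightarrow> (\<lambda>n. of_nat (Suc n) powr (- s)) sums f s)
     \<and> f 1 = 0"

text \<open>
  The value at the pole \<open>1\<close> is a dummy, fixed only to make the function unique; the
  lemma \<open>ex1_is_zeta\<close> below shows that the description is proper.
\<close>

definition zeta :: "complex \<Rightarrow> complex" where
  "zeta = (THE f. is_zeta f)"

lemma holomorphic_series:
  fixes f :: "nat \<Rightarrow> complex \<Rightarrow> complex"
  assumes S: "open S" and hol: "\<And>n. f n holomorphic_on S"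
    and bd: "\<And>s. s \<in> S \<Longrightarrow> \<exists>d>0. \<exists>h::nat\<Rightarrow>real. summable h \<and> (\<forall>n. \<forall>y\<in>ball s d \<inter> S. norm (f n y) \<le> h n)"
  shows "(\<lambda>s. \<Sum>n. f n s) holomorphic_on S"
    and "\<And>s. s \<in> S \<Longrightarrow> summable (\<lambda>n. f n s)"
proof -
  have fd: "\<And>n x. x \<in> S \<Longrightarrow> f n field_differentiable (at x)"
    using hol S holomorphic_on_imp_differentiable_at by blast
  have bd': "\<exists>d h. 0 < d \<and> summable h \<and> range h \<subseteq> \<real>\<^sub>\<ge>\<^sub>0 \<and>
      (\<forall>\<^sub>F n in sequentially. \<forall>y\<in>ball s d \<inter> S. cmod (f n y) \<le> cmod (h n))" if s: "s \<in> S" for s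
  proof -
    obtain d and h :: "nat \<Rightarrow> real" where d: "d > 0" "summable h"
      and h: "\<forall>n. \<forall>y\<in>ball s d \<inter> S. norm (f n y) \<le> h n"
      using bd[OF s] by blast
    have h0: "h n \<ge> 0" for n
    proof -
      have "norm (f n s) \<le> h n" using h s d by auto
      then show ?thesis using norm_ge_zero order_trans by blast
    qed
    show ?thesis
      apply (rule exI[of _ d], rule exI[of _ "\<lambda>n. complex_of_real (h n)"])
      using d h h0 by (auto simp: summable_of_real)
  qed
  obtain g where g: "\<forall>x \<in> S. ((\<lambda>n. f n x) sums g x) \<and> g field_differentiable (at x)"
    using series_differentiable_comparison_complex[OF S fd bd'] by blast
  show "\<And>s. s \<in> S \<Longrightarrow> summable (\<lambda>n. f n s)" using g sums_summable by blast
  have "g holomorphic_on S" using g by (simp add: holomorphic_on_def field_differentiable_at_within)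
  moreover have "(\<Sum>n. f n s) = g s" if "s \<in> S" for s using g that sums_unique by metis
  ultimately show "(\<lambda>s. \<Sum>n. f n s) holomorphic_on S" using holomorphic_cong by (metis (no_types, lifting))
qed

text \<open>Iterated differences of \<open>x\<close> to the power \<open>-s\<close> and an entire continuation of the
  alternating series.\<close>

fun pdiff :: "nat \<Rightarrow> complex \<Rightarrow> complex \<Rightarrow> complex" where
  "pdiff 0 s z = z powr (- s)"
| "pdiff (Suc k) s z = pdiff k s z - pdiff k s (z + 1)"

lemma nonpos_aux: "Re z > 0 \<Longrightarrow> z \<notin> \<real>\<^sub>\<le>\<^sub>0"
  by (auto elim!: nonpos_Reals_cases)

lemma pdiff_deriv:
  "Re z > 0 \<Longrightarrow> ((\<lambda>z. pdiff k s z) has_field_derivative (- s * pdiff k (s + 1) z)) (at z)"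
proof (induction k arbitrary: z)
  case 0
  then show ?case
    using has_field_derivative_powr[of z "-s"] nonpos_aux
    by (simp add: minus_diff_commute)
next
  case (Suc k)
  have 1: "((\<lambda>z. pdiff k s z) has_field_derivative (- s * pdiff k (s + 1) z)) (at z)"
    using Suc by blast
  have "((\<lambda>z. pdiff k s z) has_field_derivative (- s * pdiff k (s + 1) (z+1))) (at (z+1))"
    using Suc by simp
  then have 2: "((\<lambda>z. pdiff k s (z+1)) has_field_derivative (- s * pdiff k (s + 1) (z+1))) (at z)"
    by (simp add: DERIV_shift)
  show ?case
    using DERIV_diff[OF 1 2] by (simp add: algebra_simps)
qed

lemma real_mvt_bound:
  fixes f f' :: "complex \<Rightarrow> complex" and x y :: real
  assumes "x \<le> y"
    and der: "\<And>u::real. x \<le> u \<Longrightarrow> u \<le> y \<Longrightarrow> (f has_field_derivative f' (of_real u)) (at (of_real u))"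
    and B: "\<And>u::real. x \<le> u \<Longrightarrow> u \<le> y \<Longrightarrow> norm (f' (of_real u)) \<le> B"
  shows "norm (f (of_real x) - f (of_real y)) \<le> B * (y - x)"
proof -
  let ?S = "closed_segment (complex_of_real x) (of_real y)"
  have S: "?S = of_real ` {x..y}"
    using assms(1) by (simp add: closed_segment_of_real closed_segment_eq_real_ivl)
  have "norm (f (of_real x) - f (of_real y)) \<le> B * norm (complex_of_real x - of_real y)"
  proof (rule field_differentiable_bound[where S = ?S and f' = f'])
    show "(f has_field_derivative f' z) (at z within ?S)" if "z \<in> ?S" for z
      using that der unfolding S by (auto intro: has_field_derivative_at_within)
    show "norm (f' z) \<le> B" if "z \<in> ?S" for z
      using that B unfolding S by auto
  qed auto
  also have "norm (complex_of_real x - of_real y) = y - x"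
    using assms(1) by (metis abs_minus_commute abs_of_nonneg diff_ge_0_iff_ge norm_of_real of_real_diff)
  finally show ?thesis .
qed

lemma pdiff_bound:
  assumes "x \<ge> 1" "Re s + real k \<ge> 0"
  shows "norm (pdiff k s (of_real x)) \<le> norm (pochhammer s k) * x powr (- Re s - real k)"
  using assms
proof (induction k arbitrary: s x)
  case 0
  then show ?case by (simp add: norm_powr_real_powr)
next
  case (Suc k)
  let ?B = "norm s * (norm (pochhammer (s+1) k) * x powr (- Re s - real (Suc k)))"
  have "norm (pdiff k s (of_real x) - pdiff k s (of_real (x + 1))) \<le> ?B * ((x+1) - x)"
  proof (rule real_mvt_bound[where f' = "\<lambda>z. - s * pdiff k (s + 1) z"])
    fix u :: real assume u: "x \<le> u"
    show "((pdiff k s) has_field_derivative - s * pdiff k (s + 1) (of_real u)) (at (of_real u))"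
      using u Suc.prems pdiff_deriv[of "of_real u" k s] by simp
    have "norm (pdiff k (s+1) (of_real u)) \<le> norm (pochhammer (s+1) k) * u powr (- Re (s+1) - real k)"
      using u Suc.prems by (intro Suc.IH) auto
    also have "\<dots> \<le> norm (pochhammer (s+1) k) * x powr (- Re (s+1) - real k)"
      using u Suc.prems by (intro mult_left_mono powr_mono2') auto
    also have "- Re (s+1) - real k = - Re s - real (Suc k)" by simp
    finally show "norm (- s * pdiff k (s + 1) (of_real u)) \<le> ?B"
      by (simp add: norm_mult mult_left_mono)
  qed auto
  also have "?B * ((x+1) - x) = norm (pochhammer s (Suc k)) * x powr (- Re s - real (Suc k))"
    by (simp add: pochhammer_rec norm_mult)
  finally show ?case by simp
qed

lemma pdiff_holomorphic: "Re z > 0 \<Longrightarrow> (\<lambda>s. pdiff k s z) holomorphic_on A"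
proof (induction k arbitrary: z)
  case 0
  then have "z \<noteq> 0" by auto
  then show ?case by (auto intro!: holomorphic_intros)
next
  case (Suc k)
  then show ?case by (auto intro!: holomorphic_intros)
qed

lemma summable_Suc_powr: "a < -1 \<Longrightarrow> summable (\<lambda>n. real (Suc n) powr a)"
  using summable_real_powr_iff[of a] summable_Suc_iff[of "\<lambda>n. real n powr a"] by simp

lemma local_bound:
  fixes f :: "nat \<Rightarrow> complex \<Rightarrow> complex" and g :: "complex \<Rightarrow> real" and a :: real
  assumes S: "open S" "s \<in> S" and cont: "continuous_on S g"
    and Re: "Re s > 1 - a"
    and bd: "\<And>n y. y \<in> S \<Longrightarrow> norm (f n y) \<le> g y * real (Suc n) powr (- Re y - a)"
  shows "\<exists>d>0. \<exists>h::nat\<Rightarrow>real. summable h \<and> (\<forall>n. \<forall>y\<in>ball s d \<inter> S. norm (f n y) \<le> h n)"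
proof -
  define e where "e = (Re s - (1 - a)) / 2"
  have e: "e > 0" using Re by (simp add: e_def)
  obtain r where r: "r > 0" "\<forall>y\<in>S. dist y s < r \<longrightarrow> dist (g y) (g s) < 1"
    using cont S(2) unfolding continuous_on_iff by (metis zero_less_one)
  define h where "h = (\<lambda>n. (\<bar>g s\<bar> + 1) * real (Suc n) powr (- 1 - e))"
  have "summable h"
    unfolding h_def using e by (intro summable_mult summable_Suc_powr) auto
  moreover have "norm (f n y) \<le> h n" if y: "y \<in> ball s (min r e) \<inter> S" for n y
  proof -
    have "dist (g y) (g s) < 1" using r y by (auto simp: dist_commute)
    then have g: "g y \<le> \<bar>g s\<bar> + 1" by (auto simp: dist_real_def)
    have "\<bar>Re s - Re y\<bar> < e"
      using y abs_Re_le_cmod[of "s - y"] by (auto simp: dist_norm)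
    then have le: "- Re y - a \<le> - 1 - e" by (simp add: e_def field_simps abs_if split: if_splits)
    have "norm (f n y) \<le> g y * real (Suc n) powr (- Re y - a)" using bd y by auto
    also have "\<dots> \<le> (\<bar>g s\<bar> + 1) * real (Suc n) powr (- 1 - e)"
      using g le by (intro mult_mono powr_mono) auto
    finally show ?thesis by (simp add: h_def)
  qed
  ultimately show ?thesis
    using r(1) e by (intro exI[of _ "min r e"]) auto
qed

lemma continuous_norm_pochhammer: "continuous_on A (\<lambda>s::complex. norm (pochhammer s k))"
  unfolding pochhammer_prod by (intro continuous_intros)

lemma open_Re_gt: "open {s. Re s > a}"
  using open_halfspace_Re_gt by simp

lemma alt_pdiff:
  fixes k :: nat
  defines "S \<equiv> {s. Re s > 1 - real k}"
  shows "(\<lambda>s. \<Sum>n. (-1) ^ n * pdiff k s (of_nat (Suc n))) holomorphic_on S"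
    and "\<And>s. s \<in> S \<Longrightarrow> summable (\<lambda>n. (-1) ^ n * pdiff k s (of_nat (Suc n)))"
proof -
  let ?f = "\<lambda>n s. (-1) ^ n * pdiff k s (of_nat (Suc n))"
  have S: "open S" unfolding S_def by (rule open_Re_gt)
  have hol: "?f n holomorphic_on S" for n
    by (intro holomorphic_intros pdiff_holomorphic) auto
  have bd: "\<exists>d>0. \<exists>h::nat\<Rightarrow>real. summable h \<and> (\<forall>n. \<forall>y\<in>ball s d \<inter> S. norm (?f n y) \<le> h n)"
    if "s \<in> S" for s
  proof (rule local_bound[OF S that])
    show "Re s > 1 - real k" using that by (simp add: S_def)
    show "norm (?f n y) \<le> norm (pochhammer y k) * real (Suc n) powr (- Re y - real k)"
      if "y \<in> S" for n y
      using that pdiff_bound[of "real (Suc n)" y k] by (simp add: S_def norm_mult norm_power)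
  qed (rule continuous_norm_pochhammer)
  show "(\<lambda>s. \<Sum>n. ?f n s) holomorphic_on S" by (rule holomorphic_series(1)[OF S hol bd])
  show "\<And>s. s \<in> S \<Longrightarrow> summable (\<lambda>n. ?f n s)" by (rule holomorphic_series(2)[OF S hol bd])
qed

definition eta_approx :: "nat \<Rightarrow> complex \<Rightarrow> complex" where
  "eta_approx k s = (\<Sum>j<k. pdiff j s 1 / 2 ^ Suc j)
      + (\<Sum>n. (-1) ^ n * pdiff k s (of_nat (Suc n))) / 2 ^ k"

lemma eta_approx_holomorphic: "eta_approx k holomorphic_on {s. Re s > 1 - real k}"
  unfolding eta_approx_def
  by (intro holomorphic_intros alt_pdiff pdiff_holomorphic) auto

lemma eta_approx_Suc:
  assumes "Re s > 1 - real k"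
  shows "eta_approx (Suc k) s = eta_approx k s"
proof -
  let ?f = "\<lambda>n. (-1) ^ n * pdiff k s (of_nat (Suc n))"
  have f: "summable ?f" using alt_pdiff(2)[of s k] assms by simp
  have f': "summable (\<lambda>n. ?f (Suc n))" using f by (rule summable_Suc_iff[THEN iffD2])
  have "(\<Sum>n. (-1) ^ n * pdiff (Suc k) s (of_nat (Suc n))) = (\<Sum>n. ?f n + ?f (Suc n))"
    by (intro suminf_cong) (simp add: algebra_simps)
  also have "\<dots> = suminf ?f + (\<Sum>n. ?f (Suc n))" using f f' by (simp add: suminf_add)
  also have "(\<Sum>n. ?f (Suc n)) = suminf ?f - ?f 0" using suminf_split_head[OF f] by simp
  finally have "(\<Sum>n. (-1) ^ n * pdiff (Suc k) s (of_nat (Suc n))) = 2 * suminf ?f - pdiff k s 1"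
    by simp
  then have "(\<Sum>n. (-1) ^ n * pdiff (Suc k) s (of_nat (Suc n))) / 2 ^ Suc k
      = suminf ?f / 2 ^ k - pdiff k s 1 / 2 ^ Suc k"
    by (simp only: diff_divide_distrib power_Suc) simp
  then show ?thesis unfolding eta_approx_def by (simp only: sum.lessThan_Suc) simp
qed

lemma eta_approx_eq:
  assumes "Re s > 1 - real k" "k \<le> m"
  shows "eta_approx m s = eta_approx k s"
  using assms(2) by (induction m rule: dec_induct) (use assms(1) eta_approx_Suc in auto)

lemma ex_eta:
  "\<exists>E. E holomorphic_on UNIV \<and> (\<forall>s. Re s > 1 \<longrightarrow> (\<lambda>n. (-1) ^ n * of_nat (Suc n) powr (- s)) sums E s)"
proof -
  define E where "E = (\<lambda>s. eta_approx (nat \<lceil>2 - Re s\<rceil>) s)"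
  have eq: "E s = eta_approx k s" if "Re s > 1 - real k" for s k
  proof -
    have "Re s > 1 - real (nat \<lceil>2 - Re s\<rceil>)" by linarith
    then show ?thesis unfolding E_def using that
      by (metis eta_approx_eq nle_le)
  qed
  have "E field_differentiable (at s)" for s
  proof -
    obtain k :: nat where k: "Re s > 1 - real k"
      using reals_Archimedean2[of "1 - Re s"] by (auto simp: algebra_simps)
    let ?S = "{s. Re s > 1 - real k}"
    have "E holomorphic_on ?S \<longleftrightarrow> eta_approx k holomorphic_on ?S"
      by (rule holomorphic_cong) (auto simp: eq)
    then have "E holomorphic_on ?S" using eta_approx_holomorphic by blast
    then show ?thesis
      using holomorphic_on_imp_differentiable_at[of E ?S s] open_Re_gt k by auto
  qed
  then have 1: "E holomorphic_on UNIV" by (simp add: holomorphic_on_def)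
  have 2: "(\<lambda>n. (-1) ^ n * of_nat (Suc n) powr (- s)) sums E s" if "Re s > 1" for s
    using alt_pdiff(2)[of s 0] eq[of 0 s] that summable_sums[of "\<lambda>n. (-1) ^ n * of_nat (Suc n) powr (- s)"]
    by (simp add: eta_approx_def)
  show ?thesis using 1 2 by blast
qed

text \<open>Continuation to the right half-plane by comparison with an integral.\<close>

lemma ex_zeta_half:
  "\<exists>A. A holomorphic_on ({s. Re s > 0} - {1}) \<and>
     (\<forall>s. Re s > 1 \<longrightarrow> (\<lambda>n. of_nat (Suc n) powr (- s)) sums A s)"
proof -
  define S where "S = {s. Re s > 0} - {1::complex}"
  define T where "T = (\<lambda>n s. of_nat (Suc n) powr (1 - s) / (s - 1) :: complex)"
  define f where "f = (\<lambda>n s. of_nat (Suc n) powr (- s) - (T n s - T (Suc n) s))"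
  have S: "open S" unfolding S_def by (intro open_delete open_Re_gt)
  have hol: "f n holomorphic_on S" for n
    unfolding f_def T_def S_def by (intro holomorphic_intros) auto
  have fbd: "norm (f n s) \<le> norm s * real (Suc n) powr (- Re s - 1)" if s: "s \<in> S" for n s
  proof -
    define x where "x = real (Suc n)"
    have x: "x \<ge> 1" by (simp add: x_def)
    define g where "g = (\<lambda>z. z * of_real x powr (- s) + z powr (1 - s) / (s - 1))"
    have s0: "Re s > 0" "s - 1 \<noteq> 0" using s by (auto simp: S_def)
    have "norm (g (of_real x) - g (of_real (x + 1))) \<le> (norm s * x powr (- Re s - 1)) * ((x + 1) - x)"
    proof (rule real_mvt_bound[where f' = "\<lambda>z. of_real x powr (- s) - z powr (- s)"])
      fix u :: real assume u: "x \<le> u" "u \<le> x + 1"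
      have 1: "((\<lambda>z. z powr (1 - s)) has_field_derivative ((1 - s) * of_real u powr (1 - s - 1))) (at (of_real u))"
        using u x by (intro has_field_derivative_powr nonpos_aux) auto
      have "(g has_field_derivative (1 * of_real x powr (- s) + ((1 - s) * of_real u powr (1 - s - 1)) / (s - 1))) (at (of_real u))"
        unfolding g_def by (intro DERIV_add DERIV_cmult_right DERIV_ident DERIV_cdivide 1)
      moreover have "((1 - s) * of_real u powr (1 - s - 1)) / (s - 1) = - (of_real u powr (- s))"
        using s0 by (simp add: field_simps)
      ultimately show "(g has_field_derivative (of_real x powr (- s) - of_real u powr (- s))) (at (of_real u))"
        by simp
      have "norm (complex_of_real x powr (- s) - of_real u powr (- s)) \<le> (norm s * x powr (- Re s - 1)) * (u - x)"
      proof (rule real_mvt_bound[where f' = "\<lambda>z. - s * z powr (- s - 1)"])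
        fix v :: real assume v: "x \<le> v"
        show "((\<lambda>z. z powr (- s)) has_field_derivative - s * of_real v powr (- s - 1)) (at (of_real v))"
          using v x by (intro has_field_derivative_powr nonpos_aux) auto
        have "v powr (- Re s - 1) \<le> x powr (- Re s - 1)"
          using v x s0 by (intro powr_mono2') auto
        then show "norm (- s * of_real v powr (- s - 1)) \<le> norm s * x powr (- Re s - 1)"
          using v x by (simp add: norm_mult norm_powr_real_powr mult_left_mono)
      qed (use u in auto)
      also have "\<dots> \<le> (norm s * x powr (- Re s - 1)) * 1"
        using u by (intro mult_left_mono) auto
      finally show "norm (complex_of_real x powr (- s) - of_real u powr (- s)) \<le> norm s * x powr (- Re s - 1)"
        by simp
    qed auto
    moreover have "g (of_real x) - g (of_real (x + 1)) = - f n s"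
      by (simp add: g_def f_def T_def x_def algebra_simps)
    ultimately show ?thesis by (simp add: x_def)
  qed
  have bd: "\<exists>d>0. \<exists>h::nat\<Rightarrow>real. summable h \<and> (\<forall>n. \<forall>y\<in>ball s d \<inter> S. norm (f n y) \<le> h n)"
    if "s \<in> S" for s
    by (rule local_bound[OF S that _ _ fbd]) (use that in \<open>auto simp: S_def intro!: continuous_intros\<close>)
  have "(\<lambda>s. 1 / (s - 1) + (\<Sum>n. f n s)) holomorphic_on S"
    by (intro holomorphic_intros holomorphic_series(1)[OF S hol bd]) (auto simp: S_def)
  moreover have "(\<lambda>n. of_nat (Suc n) powr (- s)) sums (1 / (s - 1) + (\<Sum>n. f n s))" if s: "Re s > 1" for s
  proof -
    have sS: "s \<in> S" using s by (auto simp: S_def)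
    have "(\<lambda>n. real n powr (1 - Re s)) \<longlonglongrightarrow> 0"
      using s by (intro tendsto_neg_powr filterlim_real_sequentially) auto
    then have "(\<lambda>n. real (Suc n) powr (1 - Re s) / norm (s - 1)) \<longlonglongrightarrow> 0 / norm (s - 1)"
      using sS by (intro tendsto_divide tendsto_const LIMSEQ_Suc[of "\<lambda>n. real n powr (1 - Re s)"]) (auto simp: S_def)
    then have "(\<lambda>n. norm (T n s)) \<longlonglongrightarrow> 0"
      unfolding T_def norm_divide
      by (simp add: norm_powr_real_powr del: of_nat_Suc)
    then have "(\<lambda>n. T n s) \<longlonglongrightarrow> 0" by (simp add: tendsto_norm_zero_iff)
    then have "(\<lambda>n. T n s - T (Suc n) s) sums (T 0 s - 0)" by (rule telescope_sums')
    moreover have "T 0 s = 1 / (s - 1)" by (simp add: T_def)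
    ultimately have "(\<lambda>n. (T n s - T (Suc n) s) + f n s) sums (1 / (s - 1) + (\<Sum>n. f n s))"
      using summable_sums[OF holomorphic_series(2)[OF S hol bd sS]] by (intro sums_add) auto
    then show ?thesis by (simp add: f_def)
  qed
  ultimately show ?thesis unfolding S_def by blast
qed

lemma eta_zeta_relation:
  assumes s: "Re s > 1"
    and E: "(\<lambda>n. (-1) ^ n * of_nat (Suc n) powr (- s)) sums E"
    and Z: "(\<lambda>n. of_nat (Suc n) powr (- s)) sums (Z::complex)"
  shows "E = (1 - 2 powr (1 - s)) * Z"
proof -
  let ?g = "\<lambda>n. if odd n then 2 * of_nat (Suc n) powr (- s) else (0::complex)"
  have *: "?g (2 * n + 1) = 2 powr (1 - s) * of_nat (Suc n) powr (- s)" for n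
  proof -
    have "of_nat (Suc (2 * n + 1)) = complex_of_real 2 * of_real (real (Suc n))"
      by (simp add: algebra_simps)
    also have "\<dots> powr (- s) = of_real 2 powr (- s) * of_real (real (Suc n)) powr (- s)"
      by (rule powr_times_real) auto
    finally have a: "of_nat (Suc (2 * n + 1)) powr (- s) = 2 powr (- s) * of_nat (Suc n) powr (- s)"
      by simp
    have b: "(2::complex) powr (1 - s) = 2 * 2 powr (- s)"
      using powr_add[of "2::complex" 1 "-s"] by simp
    show ?thesis using a b by (simp del: of_nat_Suc)
  qed
  have "(\<lambda>n. ?g (2 * n + 1)) sums (2 powr (1 - s) * Z)"
    unfolding * using Z by (rule sums_mult)
  moreover have "strict_mono (\<lambda>n::nat. 2 * n + 1)" by (simp add: strict_mono_def)
  moreover have "?g n = 0" if "n \<notin> range (\<lambda>n::nat. 2 * n + 1)" for n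
    using that by (auto elim!: oddE)
  ultimately have "?g sums (2 powr (1 - s) * Z)"
    using sums_mono_reindex[of "\<lambda>n::nat. 2 * n + 1" ?g] by blast
  then have "(\<lambda>n. of_nat (Suc n) powr (- s) - ?g n) sums (Z - 2 powr (1 - s) * Z)"
    using Z by (intro sums_diff)
  moreover have "(\<lambda>n. of_nat (Suc n) powr (- s) - ?g n) = (\<lambda>n. (-1) ^ n * of_nat (Suc n) powr (- s))"
    by (auto simp: fun_eq_iff)
  ultimately show ?thesis using E sums_unique2 by (fastforce simp: algebra_simps)
qed

lemma ex_is_zeta: "\<exists>f. is_zeta f"
proof -
  obtain E where E: "E holomorphic_on UNIV"
      "\<And>s. Re s > 1 \<Longrightarrow> (\<lambda>n. (-1) ^ n * of_nat (Suc n) powr (- s)) sums E s"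
    using ex_eta by blast
  obtain A where A: "A holomorphic_on ({s. Re s > 0} - {1})"
      "\<And>s. Re s > 1 \<Longrightarrow> (\<lambda>n. of_nat (Suc n) powr (- s)) sums A s"
    using ex_zeta_half by blast
  define P where "P = {s. Re s > 0} - {1::complex}"
  define N where "N = {s. Re s < 1}"
  define B where "B = (\<lambda>s. E s / (1 - 2 powr (1 - s)))"
  have oP: "open P" unfolding P_def by (intro open_delete open_Re_gt)
  have oN: "open N" unfolding N_def using open_halfspace_Re_lt by simp
  have conn: "connected P" unfolding P_def
    by (intro connected_open_delete open_Re_gt convex_connected convex_halfspace_Re_gt) auto
  have nz: "(1::complex) - 2 powr (1 - s) \<noteq> 0" if "s \<in> N" for s
  proof
    assume "(1::complex) - 2 powr (1 - s) = 0"
    then have "norm ((2::complex) powr (1 - s)) = 1" by simp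
    moreover have "norm ((2::complex) powr (1 - s)) = 2 powr (1 - Re s)"
      by (simp add: norm_powr_real_powr)
    moreover have "2 powr (1 - Re s) > 1" using that by (simp add: N_def)
    ultimately show False by simp
  qed
  have B: "B holomorphic_on N"
    unfolding B_def
    by (intro holomorphic_intros holomorphic_on_subset[OF E(1)]) (use nz in auto)
  have rel: "E s = (1 - 2 powr (1 - s)) * A s" if "s \<in> P" for s
  proof (rule analytic_continuation_open[of "{s. Re s > 1}" P E "\<lambda>s. (1 - 2 powr (1 - s)) * A s"])
    show "{s. Re s > 1} \<noteq> {}" using exI[of "\<lambda>s. Re s > 1" 2] by auto
    show "(\<lambda>s. (1 - 2 powr (1 - s)) * A s) holomorphic_on P"
      using A(1) unfolding P_def by (intro holomorphic_intros) auto
    show "E s = (1 - 2 powr (1 - s)) * A s" if "s \<in> {s. Re s > 1}" for s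
      using eta_zeta_relation[of s] E(2) A(2) that by blast
  qed (use oP conn that open_Re_gt E(1) holomorphic_on_subset in \<open>auto simp: P_def\<close>)
  have hol: "(\<lambda>s. if s \<in> P then A s else B s) holomorphic_on (P \<union> N)"
  proof (rule holomorphic_on_If_Un)
    show "A s = B s" if "s \<in> P" "s \<in> N" for s
      using rel[OF that(1)] nz[OF that(2)] by (simp add: B_def)
  qed (use A B oP oN in \<open>auto simp: P_def\<close>)
  have PN: "P \<union> N = - {1}" by (auto simp: P_def N_def)
  define f where "f = (\<lambda>s. if s = 1 then 0 else if s \<in> P then A s else B s)"
  have "f holomorphic_on (- {1})"
    using hol unfolding PN
    by (rule holomorphic_transform) (simp add: f_def)
  moreover have "f s = A s" if "Re s > 1" for s using that by (auto simp: f_def P_def)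
  ultimately have "is_zeta f" unfolding is_zeta_def using A(2) by (simp add: f_def)
  then show ?thesis by blast
qed

lemma ex1_is_zeta: "\<exists>!f. is_zeta f"
proof (rule ex_ex1I[OF ex_is_zeta])
  fix f g assume f: "is_zeta f" and g: "is_zeta g"
  have "f s = g s" for s
  proof (cases "s = 1")
    case False
    show ?thesis
    proof (rule analytic_continuation_open[of "{s. Re s > 1}" "- {1}" f g])
      show "{s. Re s > 1} \<noteq> {}" using exI[of "\<lambda>s. Re s > 1" 2] by auto
      show "connected (- {1::complex})"
        using connected_open_delete[of "UNIV :: complex set" 1] by (simp add: Compl_eq_Diff_UNIV connected_UNIV)
      show "f s = g s" if "s \<in> {s. Re s > 1}" for s
        using that f g unfolding is_zeta_def by (auto intro: sums_unique2)
    qed (use False f g open_Re_gt in \<open>auto simp: is_zeta_def\<close>)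
  qed (use f g in \<open>simp add: is_zeta_def\<close>)
  then show "f = g" by blast
qed

lemma is_zeta_zeta: "is_zeta zeta"
  unfolding zeta_def using ex1_is_zeta by (rule theI')


section \<open>The twisted divisor function\<close>

definition tau :: "nat \<Rightarrow> real \<Rightarrow> complex" where
  "tau n \<theta> = (\<Sum>d | d dvd n. of_nat d powr (\<i> * of_real \<theta>))"

text \<open>
  The meromorphic continuation of the Dirichlet series with coefficients
  \<open>|tau n \<theta>|\<^sup>2\<close>, in Ramanujan's product form.
\<close>

definition D_fun :: "real \<Rightarrow> complex \<Rightarrow> complex" where
  "D_fun \<theta> s = zeta s ^ 2 * zeta (s + \<i> * of_real \<theta>) * zeta (s - \<i> * of_real \<theta>) / zeta (2 * s)"

definition starred_sum :: "(nat \<Rightarrow> real) \<Rightarrow> real \<Rightarrow> real" where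
  "starred_sum a x = (\<Sum>n | 1 \<le> n \<and> real n \<le> x. a n) - (if x \<in> \<nat> then a (nat \<lfloor>x\<rfloor>) / 2 else 0)"

text \<open>
  The residue at \<open>1\<close> is real and those at \<open>1 + \<i>\<theta>\<close> and \<open>1 - \<i>\<theta>\<close> are complex conjugates, so
  taking the real part only changes the type. The latter two add up to an oscillating term
  of the shape \<open>\<omega> x cos (\<theta> log x + \<phi>)\<close> with a phase \<open>\<phi>\<close> depending on \<open>\<theta>\<close>.
\<close>

definition main_term :: "real \<Rightarrow> real \<Rightarrow> real" where
  "main_term \<theta> x = Re (\<Sum>p \<in> {1, 1 + \<i> * of_real \<theta>, 1 - \<i> * of_real \<theta>}.
      residue (\<lambda>s. D_fun \<theta> s * of_real x powr s / s) p)"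

definition Delta :: "real \<Rightarrow> real \<Rightarrow> real" where
  "Delta \<theta> x = starred_sum (\<lambda>n. (cmod (tau n \<theta>))\<^sup>2) x - main_term \<theta> x"


section \<open>Omega notation\<close>

text \<open>
  These are the negations of \<open>o\<close>-estimates as \<open>x\<close> tends to infinity, unlike the
  \<open>\<Omega>\<close> of \<open>HOL-Library.Landau_Symbols\<close>, which asserts a lower bound for all large \<open>x\<close>.
\<close>

definition Omega :: "(real \<Rightarrow> real) \<Rightarrow> (real \<Rightarrow> real) \<Rightarrow> bool" where
  "Omega f g \<longleftrightarrow> Limsup at_top (\<lambda>x. ereal (\<bar>f x\<bar> / g x)) > 0"

definition Omega_pm :: "(real \<Rightarrow> real) \<Rightarrow> (real \<Rightarrow> real) \<Rightarrow> bool" where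
  "Omega_pm f g \<longleftrightarrow> Limsup at_top (\<lambda>x. ereal (f x / g x)) > 0
     \<and> Liminf at_top (\<lambda>x. ereal (f x / g x)) < 0"

definition alpha :: "real \<Rightarrow> real \<Rightarrow> real" where
  "alpha c x = 3 / 8 - c / ln x powr (1 / 8)"

end

theory Submission
  imports Defs "HOL-Probability.Probability" "HOL-Real_Asymp.Real_Asymp"
begin

text \<open>
  Suppose that both alternatives fail, and put \<open>\<kappa> = 3/8 + \<delta>/2\<close> and \<open>\<beta> = 3/8 - \<delta>'\<close>. As
  \<open>\<alpha>(x) < 3/8\<close>, the failure of the first gives \<open>|\<Delta>(x)| \<le> x powr \<kappa>\<close> for large \<open>x\<close>; the failure of the
  second gives \<open>\<epsilon> \<Delta>(x) \<ge> - x powr \<beta>\<close> for large \<open>x\<close> and one of the signs \<open>\<epsilon> = 1\<close> or \<open>\<epsilon> = -1\<close>. This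
  leads to a contradiction by comparing two estimates for an integral of
  \<open>Z(s) = \<zeta>(s)\<^sup>2 \<zeta>(s + \<i>\<theta>) \<zeta>(s - \<i>\<theta>)\<close>, called \<open>zeta_quad\<close> below, over a vertical segment.

  Let \<open>g(u) = \<Delta>(exp u)\<close> for \<open>u \<ge> 0\<close>. Ramanujan's formula (\<open>ramanujan_identity\<close>) says that the Laplace
  transform \<open>G(s)\<close> of \<open>g\<close> satisfies \<open>s (G(s) + P(s)) \<zeta>(2s) = Z(s)\<close> with a sum \<open>P\<close> of principal parts at
  \<open>1\<close> and \<open>1 \<plusminus> \<i>\<theta>\<close> (\<open>log_error_laplace\<close>). The integral \<open>G(s)\<close> converges for \<open>Re s > \<kappa>\<close> by the
  two-sided bound. By the one-sided bound and Landau's theorem (\<open>landau_nonneg_laplace\<close>) it even converges for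
  \<open>Re s > \<beta>\<close>, since \<open>\<zeta>(2s)\<close> has no zero on the real segment in between: \<open>\<zeta>\<close> is negative on \<open>(0, 1)\<close>
  (\<open>zeta_neg_real\<close>). So \<open>g(u) exp (- \<sigma> u)\<close> is integrable for \<open>\<sigma> > \<beta>\<close>. As
  \<open>g(u)\<^sup>2 \<le> C |g(u)| exp (\<kappa> u)\<close>, it is square-integrable if also \<open>2\<sigma> > \<kappa> + \<beta>\<close>. The
  hypothesis \<open>\<delta> < \<delta>'\<close> yields \<open>\<kappa> + \<beta> < 3/4\<close>, so there is such a \<open>\<sigma> < 3/8\<close>. Fix it.

  Upper estimate: the integral of \<open>|G(\<sigma> + \<i>t)|\<^sup>2\<close> over \<open>[T, 2T]\<close> is bounded uniformly in \<open>T\<close>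
  (\<open>fourier_gaussian_bessel\<close>), and that of \<open>|\<zeta>(2\<sigma> + 2\<i>t)|\<^sup>2\<close> is \<open>O(T)\<close>
  (\<open>zeta_mean_square\<close>). Hence the integral of \<open>|Z(\<sigma> + \<i>t)|\<close> over \<open>[T, 2T]\<close> is
  \<open>O(T powr (3/2))\<close>. Here \<open>\<zeta>(2s)\<close> stays multiplied out, since
  \<open>Z(s) / \<zeta>(2s)\<close> would be large near zeros of \<open>\<zeta>(2s)\<close>.

  Lower estimate: by the functional equation, \<open>|Z(s)|\<close> is at least of the order of
  \<open>T powr (2 - 4\<sigma>) |Z(1 - s)|\<close> (\<open>zeta_reflection_lower_bound\<close>). The integral of \<open>|Z(1 - s)|\<close> is at
  least of order \<open>T\<close>, as is seen by moving the line of integration to the right, where \<open>Z\<close> is close to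
  \<open>1\<close> (\<open>zeta_quad_first_moment_lower\<close>). The resulting order \<open>T powr (3 - 4\<sigma>)\<close> exceeds
  \<open>T powr (3/2)\<close> because \<open>\<sigma> < 3/8\<close>. The two estimates are confronted in
  \<open>no_one_sided_small_error\<close>.

  The functional equation comes from evaluating the Mellin transform of \<open>1 / (exp x - 1) - 1 / x\<close> twice, by a
  geometric series and by partial fractions (\<open>mellin_bose_zeta\<close>, \<open>mellin_bose_zeta_reflected\<close>).
  The size of the Gamma factor comes from comparing Euler's limit formula with the line
  \<open>Re s = 1/2\<close>, on which the reflection formula gives the exact absolute value (\<open>norm_Gamma_compare\<close>,
  \<open>norm_Gamma_half\<close>).
\<close>

section \<open>Corrected partial sums of the zeta function\<close>

text \<open>
  The partial sums of the Dirichlet series, corrected by the first term of Euler-Maclaurin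
  summation. With the correction they tend to \<open>\<zeta>(s)\<close> for \<open>Re s > 0\<close> and \<open>s \<noteq> 1\<close>.
\<close>
definition zeta_partial :: "nat \<Rightarrow> complex \<Rightarrow> complex" where
  "zeta_partial N s = (\<Sum>n<N. of_nat (Suc n) powr (- s)) - of_nat N powr (1 - s) / (1 - s)"

text \<open>
  The increment is \<open>(N + 1)\<close> to the power \<open>-s\<close> minus the integral of \<open>x powr (-s)\<close> over
  \<open>[N, N + 1]\<close>, so it is of the size of the derivative of \<open>x powr (-s)\<close>.
\<close>
lemma zeta_partial_step_bound:
  assumes N: "N \<ge> 1" and s: "Re s > 0" "s \<noteq> 1"
  shows "norm (zeta_partial (Suc N) s - zeta_partial N s) \<le> norm s * real N powr (- Re s - 1)"
proof -
  define x where "x = real N"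
  have x: "x \<ge> 1" using N by (simp add: x_def)
  define c where "c = complex_of_real (x + 1) powr (- s)"
  define g where "g = (\<lambda>z. z * c - z powr (1 - s) / (1 - s))"
  have "norm (g (of_real x) - g (of_real (x + 1))) \<le> (norm s * x powr (- Re s - 1)) * ((x + 1) - x)"
  proof (rule real_mvt_bound[where f' = "\<lambda>z. c - z powr (- s)"])
    fix u :: real assume u: "x \<le> u" "u \<le> x + 1"
    have "((\<lambda>z. z powr (1 - s)) has_field_derivative ((1 - s) * of_real u powr (1 - s - 1))) (at (of_real u))"
      using u x by (intro has_field_derivative_powr nonpos_aux) auto
    then have "(g has_field_derivative (1 * c - ((1 - s) * of_real u powr (1 - s - 1)) / (1 - s))) (at (of_real u))"
      unfolding g_def by (intro DERIV_diff DERIV_cmult_right DERIV_ident DERIV_cdivide)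
    then show "(g has_field_derivative (c - of_real u powr (- s))) (at (of_real u))"
      using s by simp
    have "norm (complex_of_real u powr (- s) - of_real (x + 1) powr (- s)) \<le> (norm s * x powr (- Re s - 1)) * (x + 1 - u)"
    proof (rule real_mvt_bound[where f' = "\<lambda>z. - s * z powr (- s - 1)"])
      fix v :: real assume v: "u \<le> v"
      show "((\<lambda>z. z powr (- s)) has_field_derivative - s * of_real v powr (- s - 1)) (at (of_real v))"
        using u v x by (intro has_field_derivative_powr nonpos_aux) auto
      have "v powr (- Re s - 1) \<le> x powr (- Re s - 1)"
        using u v x s by (intro powr_mono2') auto
      then show "norm (- s * of_real v powr (- s - 1)) \<le> norm s * x powr (- Re s - 1)"
        using u v x by (simp add: norm_mult norm_powr_real_powr mult_left_mono)
    qed (use u in auto)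
    also have "\<dots> \<le> (norm s * x powr (- Re s - 1)) * 1"
      using u by (intro mult_left_mono) auto
    finally show "norm (c - of_real u powr (- s)) \<le> norm s * x powr (- Re s - 1)"
      by (simp add: c_def norm_minus_commute)
  qed auto
  moreover have "g (of_real (x + 1)) - g (of_real x) = zeta_partial (Suc N) s - zeta_partial N s"
    by (simp add: g_def c_def zeta_partial_def x_def algebra_simps)
  moreover have "norm (g (of_real (x + 1)) - g (of_real x)) = norm (g (of_real x) - g (of_real (x + 1)))"
    by (rule norm_minus_commute)
  ultimately show ?thesis by (simp add: x_def)
qed

text \<open>
  Bounds the increments by telescoping differences. The factor \<open>2 powr (a + 1)\<close> pays for
  moving the point supplied by the mean value theorem, which is at most \<open>2 * x\<close>, back to \<open>x\<close>.
\<close>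
lemma powr_telescope_bound:
  assumes "0 < a" "1 \<le> (x::real)"
  shows "x powr (- a - 1) \<le> 2 powr (a + 1) / a * (x powr (- a) - (x + 1) powr (- a))"
proof -
  have "\<exists>z>x. z < x + 1 \<and> (x + 1) powr (- a) - x powr (- a) = (x + 1 - x) * (- a * z powr (- a - 1))"
    using assms proof (intro MVT2)
    fix y assume "x \<le> y" "y \<le> x + 1"
    then show "((\<lambda>y. y powr (- a)) has_real_derivative - a * y powr (- a - 1)) (at y)"
      using assms has_real_derivative_powr[of y "- a"] by simp
  qed auto
  then obtain z where z: "x < z" "z < x + 1" "x powr (- a) - (x + 1) powr (- a) = a * z powr (- a - 1)"
    by auto
  have "(2 * x) powr (- a - 1) \<le> z powr (- a - 1)"
    using z assms by (intro powr_mono2') auto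
  then have "2 powr (a + 1) * (2 powr (- a - 1) * x powr (- a - 1)) \<le> 2 powr (a + 1) * z powr (- a - 1)"
    using assms by (intro mult_left_mono) (auto simp: powr_mult)
  then have "x powr (- a - 1) \<le> 2 powr (a + 1) * z powr (- a - 1)"
  proof -
    have "2 powr (a + 1) * 2 powr (- a - 1) = (1::real)" by (simp flip: powr_add)
    then show ?thesis using \<open>2 powr (a + 1) * _ \<le> _\<close> by (simp only: mult.assoc[symmetric])
  qed
  then show ?thesis using z(3) assms by simp
qed

text \<open>
  The increments are summable locally uniformly, so the limit is holomorphic for \<open>Re s > 0\<close>
  and must be \<open>\<zeta>\<close>, with which it agrees for \<open>Re s > 1\<close>. The error is the tail of the increments.
\<close>
lemma zeta_partial_error:
  assumes s: "Re s > 0" "s \<noteq> 1" and N: "N \<ge> 1"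
  shows "norm (zeta s - zeta_partial N s) \<le> norm s * (2 powr (Re s + 1) / Re s) * real N powr (- Re s)"
proof -
  define S where "S = {s. Re s > 0} - {1::complex}"
  have S: "open S" unfolding S_def by (intro open_delete open_Re_gt)
  define f where "f = (\<lambda>n s. zeta_partial (Suc (Suc n)) s - zeta_partial (Suc n) s)"
  have hol0: "zeta_partial n holomorphic_on S" if "n \<ge> 1" for n
    unfolding zeta_partial_def S_def using that by (intro holomorphic_intros) auto
  have hol: "f n holomorphic_on S" for n
    unfolding f_def by (intro holomorphic_intros hol0) auto
  have fbd: "norm (f n s) \<le> norm s * real (Suc n) powr (- Re s - 1)" if s: "s \<in> S" for n s
    unfolding f_def using s by (intro zeta_partial_step_bound) (auto simp: S_def)
  have bd: "\<exists>d>0. \<exists>h::nat\<Rightarrow>real. summable h \<and> (\<forall>n. \<forall>y\<in>ball s d \<inter> S. norm (f n y) \<le> h n)"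
    if "s \<in> S" for s
    by (rule local_bound[OF S that _ _ fbd]) (use that in \<open>auto simp: S_def intro!: continuous_intros\<close>)
  define A where "A = (\<lambda>s. zeta_partial 1 s + (\<Sum>n. f n s))"
  have A: "A holomorphic_on S" unfolding A_def
    by (intro holomorphic_intros holomorphic_series(1)[OF S hol bd] hol0) auto
  have lim: "(\<lambda>n. zeta_partial (Suc n) s) \<longlonglongrightarrow> A s" if "s \<in> S" for s
  proof -
    have "summable (\<lambda>n. f n s)" using holomorphic_series(2)[OF S hol bd that] .
    then have "(\<lambda>n. \<Sum>k<n. f k s) \<longlonglongrightarrow> (\<Sum>n. f n s)" by (rule summable_LIMSEQ)
    moreover have "(\<Sum>k<n. f k s) = zeta_partial (Suc n) s - zeta_partial 1 s" for n
      unfolding f_def by (induction n) (auto)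
    ultimately have "(\<lambda>n. zeta_partial (Suc n) s - zeta_partial 1 s) \<longlonglongrightarrow> (\<Sum>n. f n s)" by simp
    from tendsto_add[OF tendsto_const[of "zeta_partial 1 s"] this]
    show ?thesis by (simp add: A_def)
  qed
  have conn: "connected S" unfolding S_def
    by (intro connected_open_delete open_Re_gt convex_connected convex_halfspace_Re_gt) auto
  have zeta: "zeta holomorphic_on S" using is_zeta_zeta unfolding is_zeta_def S_def
    by (auto elim!: holomorphic_on_subset)
  have eq1: "zeta s = A s" if s: "Re s > 1" for s
  proof -
    have sS: "s \<in> S" using s by (auto simp: S_def)
    have "(\<lambda>n. of_nat (Suc n) powr (- s)) sums zeta s" using is_zeta_zeta s by (auto simp: is_zeta_def)
    then have 1: "(\<lambda>n. \<Sum>k<Suc n. of_nat (Suc k) powr (- s)) \<longlonglongrightarrow> zeta s"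
      unfolding sums_def by (rule LIMSEQ_Suc)
    have "(\<lambda>n. real n powr (1 - Re s)) \<longlonglongrightarrow> 0"
      using s by (intro tendsto_neg_powr filterlim_real_sequentially) auto
    then have "(\<lambda>n. real (Suc n) powr (1 - Re s) / norm (1 - s)) \<longlonglongrightarrow> 0 / norm (1 - s)"
      using sS by (intro tendsto_divide tendsto_const LIMSEQ_Suc[of "\<lambda>n. real n powr (1 - Re s)"]) (auto simp: S_def)
    then have "(\<lambda>n. norm (of_nat (Suc n) powr (1 - s) / (1 - s))) \<longlonglongrightarrow> 0"
      unfolding norm_divide by (simp add: norm_powr_real_powr del: of_nat_Suc)
    then have 2: "(\<lambda>n. of_nat (Suc n) powr (1 - s) / (1 - s)) \<longlonglongrightarrow> 0"
      using tendsto_norm_zero_iff by blast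
    have "(\<lambda>n. zeta_partial (Suc n) s) \<longlonglongrightarrow> zeta s - 0"
      unfolding zeta_partial_def using tendsto_diff[OF 1 2] by simp
    then have "(\<lambda>n. zeta_partial (Suc n) s) \<longlonglongrightarrow> zeta s" by simp
    then show ?thesis using LIMSEQ_unique lim[OF sS] by blast
  qed
  have eq: "zeta s = A s" if "s \<in> S" for s
  proof (rule analytic_continuation_open[of "{s. Re s > 1}" S zeta A])
    show "{s. Re s > 1} \<noteq> {}" using exI[of "\<lambda>s. Re s > 1" 2] by auto
  qed (use S conn that open_Re_gt zeta A eq1 in \<open>auto simp: S_def\<close>)
  have sS: "s \<in> S" using s by (auto simp: S_def)
  let ?C = "norm s * (2 powr (Re s + 1) / Re s)"
  have step1: "norm (zeta_partial (Suc n) s - zeta_partial n s) \<le> ?C * (real n powr (- Re s) - real (Suc n) powr (- Re s))"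
    if "n \<ge> 1" for n
  proof -
    have "norm (zeta_partial (Suc n) s - zeta_partial n s) \<le> norm s * real n powr (- Re s - 1)"
      using that s by (intro zeta_partial_step_bound) auto
    also have "\<dots> \<le> norm s * (2 powr (Re s + 1) / Re s * (real n powr (- Re s) - (real n + 1) powr (- Re s)))"
      using that s by (intro mult_left_mono powr_telescope_bound) auto
    finally show ?thesis by (simp only: mult.assoc of_nat_Suc add.commute[of 1])
  qed
  have fin: "norm (zeta_partial M s - zeta_partial N s) \<le> ?C * (real N powr (- Re s) - real M powr (- Re s))"
    if "M \<ge> N" for M using that
  proof (induction M rule: dec_induct)
    case base then show ?case by simp
  next
    case (step n)
    have "norm (zeta_partial (Suc n) s - zeta_partial N s) \<le> norm (zeta_partial (Suc n) s - zeta_partial n s) + norm (zeta_partial n s - zeta_partial N s)"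
      using norm_triangle_ineq[of "zeta_partial (Suc n) s - zeta_partial n s" "zeta_partial n s - zeta_partial N s"] by simp
    also have "\<dots> \<le> ?C * (real n powr (- Re s) - real (Suc n) powr (- Re s)) + ?C * (real N powr (- Re s) - real n powr (- Re s))"
      using step N by (intro add_mono step1 step.IH) auto
    also have "\<dots> = ?C * (real N powr (- Re s) - real (Suc n) powr (- Re s))"
      by (subst distrib_left[symmetric]) simp
    finally show ?case .
  qed
  have "(\<lambda>n. norm (zeta_partial (Suc n) s - zeta_partial N s)) \<longlonglongrightarrow> norm (zeta s - zeta_partial N s)"
    using lim[OF sS] eq[OF sS] by (intro tendsto_intros) auto
  moreover have "\<exists>k. \<forall>n\<ge>k. norm (zeta_partial (Suc n) s - zeta_partial N s) \<le> ?C * real N powr (- Re s)"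
  proof (intro exI[of _ N] allI impI)
    fix n assume n: "n \<ge> N"
    have "?C * (real N powr (- Re s) - real (Suc n) powr (- Re s)) \<le> ?C * real N powr (- Re s)"
      using s by (intro mult_left_mono) auto
    then show "norm (zeta_partial (Suc n) s - zeta_partial N s) \<le> ?C * real N powr (- Re s)"
      using fin[of "Suc n"] n by linarith
  qed
  ultimately show ?thesis by (rule LIMSEQ_le_const2)
qed

lemma zeta_partial_tendsto:
  assumes s: "Re s > 0" "s \<noteq> 1"
  shows "(\<lambda>N. zeta_partial N s) \<longlonglongrightarrow> zeta s"
proof -
  define C where "C = norm s * (2 powr (Re s + 1) / Re s)"
  have "(\<lambda>n. real n powr (- Re s)) \<longlonglongrightarrow> 0"
    using s by (intro tendsto_neg_powr filterlim_real_sequentially) auto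
  then have "(\<lambda>n. C * real n powr (- Re s)) \<longlonglongrightarrow> 0" by (rule tendsto_mult_right_zero)
  have "eventually (\<lambda>n. norm (zeta_partial n s - zeta s) \<le> C * real n powr (- Re s)) sequentially"
    using eventually_ge_at_top[of 1]
  proof eventually_elim
    case (elim n) then show ?case using zeta_partial_error[OF s elim] by (simp add: C_def norm_minus_commute)
  qed
  then have "(\<lambda>n. zeta_partial n s - zeta s) \<longlonglongrightarrow> 0" by (rule Lim_null_comparison) fact
  then show ?thesis by (simp add: LIM_zero_iff)
qed

lemma powr_Suc_le_diff:
  assumes "0 < x" "x < 1" "N \<ge> 1"
  shows "real (Suc N) powr (- x) \<le> (real (Suc N) powr (1 - x) - real N powr (1 - x)) / (1 - x)"
proof -
  have "\<exists>z>real N. z < real N + 1 \<and> (real N + 1) powr (1 - x) - real N powr (1 - x) = (real N + 1 - real N) * ((1 - x) * z powr (- x))"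
  proof (intro MVT2)
    fix y assume "real N \<le> y" "y \<le> real N + 1"
    then show "((\<lambda>y. y powr (1 - x)) has_real_derivative (1 - x) * y powr (- x)) (at y)"
      using assms has_real_derivative_powr[of y "1 - x"] by simp
  qed auto
  then obtain z where z: "real N < z" "z < real N + 1" "(real N + 1) powr (1 - x) - real N powr (1 - x) = (1 - x) * z powr (- x)"
    by auto
  have "(real N + 1) powr (- x) \<le> z powr (- x)" using z assms by (intro powr_mono2') auto
  also have "z powr (- x) = ((real N + 1) powr (1 - x) - real N powr (1 - x)) / (1 - x)" using z assms by simp
  finally show ?thesis by (simp add: add.commute)
qed
text \<open>
  On the real interval the corrected partial sums decrease, since each new term is smaller
  than the integral that is subtracted with it. Hence \<open>\<zeta>(x)\<close> is at most the first of them,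
  \<open>1 - 1 / (1 - x)\<close>. This is what makes \<open>1 / \<zeta>(2s)\<close> regular on the real segment on which
  Landau's theorem is applied.
\<close>
lemma zeta_neg_real:
  assumes "0 < x" "x < 1"
  shows "Re (zeta (of_real x)) < 0"
proof -
  have zp: "Re (zeta_partial N (of_real x)) = (\<Sum>n<N. real (Suc n) powr (- x)) - real N powr (1 - x) / (1 - x)" for N
  proof -
    have "of_nat m powr (- complex_of_real x) = of_real (real m powr (- x))"
      "of_nat m powr (1 - complex_of_real x) = of_real (real m powr (1 - x))" for m
      using powr_of_real[of "real m" "- x"] powr_of_real[of "real m" "1 - x"] by simp_all
    then have "zeta_partial N (of_real x) = of_real ((\<Sum>n<N. real (Suc n) powr (- x)) - real N powr (1 - x) / (1 - x))"
      by (simp add: zeta_partial_def del: of_nat_Suc)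
    then show ?thesis by simp
  qed
  have step: "Re (zeta_partial (Suc N) (of_real x)) \<le> Re (zeta_partial N (of_real x))" if "N \<ge> 1" for N
    using powr_Suc_le_diff[OF assms that] unfolding zp by (simp add: diff_divide_distrib)
  have "Re (zeta_partial N (of_real x)) \<le> Re (zeta_partial 1 (of_real x))" if "N \<ge> 1" for N
    using that by (induction N rule: dec_induct) (use step in \<open>auto intro: order_trans\<close>)
  moreover have "(\<lambda>N. Re (zeta_partial N (of_real x))) \<longlonglongrightarrow> Re (zeta (of_real x))"
    using assms by (intro tendsto_intros zeta_partial_tendsto) auto
  ultimately have "Re (zeta (of_real x)) \<le> Re (zeta_partial 1 (of_real x))"
    by (intro LIMSEQ_le_const2) auto
  also have "\<dots> = 1 - 1 / (1 - x)" unfolding zp by simp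
  also have "\<dots> < 0" using assms by (simp add: field_simps)
  finally show ?thesis .
qed

text \<open>
  The first corrected partial sum is \<open>1 + 1 / (s - 1)\<close>, and its distance to \<open>\<zeta>(s)\<close> stays bounded near \<open>1\<close>.
\<close>
lemma zeta_simple_pole:
  obtains h where "h holomorphic_on {s. Re s > 0}" "h 1 = 1"
    "\<And>s. Re s > 0 \<Longrightarrow> s \<noteq> 1 \<Longrightarrow> h s = (s - 1) * zeta s"
proof -
  have hol: "(\<lambda>s. (s - 1) * zeta s) holomorphic_on {s. Re s > 0} - {1}"
    using is_zeta_zeta unfolding is_zeta_def
    by (intro holomorphic_intros) (auto elim!: holomorphic_on_subset)
  have ev: "eventually (\<lambda>s::complex. Re s > 1/2 \<and> norm s < 2) (at 1)"
  proof -
    have "open ({s::complex. Re s > 1/2} \<inter> ball 0 2)" by (intro open_Int open_Re_gt open_ball)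
    then have "eventually (\<lambda>s. s \<in> {s::complex. Re s > 1/2} \<inter> ball 0 2) (nhds 1)"
      by (rule eventually_nhds_in_open) auto
    then show ?thesis by (auto simp: eventually_at_filter elim!: eventually_mono)
  qed
  have lim: "((\<lambda>s. (s - 1) * zeta s) \<longlongrightarrow> 1) (at 1)"
  proof -
    have "((\<lambda>s::complex. norm (s - 1) * 33) \<longlongrightarrow> norm (1 - 1 :: complex) * 33) (at 1)"
      by (intro tendsto_intros)
    then have 0: "((\<lambda>s::complex. norm (s - 1) * 33) \<longlongrightarrow> 0) (at 1)" by simp
    have "eventually (\<lambda>s. s \<noteq> 1) (at (1::complex))" by (rule eventually_neq_at_within)
    with ev have "eventually (\<lambda>s. norm ((s - 1) * zeta s - 1) \<le> norm (s - 1) * 33) (at 1)"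
    proof eventually_elim
      case (elim s)
      have "norm (zeta s - zeta_partial 1 s) \<le> norm s * (2 powr (Re s + 1) / Re s) * real 1 powr (- Re s)"
        using elim by (intro zeta_partial_error) auto
      also have "\<dots> \<le> 2 * (2 powr 3 / (1/2)) * 1"
        using elim complex_Re_le_cmod[of s] by (intro mult_mono frac_le powr_mono) auto
      finally have *: "norm (zeta s - zeta_partial 1 s) \<le> 32" by simp
      have "(s - 1) * zeta s - 1 = (s - 1) * (zeta s - zeta_partial 1 s) + (s - 1)"
        using elim by (simp add: zeta_partial_def field_simps)
      then have "norm ((s - 1) * zeta s - 1) \<le> norm (s - 1) * norm (zeta s - zeta_partial 1 s) + norm (s - 1)"
        by (metis norm_mult norm_triangle_ineq)
      also have "\<dots> \<le> norm (s - 1) * 32 + norm (s - 1)" using * by (intro add_mono mult_left_mono) auto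
      finally show ?case by simp
    qed
    then have "((\<lambda>s. (s - 1) * zeta s - 1) \<longlongrightarrow> 0) (at 1)" using 0 by (rule Lim_null_comparison)
    then show ?thesis by (simp add: LIM_zero_iff)
  qed
  define h where "h = (\<lambda>s. if s = 1 then 1 else (s - 1) * zeta s)"
  have "h holomorphic_on {s. Re s > 0}"
    unfolding h_def using hol lim by (intro removable_singularity) (auto intro: open_Re_gt)
  then show thesis by (intro that[of h]) (auto simp: h_def)
qed

text \<open>
  Termwise comparison of the series from \<open>n = 2\<close> on with the series of \<open>\<zeta>(2)\<close>.
\<close>
lemma zeta_near_one:
  assumes "Re s \<ge> 2"
  shows "norm (zeta s - 1) \<le> (pi ^ 2 / 6 - 1) * (1/2) powr (Re s - 2)"
proof -
  have z: "(\<lambda>n. of_nat (Suc n) powr (- s)) sums zeta s"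
    using is_zeta_zeta assms by (auto simp: is_zeta_def)
  then have z1: "(\<lambda>n. of_nat (Suc (Suc n)) powr (- s)) sums (zeta s - 1)"
    by (subst sums_Suc_iff) simp
  have "(\<lambda>n. 1 / real (Suc n) ^ 2) sums (pi\<^sup>2 / 6)" using inverse_squares_sums by (simp add: add.commute)
  then have s1: "(\<lambda>n. 1 / real (Suc (Suc n)) ^ 2) sums (pi\<^sup>2 / 6 - 1)"
    by (subst sums_Suc_iff) simp
  have s2: "(\<lambda>n. 1 / real (Suc (Suc n)) ^ 2 * (1/2) powr (Re s - 2)) sums ((pi\<^sup>2 / 6 - 1) * (1/2) powr (Re s - 2))"
    by (rule sums_mult2[OF s1])
  have bd: "norm (of_nat (Suc (Suc n)) powr (- s) :: complex) \<le> 1 / real (Suc (Suc n)) ^ 2 * (1/2) powr (Re s - 2)" for n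
  proof -
    let ?m = "real (Suc (Suc n))"
    have "norm (of_nat (Suc (Suc n)) powr (- s) :: complex) = ?m powr (- Re s)"
      by (simp add: norm_powr_real_powr del: of_nat_Suc)
    also have "\<dots> = ?m powr (- 2) * (1 / ?m) powr (Re s - 2)"
    proof -
      have "(1 / ?m) powr (Re s - 2) = ?m powr (2 - Re s)"
        using powr_minus[of ?m "Re s - 2"] by (simp add: powr_divide inverse_eq_divide del: of_nat_Suc)
      then show ?thesis by (simp only: powr_add[symmetric]) simp
    qed
    also have "\<dots> \<le> ?m powr (- 2) * (1 / 2) powr (Re s - 2)"
      using assms by (intro mult_left_mono powr_mono2) auto
    also have "?m powr (- 2) = 1 / ?m ^ 2" by (simp add: powr_minus powr_numeral inverse_eq_divide del: of_nat_Suc)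
    finally show ?thesis .
  qed
  have "norm (\<Sum>n. of_nat (Suc (Suc n)) powr (- s) :: complex) \<le> (\<Sum>n. 1 / real (Suc (Suc n)) ^ 2 * (1/2) powr (Re s - 2))"
    by (intro norm_suminf_le bd sums_summable[OF s2])
  then show ?thesis by (simp only: sums_unique[OF z1, symmetric] sums_unique[OF s2, symmetric])
qed

lemma zeta_nonzero_Re_ge_2: "Re s \<ge> 2 \<Longrightarrow> zeta s \<noteq> 0"
proof
  assume s: "Re s \<ge> 2" and z: "zeta s = 0"
  have "norm (zeta s - 1) \<le> (pi ^ 2 / 6 - 1) * (1/2) powr (Re s - 2)" by (rule zeta_near_one[OF s])
  also have "\<dots> \<le> (pi ^ 2 / 6 - 1) * 1"
    using s pi_gt3 power_strict_mono[of 3 pi 2] by (intro mult_left_mono powr_le1) auto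
  also have "pi ^ 2 \<le> 3.2 ^ 2" using pi_approx by (intro power_mono) auto
  finally show False using z by (simp add: power2_eq_square)
qed

text \<open>
  Linear growth in vertical strips is crude, but the weight used for the first moment below
  decays fast enough on the horizontal sides to absorb four such factors.
\<close>
lemma zeta_growth:
  assumes "a > 0"
  obtains K where "K > 0" "\<And>s. a \<le> Re s \<Longrightarrow> Re s \<le> b \<Longrightarrow> \<bar>Im s\<bar> \<ge> 1 \<Longrightarrow> norm (zeta s) \<le> K * \<bar>Im s\<bar>"
proof -
  define B where "B = max b 1"
  define K where "K = 2 + (B + 1) * (2 powr (B + 1) / a)"
  show thesis
  proof (rule that[of K])
    show "K > 0" using assms by (auto simp: K_def B_def intro!: add_pos_nonneg mult_nonneg_nonneg)
    fix s assume s: "a \<le> Re s" "Re s \<le> b" "\<bar>Im s\<bar> \<ge> 1"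
    have s1: "s \<noteq> 1" using s by auto
    have "norm s \<le> \<bar>Re s\<bar> + \<bar>Im s\<bar>" by (rule cmod_le)
    also have "\<dots> \<le> B * \<bar>Im s\<bar> + \<bar>Im s\<bar>"
      using s assms mult_mono[of "\<bar>Re s\<bar>" B 1 "\<bar>Im s\<bar>"] by (auto simp: B_def)
    finally have ns: "norm s \<le> (B + 1) * \<bar>Im s\<bar>" by (simp add: algebra_simps)
    have "norm (zeta s - zeta_partial 1 s) \<le> norm s * (2 powr (Re s + 1) / Re s) * real 1 powr (- Re s)"
      using s s1 assms by (intro zeta_partial_error) auto
    also have "\<dots> \<le> ((B + 1) * \<bar>Im s\<bar>) * (2 powr (B + 1) / a) * 1"
      using s ns assms by (intro mult_mono frac_le powr_mono) (auto simp: B_def)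
    finally have 1: "norm (zeta s - zeta_partial 1 s) \<le> (B + 1) * (2 powr (B + 1) / a) * \<bar>Im s\<bar>" by (simp add: algebra_simps)
    have "1 \<le> norm (1 - s)" using s abs_Im_le_cmod[of "1 - s"] by auto
    then have "norm (1 / (1 - s)) \<le> 1" by (simp add: norm_divide divide_le_eq_1)
    then have "norm (1 - 1 / (1 - s)) \<le> 2" using norm_triangle_ineq4[of 1 "1 / (1 - s)"] by simp
    also have "\<dots> \<le> 2 * \<bar>Im s\<bar>" using s by simp
    finally have 2: "norm (zeta_partial 1 s) \<le> 2 * \<bar>Im s\<bar>" by (simp add: zeta_partial_def)
    have "norm (zeta s) \<le> norm (zeta s - zeta_partial 1 s) + norm (zeta_partial 1 s)"
      by (metis diff_add_cancel norm_triangle_ineq)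
    then show "norm (zeta s) \<le> K * \<bar>Im s\<bar>" using 1 2 by (simp add: K_def algebra_simps)
  qed
qed

section \<open>Ramanujan's product formula\<close>

\<comment> \<open>Frees the infix for the operator of the same name on set-indexed sums.\<close>
no_notation Infinite_Set_Sum.abs_summable_on (infix \<open>abs'_summable'_on\<close> 50)

lemma abs_summable_on_mult_Times:
  fixes f :: "'a \<Rightarrow> complex" and g :: "'b \<Rightarrow> complex"
  assumes "f abs_summable_on A" "g abs_summable_on B"
  shows "(\<lambda>(x,y). f x * g y) abs_summable_on A \<times> B"
proof (subst Infinite_Sum.abs_summable_on_Sigma_iff, intro conjI ballI)
  fix x assume "x \<in> A"
  show "(\<lambda>y. case (x, y) of (x, y) \<Rightarrow> f x * g y) abs_summable_on B"
    using assms(2) by (auto simp: norm_mult intro: summable_on_cmult_right)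
next
  have "(\<lambda>x. norm (f x) * infsum (\<lambda>y. norm (g y)) B) summable_on A"
    using assms(1) by (rule summable_on_cmult_left)
  moreover have "infsum (\<lambda>y. norm (case (x, y) of (x, y) \<Rightarrow> f x * g y)) B = norm (f x) * infsum (\<lambda>y. norm (g y)) B" for x
    by (simp add: norm_mult infsum_cmult_right')
  moreover have "infsum (\<lambda>y. norm (g y)) B \<ge> 0" by (rule infsum_nonneg) auto
  ultimately show "(\<lambda>x. \<Sum>\<^sub>\<infinity>y\<in>B. norm (case (x, y) of (x, y) \<Rightarrow> f x * g y)) abs_summable_on A"
    by simp
qed

lemma has_sum_mult_Times:
  fixes f :: "'a \<Rightarrow> complex" and g :: "'b \<Rightarrow> complex"
  assumes "f abs_summable_on A" "g abs_summable_on B" "(f has_sum a) A" "(g has_sum b) B"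
  shows "((\<lambda>(x,y). f x * g y) has_sum (a * b)) (A \<times> B)"
proof (rule has_sum_SigmaI)
  show "((\<lambda>y. case (x, y) of (x, y) \<Rightarrow> f x * g y) has_sum (f x * b)) B" for x
    using has_sum_cmult_right[OF assms(4)] by simp
  show "((\<lambda>x. f x * b) has_sum a * b) A"
    using assms(3) by (rule has_sum_cmult_left)
  show "(\<lambda>(x, y). f x * g y) summable_on A \<times> B"
    by (rule abs_summable_summable[OF abs_summable_on_mult_Times[OF assms(1,2)]])
qed

lemma of_nat_powr_exp: "n > 0 \<Longrightarrow> of_nat n powr (z::complex) = exp (z * of_real (ln (real n)))"
  by (simp add: powr_def flip: Ln_of_nat)

lemma zeta_has_sum:
  assumes "Re s > 1"
  shows "(\<lambda>n. of_nat n powr (- s) :: complex) abs_summable_on {1..}"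
    and "((\<lambda>n. of_nat n powr (- s)) has_sum zeta s) {1..}"
proof -
  have sums: "(\<lambda>n. of_nat (Suc n) powr (- s)) sums zeta s"
    using is_zeta_zeta assms by (auto simp: is_zeta_def)
  have norm: "summable (\<lambda>n. norm (of_nat (Suc n) powr (- s) :: complex))"
    using summable_Suc_powr[of "- Re s"] assms by (simp add: norm_powr_real_powr del: of_nat_Suc)
  have "((\<lambda>n. of_nat (Suc n) powr (- s)) has_sum zeta s) UNIV"
    by (rule norm_summable_imp_has_sum[OF norm sums])
  also have "?this \<longleftrightarrow> ((\<lambda>n. of_nat n powr (- s)) has_sum zeta s) {1..}"
    by (intro has_sum_reindex_bij_witness[of _ "\<lambda>n. n - 1" Suc]) auto
  finally show "((\<lambda>n. of_nat n powr (- s)) has_sum zeta s) {1..}" .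
  have "(\<lambda>n. norm (of_nat (Suc n) powr (- s) :: complex)) summable_on UNIV"
    using norm by (intro norm_summable_imp_summable_on) simp
  also have "?this \<longleftrightarrow> (\<lambda>n. norm (of_nat n powr (- s) :: complex)) summable_on {1..}"
    by (intro summable_on_reindex_bij_witness[of _ "\<lambda>n. n - 1" Suc]) auto
  finally show "(\<lambda>n. of_nat n powr (- s) :: complex) abs_summable_on {1..}" .
qed

text \<open>
  The substitution behind Ramanujan's formula. Divisors \<open>d\<close>, \<open>e\<close> of \<open>n\<close> are \<open>d = g u\<close>, \<open>e = g v\<close>
  with \<open>u\<close>, \<open>v\<close> coprime and \<open>n = g k u v\<close>. With one more factor \<open>m\<close>, the numbers \<open>b = m u\<close> and
  \<open>c = m v\<close> become arbitrary. So \<open>(m, n, d, e)\<close> corresponds to \<open>(g, k, b, c)\<close>, bijectively between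
  the quadruples in which \<open>d\<close> and \<open>e\<close> divide \<open>n\<close> and all quadruples of positive integers.
\<close>
abbreviation divisor_pairs :: "nat \<Rightarrow> (nat \<times> nat) set" where
  "divisor_pairs n \<equiv> {d. d dvd n} \<times> {e. e dvd n}"

definition split_divisors :: "nat \<times> nat \<times> nat \<times> nat \<Rightarrow> (nat \<times> nat) \<times> nat \<times> nat" where
  "split_divisors = (\<lambda>(m, n, d, e). ((gcd d e, n div lcm d e), m * (d div gcd d e), m * (e div gcd d e)))"

definition join_divisors :: "(nat \<times> nat) \<times> nat \<times> nat \<Rightarrow> nat \<times> nat \<times> nat \<times> nat" where
  "join_divisors = (\<lambda>((g, k), b, c). let m = gcd b c; u = b div m; v = c div m in (m, g * k * u * v, g * u, g * v))"

lemma lcm_mult_coprime: "coprime u v \<Longrightarrow> lcm (g * u) (g * v) = g * u * (v::nat)"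
  by (simp add: lcm_mult_left lcm_coprime mult.assoc)

lemma gcd_mult_coprime: "coprime u v \<Longrightarrow> gcd (g * u) (g * v) = (g::nat)"
  by (simp add: gcd_mult_left)

lemma divisors_param:
  assumes "n > 0" "d dvd n" "e dvd (n::nat)"
  obtains g u v k where "d = g * u" "e = g * v" "coprime u v" "n = g * k * u * v" "g > 0" "u > 0" "v > 0" "k > 0"
proof -
  define g where "g = gcd d e"
  have d0: "d > 0" "e > 0" using assms by (auto intro: Nat.gr0I)
  have g0: "g > 0" using d0 by (simp add: g_def)
  define u v where "u = d div g" and "v = e div g"
  have d: "d = g * u" "e = g * v" by (simp_all add: u_def v_def g_def)
  have cop: "coprime u v" unfolding u_def v_def g_def using d0 by (intro div_gcd_coprime) auto
  have "lcm d e dvd n" using assms by simp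
  then obtain k where "n = lcm d e * k" by (elim dvdE)
  then have n: "n = g * k * u * v" using d lcm_mult_coprime[OF cop] by (simp add: ac_simps)
  have "u > 0" "v > 0" "k > 0" using d d0 n assms by (auto intro: Nat.gr0I)
  with that d cop n g0 show thesis by blast
qed

lemma split_divisors_param:
  assumes "coprime u v" "g > 0" "u > 0" "v > 0"
  shows "split_divisors (m, g * k * u * v, g * u, g * v) = ((g, k), m * u, m * v)"
proof -
  have "g * k * u * v = (g * u * v) * k" by (simp add: ac_simps)
  then show ?thesis using assms
    by (simp add: split_divisors_def lcm_mult_coprime gcd_mult_coprime)
qed

lemma join_divisors_param:
  assumes "coprime u v" "m > 0"
  shows "join_divisors ((g, k), m * u, m * v) = (m, g * k * u * v, g * u, g * v)"
  using assms by (simp add: join_divisors_def gcd_mult_coprime Let_def)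

lemma cnj_of_nat_powr_imag: "n > 0 \<Longrightarrow> cnj (of_nat n powr (\<i> * of_real t)) = of_nat n powr (- \<i> * of_real t)"
  by (simp add: of_nat_powr_exp exp_cnj)

lemma norm_tau_squared:
  assumes "n > 0"
  shows "complex_of_real ((cmod (tau n \<theta>))\<^sup>2)
    = (\<Sum>(d, e)\<in>divisor_pairs n. of_nat d powr (\<i> * of_real \<theta>) * of_nat e powr (- \<i> * of_real \<theta>))"
proof -
  have "complex_of_real ((cmod (tau n \<theta>))\<^sup>2) = tau n \<theta> * cnj (tau n \<theta>)"
    by (simp only: complex_norm_square)
  also have "cnj (tau n \<theta>) = (\<Sum>e | e dvd n. of_nat e powr (- \<i> * of_real \<theta>))"
    unfolding tau_def cnj_sum using assms
    by (intro sum.cong refl cnj_of_nat_powr_imag) (auto intro: Nat.gr0I)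
  finally show ?thesis
    by (simp add: tau_def sum_product sum.cartesian_product)
qed

lemma dirichlet_term_factor:
  fixes s :: complex and t :: real
  assumes "m > 0" "g > 0" "k > 0" "u > 0" "v > 0"
  shows "of_nat m powr (- (2 * s)) * (of_nat (g * k * u * v) powr (- s) *
      (of_nat (g * u) powr (\<i> * of_real t) * of_nat (g * v) powr (- \<i> * of_real t)))
    = (of_nat g powr (- s) * of_nat k powr (- s)) *
      (of_nat (m * u) powr (- (s - \<i> * of_real t)) * of_nat (m * v) powr (- (s + \<i> * of_real t)))"
proof -
  have pos: "g * k * u * v > 0" "g * u > 0" "g * v > 0" "m * u > 0" "m * v > 0" using assms by auto
  show ?thesis using assms
    by (simp only: of_nat_powr_exp[OF assms(1)] of_nat_powr_exp[OF assms(2)] of_nat_powr_exp[OF assms(3)]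
        of_nat_powr_exp[OF pos(1)] of_nat_powr_exp[OF pos(2)] of_nat_powr_exp[OF pos(3)]
        of_nat_powr_exp[OF pos(4)] of_nat_powr_exp[OF pos(5)] exp_add[symmetric])
      (simp add: ln_mult algebra_simps)
qed

text \<open>
  Both sides are the same absolutely convergent sum over quadruples. Summing over \<open>(g, k, b, c)\<close>
  gives the four zeta factors on the right. Summing over \<open>(m, n, d, e)\<close> gives \<open>\<zeta>(2s)\<close> from \<open>m\<close>
  and the divisor sums \<open>|\<tau>(n, \<theta>)|\<^sup>2\<close> from \<open>d\<close> and \<open>e\<close>. The slice \<open>m = 1\<close> yields
  the convergence of the Dirichlet series.
\<close>
theorem ramanujan_identity:
  fixes \<theta> :: real
  assumes s: "Re s > 1"
  defines "a \<equiv> \<lambda>n. (cmod (tau n \<theta>))\<^sup>2"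
  shows "summable (\<lambda>n. a (Suc n) * real (Suc n) powr (- Re s))"
    and "zeta (2 * s) * (\<Sum>n. of_real (a (Suc n)) * of_nat (Suc n) powr (- s))
      = zeta s ^ 2 * zeta (s + \<i> * of_real \<theta>) * zeta (s - \<i> * of_real \<theta>)"
proof -
  let ?P = "{1::nat..}"
  let ?U = "Sigma ?P divisor_pairs"
  define h where "h = (\<lambda>x::(nat \<times> nat) \<times> nat \<times> nat. case x of (y, z) \<Rightarrow>
      (case y of (g, k) \<Rightarrow> of_nat g powr (- s) * of_nat k powr (- s)) *
      (case z of (b, c) \<Rightarrow> of_nat b powr (- (s - \<i> * of_real \<theta>)) * of_nat c powr (- (s + \<i> * of_real \<theta>))))"
  define w where "w = (\<lambda>(n::nat, d::nat, e::nat). of_nat n powr (- s) *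
      (of_nat d powr (\<i> * of_real \<theta>) * of_nat e powr (- \<i> * of_real \<theta>)))"
  define q where "q = (\<lambda>(m::nat, x). of_nat m powr (- (2 * s)) * w x)"
  have s': "Re (s - \<i> * of_real \<theta>) > 1" "Re (s + \<i> * of_real \<theta>) > 1" "Re (2 * s) > 1" using s by auto
  note Z = zeta_has_sum[OF s] and Z1 = zeta_has_sum[OF s'(1)] and Z2 = zeta_has_sum[OF s'(2)]
  have h_abs: "h abs_summable_on (?P \<times> ?P) \<times> (?P \<times> ?P)"
    unfolding h_def by (intro abs_summable_on_mult_Times Z Z1 Z2)
  have h_sum: "(h has_sum (zeta s * zeta s) * (zeta (s - \<i> * of_real \<theta>) * zeta (s + \<i> * of_real \<theta>))) ((?P \<times> ?P) \<times> (?P \<times> ?P))"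
    unfolding h_def by (intro has_sum_mult_Times abs_summable_on_mult_Times Z Z1 Z2)
  have bij: "join_divisors (split_divisors x) = x \<and> split_divisors x \<in> (?P \<times> ?P) \<times> (?P \<times> ?P) \<and> h (split_divisors x) = q x"
    if "x \<in> ?P \<times> ?U" for x
  proof -
    obtain m n d e where x: "x = (m, n, d, e)" "m > 0" "n > 0" "d dvd n" "e dvd n" using \<open>x \<in> _\<close> by fastforce
    obtain g u v k where p: "d = g * u" "e = g * v" "coprime u v" "n = g * k * u * v" "g > 0" "u > 0" "v > 0" "k > 0"
      using divisors_param[OF x(3-5)] .
    have split: "split_divisors x = ((g, k), m * u, m * v)"
      unfolding x p(1,2,4) using p by (intro split_divisors_param) auto
    have join: "join_divisors ((g, k), m * u, m * v) = x"
      unfolding x p(1,2,4) using p x by (intro join_divisors_param) auto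
    have "h ((g, k), m * u, m * v) = q x"
      unfolding x(1) p(1,2,4) h_def q_def w_def prod.case
      by (rule dirichlet_term_factor[symmetric]) (use p x in auto)
    then show ?thesis using split join p x by auto
  qed
  have bij': "split_divisors (join_divisors y) = y \<and> join_divisors y \<in> ?P \<times> ?U" if "y \<in> (?P \<times> ?P) \<times> (?P \<times> ?P)" for y
  proof -
    obtain g k b c where y: "y = ((g, k), b, c)" "g > 0" "k > 0" "b > 0" "c > 0" using \<open>y \<in> _\<close> by fastforce
    define m u v where "m = gcd b c" and "u = b div m" and "v = c div m"
    have m: "m > 0" using y by (simp add: m_def)
    have bc: "b = m * u" "c = m * v" by (simp_all add: m_def u_def v_def)
    have cop: "coprime u v" unfolding u_def v_def m_def using y by (intro div_gcd_coprime) auto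
    have uv: "u > 0" "v > 0" using bc y by (auto intro: Nat.gr0I)
    have "join_divisors y = (m, g * k * u * v, g * u, g * v)"
      unfolding y(1) bc by (rule join_divisors_param[OF cop m])
    moreover have "split_divisors (m, g * k * u * v, g * u, g * v) = y"
      unfolding y(1) bc by (rule split_divisors_param[OF cop y(2) uv])
    moreover have "g * u dvd g * k * u * v" "g * v dvd g * k * u * v"
      by (auto intro: dvdI[of _ _ "k * v"] dvdI[of _ _ "k * u"] simp: ac_simps)
    ultimately show ?thesis using m y uv by auto
  qed
  have q_sum: "(q has_sum (zeta s * zeta s) * (zeta (s - \<i> * of_real \<theta>) * zeta (s + \<i> * of_real \<theta>))) (?P \<times> ?U)"
    using h_sum by (subst has_sum_reindex_bij_witness[of _ join_divisors split_divisors "(?P \<times> ?P) \<times> (?P \<times> ?P)" h])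
      (use bij bij' in auto)
  have q_abs: "q abs_summable_on ?P \<times> ?U"
    using h_abs by (subst summable_on_reindex_bij_witness[of _ join_divisors split_divisors "(?P \<times> ?P) \<times> (?P \<times> ?P)" "\<lambda>x. norm (h x)"])
      (use bij bij' in auto)
  have w_abs: "w abs_summable_on ?U"
  proof -
    have "(\<forall>x\<in>?P. (\<lambda>y. q (x, y)) abs_summable_on ?U)"
      by (rule conjunct1[OF iffD1[OF Infinite_Sum.abs_summable_on_Sigma_iff q_abs]])
    then have "(\<lambda>y. q (1, y)) abs_summable_on ?U" by force
    then show ?thesis by (simp add: q_def)
  qed
  define c where "c = (\<lambda>n. of_real (a n) * of_nat n powr (- s) :: complex)"
  have inner: "((\<lambda>x. w (n, x)) has_sum c n) (divisor_pairs n)" if "n \<in> ?P" for n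
  proof -
    have "finite {d. d dvd n}" using that by (intro finite_divisors_nat) auto
    then have "((\<lambda>x. w (n, x)) has_sum (\<Sum>x\<in>divisor_pairs n. w (n, x))) (divisor_pairs n)"
      by (intro has_sum_finite) auto
    also have "(\<Sum>x\<in>divisor_pairs n. w (n, x)) = of_nat n powr (- s) * of_real (a n)"
      unfolding a_def using that
      by (subst norm_tau_squared) (auto simp: w_def sum_distrib_left case_prod_unfold)
    finally show ?thesis by (simp add: c_def mult.commute)
  qed
  have c_sum: "(c has_sum infsum w ?U) ?P"
    using has_sum_infsum[OF abs_summable_summable[OF w_abs]] inner by (rule has_sum_SigmaD)
  have c_abs: "c abs_summable_on ?P"
  proof (rule Infinite_Sum.abs_summable_on_comparison_test')
    show "(\<lambda>n. infsum (\<lambda>x. norm (w (n, x))) (divisor_pairs n)) summable_on ?P"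
      by (rule abs_summable_summable[OF conjunct2[OF iffD1[OF Infinite_Sum.abs_summable_on_Sigma_iff w_abs]]])
    show "norm (c n) \<le> infsum (\<lambda>x. norm (w (n, x))) (divisor_pairs n)" if "n \<in> ?P" for n
    proof -
      have fin: "finite (divisor_pairs n)" using that by (auto intro!: finite_divisors_nat)
      have "c n = (\<Sum>x\<in>divisor_pairs n. w (n, x))"
        using has_sum_unique[OF inner[OF that] has_sum_finite[OF fin]] .
      then show ?thesis using fin by (simp add: norm_sum infsum_finite)
    qed
  qed
  have a0: "a n \<ge> 0" for n by (simp add: a_def)
  have "(\<lambda>n. norm (c n)) summable_on ?P \<longleftrightarrow> (\<lambda>n. norm (c (Suc n))) summable_on UNIV"
    by (intro summable_on_reindex_bij_witness[of _ Suc "\<lambda>n. n - 1"]) auto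
  then have "summable (\<lambda>n. norm (c (Suc n)))"
    using c_abs summable_on_UNIV_nonneg_real_iff[of "\<lambda>n. norm (c (Suc n))"] by simp
  then show "summable (\<lambda>n. a (Suc n) * real (Suc n) powr (- Re s))"
    using a0 by (simp add: c_def norm_mult norm_powr_real_powr del: of_nat_Suc)
  have "(c has_sum infsum w ?U) ?P \<longleftrightarrow> ((\<lambda>n. c (Suc n)) has_sum infsum w ?U) UNIV"
    by (intro has_sum_reindex_bij_witness[of _ Suc "\<lambda>n. n - 1"]) auto
  then have "(\<lambda>n. c (Suc n)) sums infsum w ?U" using c_sum has_sum_imp_sums by blast
  then have W: "(\<Sum>n. of_real (a (Suc n)) * of_nat (Suc n) powr (- s)) = infsum w ?U"
    by (simp add: c_def sums_iff)
  have "((\<lambda>m. of_nat m powr (- (2 * s)) * infsum w ?U) has_sum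
      (zeta s * zeta s) * (zeta (s - \<i> * of_real \<theta>) * zeta (s + \<i> * of_real \<theta>))) ?P"
    using q_sum
  proof (rule has_sum_SigmaD)
    fix m show "((\<lambda>y. q (m, y)) has_sum of_nat m powr (- (2 * s)) * infsum w ?U) ?U"
      using has_sum_cmult_right[OF has_sum_infsum[OF abs_summable_summable[OF w_abs]]]
      by (simp add: q_def)
  qed
  moreover have "((\<lambda>m. of_nat m powr (- (2 * s)) * infsum w ?U) has_sum (zeta (2 * s) * infsum w ?U)) ?P"
    by (intro has_sum_cmult_left zeta_has_sum s')
  ultimately have "zeta (2 * s) * infsum w ?U = (zeta s * zeta s) * (zeta (s - \<i> * of_real \<theta>) * zeta (s + \<i> * of_real \<theta>))"
    using has_sum_unique by blast
  then show "zeta (2 * s) * (\<Sum>n. of_real (a (Suc n)) * of_nat (Suc n) powr (- s))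
      = zeta s ^ 2 * zeta (s + \<i> * of_real \<theta>) * zeta (s - \<i> * of_real \<theta>)"
    unfolding W by (simp add: power2_eq_square)
qed

section \<open>Mellin transforms and the functional equation\<close>

text \<open>
  Complex powers of positive reals, written as an exponential so that measurability in \<open>x\<close> and
  additivity in the exponent hold without a case distinction at \<open>0\<close>.
\<close>
definition cpow :: "real \<Rightarrow> complex \<Rightarrow> complex" where
  "cpow x z = exp (z * of_real (ln x))"

lemma measurable_cpow [measurable]:
  assumes [measurable]: "f \<in> borel_measurable M"
  shows "(\<lambda>x. cpow (f x) z) \<in> borel_measurable M"
  unfolding cpow_def by measurable

lemma cpow_powr: "x > 0 \<Longrightarrow> of_real x powr z = cpow x z"
  by (simp add: cpow_def powr_def flip: Ln_of_real)

lemma norm_cpow: "x > 0 \<Longrightarrow> norm (cpow x z) = x powr Re z"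
  by (simp add: cpow_def powr_def)

lemma cpow_add: "cpow x (a + b) = cpow x a * cpow x b" by (simp add: cpow_def exp_add distrib_right)
lemma cpow_minus: "cpow x (- a) = inverse (cpow x a)" by (simp add: cpow_def exp_minus)
lemma cpow_mult: "x > 0 \<Longrightarrow> y > 0 \<Longrightarrow> cpow (x * y) z = cpow x z * cpow y z"
  by (simp add: cpow_def ln_mult exp_add ring_distribs)
lemma cpow_one: "x > 0 \<Longrightarrow> cpow x 1 = of_real x" by (simp add: cpow_def exp_of_real)
lemma cpow_of_real: "x > 0 \<Longrightarrow> cpow x (of_real a) = of_real (x powr a)"
  by (simp add: cpow_def powr_def exp_of_real flip: of_real_mult)
lemma cpow_powr_real: "x > 0 \<Longrightarrow> cpow (x powr a) z = cpow x (of_real a * z)"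
  by (simp add: cpow_def ln_powr mult_ac)

definition has_mellin :: "(real \<Rightarrow> complex) \<Rightarrow> complex \<Rightarrow> complex \<Rightarrow> bool" where
  "has_mellin f s I \<longleftrightarrow> has_bochner_integral lborel (\<lambda>x. indicator {0<..} x *\<^sub>R (f x * cpow x (s - 1))) I"

lemma has_bochner_lborel_iff_absolutely:
  fixes f :: "real \<Rightarrow> complex"
  assumes "(\<lambda>x. indicator S x *\<^sub>R f x) \<in> borel_measurable borel"
  shows "has_bochner_integral lborel (\<lambda>x. indicator S x *\<^sub>R f x) b \<longleftrightarrow> f absolutely_integrable_on S \<and> integral S f = b"
proof -
  have m: "(\<lambda>x. indicator S x *\<^sub>R f x) \<in> borel_measurable lborel" using assms by simp
  have "has_bochner_integral lborel (\<lambda>x. indicator S x *\<^sub>R f x) b \<longleftrightarrow>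
      integrable lebesgue (\<lambda>x. indicator S x *\<^sub>R f x) \<and> integral\<^sup>L lebesgue (\<lambda>x. indicator S x *\<^sub>R f x) = b"
    by (simp add: has_bochner_integral_iff integrable_completion[OF m] integral_completion[OF m])
  also have "\<dots> \<longleftrightarrow> f absolutely_integrable_on S \<and> integral S f = b"
    using set_lebesgue_integral_eq_integral(2)[of S f] by (auto simp: set_integrable_def set_lebesgue_integral_def)
  finally show ?thesis .
qed

lemma has_mellin_iff_absolutely:
  assumes [measurable]: "f \<in> borel_measurable borel"
  shows "has_mellin f s I \<longleftrightarrow> (\<lambda>x. f x * cpow x (s - 1)) absolutely_integrable_on {0<..} \<and>
           integral {0<..} (\<lambda>x. f x * cpow x (s - 1)) = I"
  unfolding has_mellin_def by (rule has_bochner_lborel_iff_absolutely) measurable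

lemma has_mellin_subst_power:
  assumes f [measurable]: "f \<in> borel_measurable borel" and w: "w > 0" and p: "p > 0"
    and I: "has_mellin f s I"
  shows "has_mellin (\<lambda>x. f ((x / w) powr p)) (of_real p * s) (I * cpow w (of_real p * s) / of_real p)"
proof -
  define S where "S = {0::real<..}"
  define g where "g = (\<lambda>x::real. (x / w) powr p)"
  define h where "h = (\<lambda>x::real. p / w * (x / w) powr (p - 1))"
  have g_image: "g ` S = S"
  proof (intro equalityI subsetI)
    fix y assume y: "y \<in> S"
    have "g (w * y powr (1 / p)) = y" using y w p by (simp add: g_def S_def powr_powr)
    moreover have "w * y powr (1 / p) \<in> S" using y w by (simp add: S_def)
    ultimately show "y \<in> g ` S" by (metis image_eqI)
  qed (use w in \<open>auto simp: g_def S_def\<close>)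
  have der: "(g has_field_derivative h x) (at x within S)" if "x \<in> S" for x
  proof -
    have "(g has_field_derivative (p * (x / w) powr (p - 1) * (1 / w))) (at x)"
      unfolding g_def using that w
      by (auto intro!: derivative_eq_intros simp: S_def powr_diff field_simps)
    then show ?thesis by (auto simp: h_def intro: has_field_derivative_at_within)
  qed
  have inj: "inj_on g S"
  proof (rule inj_onI)
    fix x y assume xy: "x \<in> S" "y \<in> S" "g x = g y"
    then have "g x powr (1 / p) = g y powr (1 / p)" by simp
    then show "x = y" using xy(1,2) w p by (simp add: g_def S_def powr_powr)
  qed
  have "(\<lambda>x. f x * cpow x (s - 1)) absolutely_integrable_on g ` S \<and>
           integral (g ` S) (\<lambda>x. f x * cpow x (s - 1)) = I"
    using I by (simp add: g_image has_mellin_iff_absolutely flip: S_def)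
  then have *: "(\<lambda>x. \<bar>h x\<bar> *\<^sub>R (f (g x) * cpow (g x) (s - 1))) absolutely_integrable_on S \<and>
      integral S (\<lambda>x. \<bar>h x\<bar> *\<^sub>R (f (g x) * cpow (g x) (s - 1))) = I"
    using has_absolute_integral_change_of_variables_real[of S g h "\<lambda>x. f x * cpow x (s - 1)" I] der inj
    by (simp add: S_def)
  have "has_bochner_integral lborel (\<lambda>x. indicator S x *\<^sub>R (\<bar>h x\<bar> *\<^sub>R (f (g x) * cpow (g x) (s - 1)))) I"
    using * by (subst has_bochner_lborel_iff_absolutely) (simp_all add: S_def h_def g_def)
  then have **: "has_bochner_integral lborel (\<lambda>x. (indicator S x *\<^sub>R (\<bar>h x\<bar> *\<^sub>R (f (g x) * cpow (g x) (s - 1)))) * (cpow w (of_real p * s) / of_real p)) (I * (cpow w (of_real p * s) / of_real p))"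
    by (rule has_bochner_integral_mult_left)
  have eq: "(indicator S x *\<^sub>R (\<bar>h x\<bar> *\<^sub>R (f (g x) * cpow (g x) (s - 1)))) * (cpow w (of_real p * s) / of_real p)
     = indicator {0<..} x *\<^sub>R (f ((x / w) powr p) * cpow x (of_real p * s - 1))" for x
  proof (cases "x > 0")
    case True
    have "of_real \<bar>h x\<bar> * cpow (g x) (s - 1) = of_real p * cpow w (- 1) * (cpow (x / w) (of_real (p - 1)) * cpow (x / w) (of_real p * (s - 1)))"
    proof -
      have "x / w > 0" using True w by simp
      then show ?thesis using w p
        by (subst cpow_of_real) (simp_all add: h_def g_def cpow_powr_real abs_mult cpow_minus cpow_one divide_inverse)
    qed
    also have "\<dots> = of_real p * cpow w (- 1) * cpow (x * inverse w) (of_real p * s - 1)"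
      by (simp add: cpow_add[symmetric] algebra_simps divide_inverse)
    also have "\<dots> = of_real p * cpow w (- 1) * cpow x (of_real p * s - 1) * cpow w (1 - of_real p * s)"
    proof -
      have "cpow (inverse w) z = cpow w (- z)" for z using w by (simp add: cpow_def ln_inverse)
      then show ?thesis using True w by (simp add: cpow_mult)
    qed
    also have "\<dots> * cpow w (of_real p * s) = of_real p * cpow x (of_real p * s - 1) * (cpow w (- 1) * cpow w (1 - of_real p * s) * cpow w (of_real p * s))"
      by (simp add: mult_ac)
    also have "cpow w (- 1) * cpow w (1 - of_real p * s) * cpow w (of_real p * s) = 1"
      by (simp add: cpow_add[symmetric]) (simp add: cpow_def)
    finally have "of_real \<bar>h x\<bar> * cpow (g x) (s - 1) * cpow w (of_real p * s) = of_real p * cpow x (of_real p * s - 1)" by simp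
    then have "(of_real \<bar>h x\<bar> * cpow (g x) (s - 1) * cpow w (of_real p * s)) * f (g x) / of_real p = f (g x) * cpow x (of_real p * s - 1)"
      using p by simp
    then show ?thesis using True by (simp add: S_def scaleR_conv_of_real g_def mult_ac)
  qed (auto simp: S_def)
  show ?thesis unfolding has_mellin_def using ** unfolding eq by simp
qed

lemma has_mellin_exp:
  assumes s: "Re s > 0" and y: "y > 0"
  shows "has_mellin (\<lambda>x. of_real (exp (- y * x))) s (Gamma s * cpow y (- s))"
proof -
  have eq: "complex_of_real (exp (- x)) * cpow x (s - 1) = of_real x powr (s - 1) / of_real (exp x)" if "x \<in> {0<..}" for x
    using that by (simp add: cpow_powr exp_minus field_simps)
  have "(\<lambda>x. complex_of_real (exp (- x)) * cpow x (s - 1)) absolutely_integrable_on {0<..}"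
    using absolutely_integrable_Gamma_integral'[OF s]
    by (subst set_integrable_cong[OF refl refl eq]) auto
  moreover have "((\<lambda>x. complex_of_real (exp (- x)) * cpow x (s - 1)) has_integral Gamma s) {0<..}"
    using Gamma_integral_complex'[OF s] by (rule has_integral_eq[rotated]) (simp add: eq)
  ultimately have "has_mellin (\<lambda>x. of_real (exp (- x))) s (Gamma s)"
    by (subst has_mellin_iff_absolutely) (auto simp: integral_unique)
  from has_mellin_subst_power[OF _ _ _ this, of "1 / y" 1]
  have "has_mellin (\<lambda>x. of_real (exp (- ((x / (1 / y)) powr 1)))) s (Gamma s * cpow (1 / y) s)"
    using y by simp
  also have "cpow (1 / y) s = cpow y (- s)" using y by (simp add: cpow_def ln_div)
  finally have *: "has_mellin (\<lambda>x. of_real (exp (- ((x / (1 / y)) powr 1)))) s (Gamma s * cpow y (- s))" .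
  have eq: "indicator {0<..} x *\<^sub>R (complex_of_real (exp (- y * x)) * c) = indicator {0<..} x *\<^sub>R (of_real (exp (- ((x / (1 / y)) powr 1))) * c)" for x c
    using y by (auto simp: indicator_def mult.commute)
  show ?thesis using * unfolding has_mellin_def eq .
qed

text \<open>
  For a nonnegative kernel this is the integral of the absolute value of the integrand of the transform at
  \<open>s\<close>; it is the hypothesis of Fubini's theorem in the interchanges below.
\<close>
lemma has_mellin_real_nonneg:
  assumes "has_mellin (\<lambda>x. of_real (f x)) (of_real (Re s)) I"
  shows "has_bochner_integral lborel (\<lambda>x. indicator {0<..} x *\<^sub>R (f x * x powr (Re s - 1))) (Re I)"
proof -
  have eq: "indicator {0<..} x *\<^sub>R (f x * x powr (Re s - 1)) = Re (indicator {0<..} x *\<^sub>R (of_real (f x) * cpow x (of_real (Re s) - 1)))" for x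
    using cpow_of_real[of x "Re s - 1"] by (cases "x > 0") (auto simp: indicator_def)
  show ?thesis
    unfolding eq by (rule has_bochner_integral_bounded_linear[OF bounded_linear_Re assms[unfolded has_mellin_def]])
qed

text \<open>
  As \<open>1 / (1 + v)\<close> is the integral of \<open>exp (- t * (1 + v))\<close> over \<open>t > 0\<close>, integrating over \<open>v\<close> first
  leaves a second Gamma integral.
\<close>
lemma has_mellin_inverse_1_plus:
  assumes a: "0 < Re a" "Re a < 1"
  shows "has_mellin (\<lambda>v. of_real (1 / (1 + v))) a (Gamma a * Gamma (1 - a))"
proof -
  let ?I = "\<lambda>x. indicator {0<..} (x::real) :: real"
  define f :: "real \<times> real \<Rightarrow> complex" where
    "f = (\<lambda>(t, v). ?I t *\<^sub>R (?I v *\<^sub>R (of_real (exp (- t * (1 + v))) * cpow v (a - 1))))"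
  have f_t: "has_bochner_integral lborel (\<lambda>v. f (t, v)) (?I t *\<^sub>R (of_real (exp (- 1 * t)) * (Gamma a * cpow t (- a))))" for t
  proof (cases "t > 0")
    case True
    have "has_bochner_integral lborel (\<lambda>v. of_real (exp (- 1 * t)) * (?I v *\<^sub>R (of_real (exp (- t * v)) * cpow v (a - 1)))) (of_real (exp (- 1 * t)) * (Gamma a * cpow t (- a)))"
      using has_mellin_exp[OF a(1) True] unfolding has_mellin_def by (intro has_bochner_integral_mult_right) auto
    moreover have "f (t, v) = of_real (exp (- 1 * t)) * (?I v *\<^sub>R (of_real (exp (- t * v)) * cpow v (a - 1)))" for v
      using True by (simp add: f_def exp_add[symmetric] ring_distribs scaleR_conv_of_real exp_diff exp_minus divide_inverse)
    ultimately show ?thesis using True by simp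
  qed (simp add: f_def has_bochner_integral_zero)
  have nf_t: "has_bochner_integral lborel (\<lambda>v. norm (f (t, v))) (?I t *\<^sub>R (exp (- 1 * t) * (Gamma (Re a) * t powr (- Re a))))" for t
  proof (cases "t > 0")
    case True
    have "has_mellin (\<lambda>x. of_real (exp (- t * x))) (of_real (Re a)) (Gamma (of_real (Re a)) * cpow t (- of_real (Re a)))"
      by (rule has_mellin_exp) (use a True in auto)
    from has_mellin_real_nonneg[OF this]
    have "has_bochner_integral lborel (\<lambda>v. ?I v *\<^sub>R (exp (- t * v) * v powr (Re a - 1))) (Gamma (Re a) * t powr (- Re a))"
      using True cpow_of_real[of t "- Re a"] by (simp add: Gamma_complex_of_real)
    then have "has_bochner_integral lborel (\<lambda>v. exp (- 1 * t) * (?I v *\<^sub>R (exp (- t * v) * v powr (Re a - 1)))) (exp (- 1 * t) * (Gamma (Re a) * t powr (- Re a)))"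
      by (intro has_bochner_integral_mult_right) auto
    moreover have "norm (f (t, v)) = exp (- 1 * t) * (?I v *\<^sub>R (exp (- t * v) * v powr (Re a - 1)))" for v
      using True by (cases "v > 0") (simp_all add: f_def norm_mult norm_cpow ring_distribs exp_diff exp_minus divide_inverse norm_inverse)
    ultimately show ?thesis using True by simp
  qed (simp add: f_def has_bochner_integral_zero)
  have meas [measurable]: "f \<in> borel_measurable (lborel \<Otimes>\<^sub>M lborel)"
    unfolding f_def by measurable
  have int: "integrable (lborel \<Otimes>\<^sub>M lborel) f"
  proof (rule lborel_pair.Fubini_integrable)
    have "has_mellin (\<lambda>x. of_real (exp (- 1 * x))) (of_real (Re (1 - a))) (Gamma (of_real (Re (1 - a))) * cpow 1 (- of_real (Re (1 - a))))"
      by (rule has_mellin_exp) (use a in auto)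
    from has_mellin_real_nonneg[OF this]
    have "integrable lborel (\<lambda>t. Gamma (Re a) * (?I t *\<^sub>R (exp (- 1 * t) * t powr (- Re a))))"
      by (intro integrable_mult_right) (auto simp: has_bochner_integral_iff)
    then show "integrable lborel (\<lambda>t. \<integral>v. norm (f (t, v)) \<partial>lborel)"
      using nf_t by (simp add: has_bochner_integral_iff mult_ac)
  qed (use f_t in \<open>auto simp: has_bochner_integral_iff\<close>)
  have f_v: "has_bochner_integral lborel (\<lambda>t. f (t, v)) (?I v *\<^sub>R (of_real (1 / (1 + v)) * cpow v (a - 1)))" for v
  proof (cases "v > 0")
    case True
    have "has_mellin (\<lambda>t. of_real (exp (- (1 + v) * t))) 1 (Gamma 1 * cpow (1 + v) (- 1))"
      by (rule has_mellin_exp) (use True in auto)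
    then have "has_bochner_integral lborel (\<lambda>t. (?I t *\<^sub>R complex_of_real (exp (- (1 + v) * t))) * cpow v (a - 1)) (of_real (1 / (1 + v)) * cpow v (a - 1))"
      using True unfolding has_mellin_def
      by (intro has_bochner_integral_mult_left) (auto simp: cpow_minus cpow_one divide_inverse cpow_def[of _ 0] simp flip: of_real_add)
    moreover have "f (t, v) = (?I t *\<^sub>R complex_of_real (exp (- (1 + v) * t))) * cpow v (a - 1)" for t
      using True by (simp add: f_def algebra_simps)
    ultimately show ?thesis using True by simp
  qed (simp add: f_def has_bochner_integral_zero)
  have "has_bochner_integral lborel (\<lambda>v. \<integral>t. f (t, v) \<partial>lborel) (integral\<^sup>L (lborel \<Otimes>\<^sub>M lborel) f)"
    using lborel_pair.integrable_snd[of "\<lambda>t v. f (t, v)"] lborel_pair.integral_snd[of "\<lambda>t v. f (t, v)"] int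
    by (simp add: has_bochner_integral_iff)
  then have 1: "has_mellin (\<lambda>v. of_real (1 / (1 + v))) a (integral\<^sup>L (lborel \<Otimes>\<^sub>M lborel) f)"
    using f_v by (simp add: has_bochner_integral_iff has_mellin_def)
  have "integral\<^sup>L (lborel \<Otimes>\<^sub>M lborel) f = (\<integral>t. ?I t *\<^sub>R (of_real (exp (- 1 * t)) * (Gamma a * cpow t (- a))) \<partial>lborel)"
    using lborel_pair.integral_fst'[OF int] f_t by (simp add: has_bochner_integral_iff)
  also have "has_mellin (\<lambda>x. of_real (exp (- 1 * x))) (1 - a) (Gamma (1 - a) * cpow 1 (- (1 - a)))"
    by (rule has_mellin_exp) (use a in auto)
  then have "has_bochner_integral lborel (\<lambda>t. Gamma a * (?I t *\<^sub>R (of_real (exp (- 1 * t)) * cpow t (- a)))) (Gamma a * Gamma (1 - a))"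
    unfolding has_mellin_def by (intro has_bochner_integral_mult_right) (auto simp: cpow_def[of 1])
  then have "(\<integral>t. ?I t *\<^sub>R (of_real (exp (- 1 * t)) * (Gamma a * cpow t (- a))) \<partial>lborel) = Gamma a * Gamma (1 - a)"
    by (simp add: has_bochner_integral_iff mult_ac)
  finally show ?thesis using 1 by simp
qed

lemma has_mellin_cauchy_kernel:
  assumes s: "-1 < Re s" "Re s < 1" and w: "w > 0"
  shows "has_mellin (\<lambda>x. of_real (2 * x / (x\<^sup>2 + w\<^sup>2))) s (Gamma ((1 + s) / 2) * Gamma ((1 - s) / 2) * cpow w (s - 1))"
proof -
  let ?a = "(1 + s) / 2"
  have a: "0 < Re ?a" "Re ?a < 1" "1 - ?a = (1 - s) / 2" using s by (auto simp: field_simps)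
  have e: "complex_of_real 2 * ?a = 1 + s" by simp
  have "has_mellin (\<lambda>x. of_real (1 / (1 + (x / w) powr 2))) (1 + s) (Gamma ?a * Gamma ((1 - s) / 2) * cpow w (1 + s) / of_real 2)"
    by (rule has_mellin_subst_power[OF _ w _ has_mellin_inverse_1_plus[OF a(1,2)], of 2, unfolded e a(3)]) auto
  then have A: "has_bochner_integral lborel (\<lambda>x. of_real (2 / w\<^sup>2) * (indicator {0<..} x *\<^sub>R (of_real (1 / (1 + (x / w) powr 2)) * cpow x s)))
     (of_real (2 / w\<^sup>2) * (Gamma ?a * Gamma ((1 - s) / 2) * cpow w (1 + s) / of_real 2))"
    unfolding has_mellin_def by (intro has_bochner_integral_mult_right) auto
  have B: "of_real (2 / w\<^sup>2) * (indicator {0<..} x *\<^sub>R (of_real (1 / (1 + (x / w) powr 2)) * cpow x s))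
     = indicator {0<..} x *\<^sub>R (complex_of_real (2 * x / (x\<^sup>2 + w\<^sup>2)) * cpow x (s - 1))" for x
  proof (cases "x > 0")
    case True
    have "cpow x s = of_real x * cpow x (s - 1)" using cpow_add[of x 1 "s - 1"] True by (simp add: cpow_one)
    moreover have "2 / w\<^sup>2 * (1 / (1 + (x / w) powr 2)) * x = 2 * x / (x\<^sup>2 + w\<^sup>2)"
      using True w by (simp add: powr_numeral power_divide field_simps)
    then have "complex_of_real (2 / w\<^sup>2) * of_real (1 / (1 + (x / w) powr 2)) * of_real x = of_real (2 * x / (x\<^sup>2 + w\<^sup>2))"
      by (metis of_real_mult)
    ultimately show ?thesis using True by (simp add: mult_ac)
  qed auto
  have C: "of_real (2 / w\<^sup>2) * (Gamma ?a * Gamma ((1 - s) / 2) * cpow w (1 + s) / of_real 2) = Gamma ((1 + s) / 2) * Gamma ((1 - s) / 2) * cpow w (s - 1)"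
  proof -
    have "cpow w (1 + s) = of_real (w\<^sup>2) * cpow w (s - 1)"
      using cpow_add[of w 1 1] cpow_add[of w "1 + 1" "s - 1"] w by (simp add: cpow_one power2_eq_square)
    then show ?thesis using w by (simp add: field_simps)
  qed
  show ?thesis unfolding has_mellin_def using A unfolding B C .
qed

text \<open>
  Logarithmic derivative of the product for \<open>sinh (x / 2) / (x / 2)\<close>, which is the sine product at an
  imaginary argument.
\<close>
lemma coth_partial_fractions:
  assumes x: "x > (0::real)"
  shows "(\<lambda>n. 2 * x / (x\<^sup>2 + (2 * pi * real (Suc n))\<^sup>2)) sums (1 / (exp x - 1) - 1 / x + 1 / 2)"
proof -
  define a where "a = (\<lambda>n. 2 * pi * real (Suc n))"
  have a: "a n > 0" "a n \<ge> real (Suc n)" for n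
    using pi_gt3 mult_right_mono[of 1 "2 * pi" "real (Suc n)"] by (auto simp: a_def)
  define f where "f = (\<lambda>n x. ln (1 + x\<^sup>2 / (a n)\<^sup>2))"
  define f' where "f' = (\<lambda>n x. 2 * x / (x\<^sup>2 + (a n)\<^sup>2))"
  define F where "F = (\<lambda>x::real. ln (sinh (x / 2) / (x / 2)))"
  define S where "S = {0<..<x + 1}"
  have pos: "1 + y\<^sup>2 / (a n)\<^sup>2 > 0" for y n by (intro add_pos_nonneg) auto
  have der: "(f n has_field_derivative f' n y) (at y within S)" for n y
  proof -
    have "1 / (1 + y\<^sup>2 / (a n)\<^sup>2) * (2 * y / (a n)\<^sup>2) = f' n y"
      using a(1)[of n] sum_power2_gt_zero_iff[of y "a n"] by (simp add: f'_def field_simps)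
    moreover have "((\<lambda>y. ln (1 + y\<^sup>2 / (a n)\<^sup>2)) has_real_derivative (1 / (1 + y\<^sup>2 / (a n)\<^sup>2) * (2 * y / (a n)\<^sup>2))) (at y)"
    proof (rule DERIV_chain2[OF DERIV_ln_divide])
      show "((\<lambda>y. 1 + y\<^sup>2 / (a n)\<^sup>2) has_real_derivative 2 * y / (a n)\<^sup>2) (at y)"
        using a(1)[of n] by (auto intro!: derivative_eq_intros simp: field_simps power2_eq_square)
    qed (rule pos)
    ultimately show ?thesis unfolding f_def by (simp add: has_field_derivative_at_within)
  qed
  have sumsF: "(\<lambda>n. f n y) sums F y" if y: "y > 0" for y
  proof -
    define z where "z = \<i> * complex_of_real (y / (2 * pi))"
    have z0: "of_real pi * z \<noteq> 0" using y by (simp add: z_def)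
    have "(\<lambda>n. of_real pi * z * (\<Prod>k=1..n. 1 - z^2 / of_nat k^2) / (of_real pi * z)) \<longlonglongrightarrow> sin (of_real pi * z) / (of_real pi * z)"
      by (intro tendsto_divide sin_product_formula_complex tendsto_const z0)
    then have "(\<lambda>n. (\<Prod>k=1..n. 1 - z^2 / of_nat k^2)) \<longlonglongrightarrow> sin (of_real pi * z) / (of_real pi * z)"
      using z0 by simp
    also have "(\<lambda>n. (\<Prod>k=1..n. 1 - z^2 / of_nat k^2)) = (\<lambda>n. of_real (\<Prod>k<n. 1 + y\<^sup>2 / (a k)\<^sup>2))"
    proof
      fix n
      have "(\<Prod>k=1..n. 1 - z^2 / of_nat k^2) = (\<Prod>k<n. 1 - z^2 / of_nat (Suc k)^2)"
        by (rule prod.reindex_bij_witness[of _ Suc "\<lambda>k. k - 1"]) auto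
      also have "\<dots> = (\<Prod>k<n. of_real (1 + y\<^sup>2 / (a k)\<^sup>2))"
        by (intro prod.cong refl) (simp add: z_def a_def power_mult_distrib power_divide del: of_nat_Suc)
      finally show "(\<Prod>k=1..n. 1 - z^2 / of_nat k^2) = of_real (\<Prod>k<n. 1 + y\<^sup>2 / (a k)\<^sup>2)" by simp
    qed
    also have "sin (of_real pi * z) / (of_real pi * z) = of_real (sinh (y / 2) / (y / 2))"
    proof -
      have piz: "of_real pi * z = \<i> * of_real (y / 2)" by (simp add: z_def)
      have "sin (\<i> * of_real (y / 2)) = \<i> * of_real (sinh (y / 2))"
        by (simp add: sin_exp_eq sinh_def exp_of_real[symmetric] scaleR_conv_of_real field_simps exp_minus)
      then show ?thesis unfolding piz using y by (simp add: field_simps)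
    qed
    finally have "(\<lambda>n. \<Prod>k<n. 1 + y\<^sup>2 / (a k)\<^sup>2) \<longlonglongrightarrow> sinh (y / 2) / (y / 2)"
      by (simp only: tendsto_of_real_iff)
    then have "(\<lambda>n. ln (\<Prod>k<n. 1 + y\<^sup>2 / (a k)\<^sup>2)) \<longlonglongrightarrow> F y"
      unfolding F_def using y by (intro tendsto_ln) auto
    moreover have "ln (\<Prod>k<n. 1 + y\<^sup>2 / (a k)\<^sup>2) = (\<Sum>k<n. f k y)" for n
      unfolding f_def using less_imp_neq[OF pos[of y], symmetric] by (subst ln_prod) auto
    ultimately show ?thesis by (simp add: sums_def)
  qed
  have unif: "uniformly_convergent_on S (\<lambda>n y. \<Sum>i<n. f' i y)"
  proof (rule Weierstrass_m_test'_ev[OF always_eventually, rule_format])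
    fix n y assume y: "y \<in> S"
    have "2 * y / (y\<^sup>2 + (a n)\<^sup>2) \<le> 2 * (x + 1) / (0 + (real (Suc n))\<^sup>2)"
      using y a[of n] by (intro frac_le add_mono power_mono) (auto simp: S_def)
    then show "norm (f' n y) \<le> 2 * (x + 1) * (1 / (real (Suc n))\<^sup>2)"
      using y by (simp add: f'_def S_def)
  next
    show "summable (\<lambda>n. 2 * (x + 1) * (1 / (real (Suc n))\<^sup>2))"
      using inverse_squares_sums by (intro summable_mult) (simp add: sums_iff add.commute)
  qed
  have xS: "x \<in> interior S" using x by (simp add: S_def)
  have "((\<lambda>x. \<Sum>n. f n x) has_field_derivative (\<Sum>n. f' n x)) (at x)"
    by (rule has_field_derivative_series'(2)[of S f f' x])
      (use x der unif sumsF[OF x] xS in \<open>auto simp: S_def sums_iff\<close>)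
  then have "(F has_field_derivative (\<Sum>n. f' n x)) (at x)"
    by (rule has_field_derivative_transform_within_open[of _ _ _ "{0<..}"]) (use x sumsF in \<open>auto simp: sums_iff\<close>)
  moreover have "(F has_field_derivative (1 / (exp x - 1) - 1 / x + 1 / 2)) (at x)"
  proof -
    have sp: "sinh (x / 2) > 0" using x by simp
    have ex: "exp x > 1" using x by simp
    have "(F has_field_derivative (1 / (sinh (x / 2) / (x / 2)) * ((cosh (x / 2) * (1 / 2) * (x / 2) - sinh (x / 2) * (1 / 2)) / (x / 2 * (x / 2))))) (at x)"
      unfolding F_def using x sp by (auto intro!: derivative_eq_intros)
    also have "1 / (sinh (x / 2) / (x / 2)) * ((cosh (x / 2) * (1 / 2) * (x / 2) - sinh (x / 2) * (1 / 2)) / (x / 2 * (x / 2)))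
       = cosh (x / 2) / sinh (x / 2) / 2 - 1 / x"
      using x sp by (simp add: field_simps)
    also have "cosh (x / 2) / sinh (x / 2) = (exp x + 1) / (exp x - 1)"
    proof -
      define E where "E = exp (x / 2)"
      have E: "E > 1" "exp x = E * E" using x by (simp_all add: E_def exp_add[symmetric])
      have E2: "E * E > 1" using E ex by simp
      have "cosh (x / 2) / sinh (x / 2) = (E + inverse E) / (E - inverse E)"
      proof -
        have c: "cosh (x / 2) = (E + inverse E) / 2" and s: "sinh (x / 2) = (E - inverse E) / 2"
          by (simp_all add: cosh_def sinh_def E_def exp_minus)
        have "(a / 2) / (b / 2) = a / b" for a b :: real by simp
        then show ?thesis unfolding c s .
      qed
      also have "\<dots> = (E * E + 1) / (E * E - 1)" using E E2 by (simp add: field_simps)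
      finally show ?thesis using E by simp
    qed
    also have "(exp x + 1) / (exp x - 1) / 2 - 1 / x = 1 / (exp x - 1) - 1 / x + 1 / 2"
      using ex x by (simp add: field_simps)
    finally show ?thesis .
  qed
  ultimately have "(\<Sum>n. f' n x) = 1 / (exp x - 1) - 1 / x + 1 / 2" by (rule DERIV_unique)
  moreover have "summable (\<lambda>n. f' n x)"
  proof -
    have "x \<in> S" using x by (simp add: S_def)
    then have "convergent (\<lambda>n. \<Sum>i<n. f' i x)" by (rule uniformly_convergent_imp_convergent[OF unif])
    then show ?thesis by (simp add: summable_iff_convergent)
  qed
  ultimately have "(\<lambda>n. f' n x) sums (1 / (exp x - 1) - 1 / x + 1 / 2)" by (simp only: sums_iff simp_thms)
  then show ?thesis by (simp only: f'_def a_def)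
qed

lemma integrable_lborel_nonneg:
  fixes f :: "real \<Rightarrow> real"
  assumes "f integrable_on S" "\<And>x. x \<in> S \<Longrightarrow> f x \<ge> 0" "(\<lambda>x. indicator S x *\<^sub>R f x) \<in> borel_measurable borel"
  shows "integrable lborel (\<lambda>x. indicator S x *\<^sub>R f x)"
proof -
  have "(\<lambda>x. indicator S x *\<^sub>R f x) \<in> borel_measurable lborel" using assms(3) by simp
  moreover have "f absolutely_integrable_on S"
    using assms(1,2) by (rule nonnegative_absolutely_integrable_1)
  ultimately show ?thesis by (simp add: set_integrable_def integrable_completion)
qed

lemma has_vector_derivative_cpow:
  assumes "x > 0"
  shows "((\<lambda>x. cpow x a) has_vector_derivative (a * cpow x (a - 1))) (at x)"
proof -
  have "((\<lambda>x. complex_of_real (ln x)) has_vector_derivative of_real (1 / x)) (at x)"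
    using assms by (intro has_vector_derivative_of_real) (auto intro!: derivative_eq_intros)
  then have "((\<lambda>x. a * complex_of_real (ln x)) has_vector_derivative a * of_real (1 / x)) (at x)"
    by (rule has_vector_derivative_mult_right)
  moreover have "(exp has_field_derivative exp (a * complex_of_real (ln x))) (at (a * complex_of_real (ln x)))"
    by (rule DERIV_exp)
  ultimately have "(exp \<circ> (\<lambda>x. a * complex_of_real (ln x)) has_vector_derivative (a * of_real (1 / x)) * exp (a * complex_of_real (ln x))) (at x)"
    by (rule field_vector_diff_chain_at)
  moreover have "(a * of_real (1 / x)) * exp (a * complex_of_real (ln x)) = a * cpow x (a - 1)"
    using assms cpow_add[of x a "-1"] by (simp add: cpow_minus cpow_one divide_inverse) (simp add: cpow_def)
  ultimately show ?thesis by (simp add: o_def cpow_def)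
qed

text \<open>
  The singularity at \<open>0\<close> is harmless because the antiderivative extends continuously by \<open>0\<close>, where
  \<open>Re z < 1\<close> is needed.
\<close>
lemma has_bochner_integral_cpow_from_0:
  assumes z: "Re z < 1" and c: "c > 0"
  shows "has_bochner_integral lborel (\<lambda>y. indicator {0<..<c} y *\<^sub>R cpow y (- z)) (cpow c (1 - z) / (1 - z))"
proof -
  have z1: "1 - z \<noteq> 0" using z by auto
  define F where "F = (\<lambda>y. if y = 0 then 0 else cpow y (1 - z) / (1 - z))"
  have "((\<lambda>y. cpow y (- z)) has_integral (F c - F 0)) {0..c}"
  proof (rule fundamental_theorem_of_calculus_interior)
    show "continuous_on {0..c} F"
      unfolding continuous_on_def
    proof (rule ballI)
      fix y assume y: "y \<in> {0..c}"
      show "(F \<longlongrightarrow> F y) (at y within {0..c})"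
      proof (cases "y = 0")
        case True
        have "((\<lambda>y. y powr (1 - Re z)) \<longlongrightarrow> 0 powr (1 - Re z)) (at 0 within {0..c})"
          using z by (intro tendsto_powr' tendsto_intros) (auto simp: eventually_at_filter)
        then have "((\<lambda>y. y powr (1 - Re z) / norm (1 - z)) \<longlongrightarrow> 0 powr (1 - Re z) / norm (1 - z)) (at 0 within {0..c})"
          using z1 by (intro tendsto_divide tendsto_const) auto
        then have "((\<lambda>y. y powr (1 - Re z) / norm (1 - z)) \<longlongrightarrow> 0) (at 0 within {0..c})" by simp
        moreover have "eventually (\<lambda>y. norm (F y) \<le> y powr (1 - Re z) / norm (1 - z)) (at 0 within {0..c})"
          by (auto simp: eventually_at_filter F_def norm_divide norm_cpow)
        ultimately have "(F \<longlongrightarrow> 0) (at 0 within {0..c})" by (rule Lim_null_comparison[rotated])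
        then show ?thesis using True by (simp add: F_def)
      next
        case False
        then have "y > 0" using y by auto
        then have "isCont (\<lambda>x. cpow x (1 - z)) y"
          using has_vector_derivative_cpow has_vector_derivative_continuous by blast
        then have "((\<lambda>x. cpow x (1 - z) / (1 - z)) \<longlongrightarrow> F y) (at y within {0..c})"
          using False z1 unfolding isCont_def F_def by (auto intro!: tendsto_intros dest: tendsto_within_subset)
        moreover have "eventually (\<lambda>x. x \<noteq> 0) (at y within {0..c})"
          using False by (intro eventually_neq_at_within) 
        ultimately show ?thesis
          by (auto elim!: Lim_transform_eventually eventually_mono simp: F_def)
      qed
    qed
    show "(F has_vector_derivative cpow y (- z)) (at y)" if "y \<in> {0<..<c}" for y
    proof -
      have "((\<lambda>x. cpow x (1 - z) / (1 - z)) has_vector_derivative ((1 - z) * cpow y (1 - z - 1)) / (1 - z)) (at y)"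
        using that by (intro has_vector_derivative_divide has_vector_derivative_cpow) auto
      then have "((\<lambda>x. cpow x (1 - z) / (1 - z)) has_vector_derivative cpow y (- z)) (at y)" using z1 by simp
      then show ?thesis
        by (rule has_vector_derivative_transform_within_open[of _ _ _ "{0<..}"]) (use that in \<open>auto simp: F_def\<close>)
    qed
  qed (use c in auto)
  then have hi: "((\<lambda>y. cpow y (- z)) has_integral (cpow c (1 - z) / (1 - z))) {0<..<c}"
    using c by (simp add: F_def has_integral_Icc_iff_Ioo)
  have "(\<lambda>y. y powr (- Re z)) integrable_on {0..c}" using z c by (intro integrable_on_powr_from_0) auto
  then have "(\<lambda>y. y powr (- Re z)) integrable_on {0<..<c}" by (simp add: integrable_on_Icc_iff_Ioo)
  then have "(\<lambda>y. cpow y (- z)) absolutely_integrable_on {0<..<c}"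
    using hi by (intro absolutely_integrable_integrable_bound[of "{0<..<c}" _ "\<lambda>y. y powr (- Re z)"]) (auto simp: norm_cpow integrable_on_def)
  then show ?thesis using hi by (subst has_bochner_lborel_iff_absolutely) (auto simp: integral_unique)
qed

text \<open>
  If \<open>k(\<cdot>, y)\<close> has the transform \<open>c y powr (-z)\<close>, then the sum of \<open>k(x, n)\<close> over \<open>n \<le> N\<close> minus the
  integral of \<open>k(x, y)\<close> over \<open>0 < y < N\<close> has the transform \<open>c\<close> times the corrected partial sum of
  \<open>\<zeta>(z)\<close>: the integral accounts exactly for the correction. Dominated convergence then
  produces \<open>\<zeta>(z)\<close> inside the critical strip, where the sum alone would diverge.
\<close>
theorem has_mellin_sum_minus_integral:
  fixes k :: "real \<Rightarrow> real \<Rightarrow> real" and h B :: "real \<Rightarrow> real"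
  assumes k [measurable]: "case_prod k \<in> borel_measurable (lborel \<Otimes>\<^sub>M lborel)"
    and pos: "\<And>x y. x > 0 \<Longrightarrow> y > 0 \<Longrightarrow> k x y \<ge> 0"
    and M: "\<And>y. y > 0 \<Longrightarrow> has_mellin (\<lambda>x. of_real (k x y)) s (c * cpow y (- z))"
    and MR: "\<And>y. y > 0 \<Longrightarrow> has_mellin (\<lambda>x. of_real (k x y)) (of_real (Re s)) (of_real c0 * cpow y (- of_real (Re z)))"
    and z: "0 < Re z" "Re z < 1"
    and I: "\<And>x N. x > 0 \<Longrightarrow> has_bochner_integral lborel (\<lambda>y. indicator {0<..<real N} y * k x y) (I N x)"
    and lim: "\<And>x. x > 0 \<Longrightarrow> (\<lambda>N. (\<Sum>n<N. k x (real (Suc n))) - I N x) \<longlonglongrightarrow> h x"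
    and dom: "\<And>x N. x > 0 \<Longrightarrow> N \<ge> 1 \<Longrightarrow> \<bar>(\<Sum>n<N. k x (real (Suc n))) - I N x\<bar> \<le> B x"
    and B: "integrable lborel (\<lambda>x. indicator {0<..} x * (B x * x powr (Re s - 1)))"
    and h [measurable]: "h \<in> borel_measurable borel"
  shows "has_mellin (\<lambda>x. of_real (h x)) s (c * zeta z)"
proof -
  define E where "E = (\<lambda>N x. (\<Sum>n<N. k x (real (Suc n))) - I N x)"
  have part: "has_mellin (\<lambda>x. of_real (I N x)) s (c * (cpow (real N) (1 - z) / (1 - z)))" if N: "N \<ge> 1" for N
  proof -
    let ?J = "\<lambda>y. indicator {0<..<real N} (y::real) :: real"
    let ?I = "\<lambda>x. indicator {0<..} (x::real) :: real"
    define f :: "real \<times> real \<Rightarrow> complex" where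
      "f = (\<lambda>(y, x). ?J y *\<^sub>R (?I x *\<^sub>R (of_real (k x y) * cpow x (s - 1))))"
    have kk: "(\<lambda>(y, x). k x y) \<in> borel_measurable (lborel \<Otimes>\<^sub>M lborel)" 
      using measurable_compose[OF measurable_pair_swap' k] by (simp add: case_prod_unfold)
    have [measurable]: "(\<lambda>p. k (snd p) (fst p)) \<in> borel_measurable (borel \<Otimes>\<^sub>M borel)"
      using kk by (simp add: case_prod_unfold)
    have [measurable]: "f \<in> borel_measurable (lborel \<Otimes>\<^sub>M lborel)"
      unfolding f_def case_prod_unfold by measurable
    have f_y: "has_bochner_integral lborel (\<lambda>x. f (y, x)) (?J y *\<^sub>R (c * cpow y (- z)))" for y
    proof (cases "y \<in> {0<..<real N}")
      case True then show ?thesis using M[of y] by (simp add: f_def has_mellin_def)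
    qed (simp add: f_def has_bochner_integral_zero)
    have nf_y: "has_bochner_integral lborel (\<lambda>x. norm (f (y, x))) (?J y *\<^sub>R (c0 * y powr (- Re z)))" for y
    proof (cases "y \<in> {0<..<real N}")
      case True
      then have y: "y > 0" by simp
      have e: "Re (of_real c0 * cpow y (- of_real (Re z))) = c0 * y powr (- Re z)"
        using cpow_of_real[OF y, of "- Re z"] by simp
      have "has_bochner_integral lborel (\<lambda>x. ?I x *\<^sub>R (k x y * x powr (Re s - 1))) (c0 * y powr (- Re z))"
        by (rule has_mellin_real_nonneg[OF MR[OF y], unfolded e])
      moreover have "norm (f (y, x)) = ?I x *\<^sub>R (k x y * x powr (Re s - 1))" for x
        using True pos[of x y] by (cases "x > 0") (auto simp: f_def norm_mult norm_cpow)
      ultimately show ?thesis using True by simp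
    qed (simp add: f_def has_bochner_integral_zero)
    have pw: "has_bochner_integral lborel (\<lambda>y. ?J y *\<^sub>R cpow y (- w)) (cpow (real N) (1 - w) / (1 - w))" if "Re w < 1" for w
      using that N by (intro has_bochner_integral_cpow_from_0) auto
    have int: "integrable (lborel \<Otimes>\<^sub>M lborel) f"
    proof (rule lborel_pair.Fubini_integrable)
      have "integrable lborel (\<lambda>y. c0 * norm (?J y *\<^sub>R cpow y (- z)))"
        using pw[OF z(2)] by (intro integrable_mult_right integrable_norm) (auto simp: has_bochner_integral_iff)
      also have "(\<lambda>y. c0 * norm (?J y *\<^sub>R cpow y (- z))) = (\<lambda>y. ?J y *\<^sub>R (c0 * y powr (- Re z)))"
        by (auto simp: fun_eq_iff indicator_def norm_cpow)
      finally show "integrable lborel (\<lambda>y. \<integral>x. norm (f (y, x)) \<partial>lborel)"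
        using nf_y by (simp add: has_bochner_integral_iff)
    qed (use f_y in \<open>auto simp: has_bochner_integral_iff\<close>)
    have f_x: "has_bochner_integral lborel (\<lambda>y. f (y, x)) (?I x *\<^sub>R (of_real (I N x) * cpow x (s - 1)))" for x
    proof (cases "x > 0")
      case True
      have "has_bochner_integral lborel (\<lambda>y. of_real (?J y * k x y) * cpow x (s - 1)) (of_real (I N x) * cpow x (s - 1))"
        by (intro has_bochner_integral_mult_left has_bochner_integral_of_real I True)
      then show ?thesis using True by (simp add: f_def scaleR_conv_of_real mult.assoc)
    qed (simp add: f_def has_bochner_integral_zero)
    have "has_bochner_integral lborel (\<lambda>x. \<integral>y. f (y, x) \<partial>lborel) (integral\<^sup>L (lborel \<Otimes>\<^sub>M lborel) f)"
      using lborel_pair.integrable_snd[of "\<lambda>t v. f (t, v)"] lborel_pair.integral_snd[of "\<lambda>t v. f (t, v)"] int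
      by (simp add: has_bochner_integral_iff)
    then have 1: "has_mellin (\<lambda>x. of_real (I N x)) s (integral\<^sup>L (lborel \<Otimes>\<^sub>M lborel) f)"
      using f_x by (simp add: has_bochner_integral_iff has_mellin_def)
    have "integral\<^sup>L (lborel \<Otimes>\<^sub>M lborel) f = (\<integral>y. c * (?J y *\<^sub>R cpow y (- z)) \<partial>lborel)"
      using lborel_pair.integral_fst'[OF int] f_y by (simp add: has_bochner_integral_iff)
    also have "\<dots> = c * (cpow (real N) (1 - z) / (1 - z))"
      by (intro has_bochner_integral_integral_eq has_bochner_integral_mult_right pw z)
    finally show ?thesis using 1 by simp
  qed
  have mE: "has_mellin (\<lambda>x. of_real (E N x)) s (c * zeta_partial N z)" if N: "N \<ge> 1" for N
  proof -
    have "has_bochner_integral lborel (\<lambda>x. \<Sum>n<N. indicator {0<..} x *\<^sub>R (of_real (k x (real (Suc n))) * cpow x (s - 1))) (\<Sum>n<N. c * cpow (real (Suc n)) (- z))"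
      using M unfolding has_mellin_def by (intro has_bochner_integral_sum) auto
    from has_bochner_integral_diff[OF this part[OF N, unfolded has_mellin_def]]
    have "has_mellin (\<lambda>x. of_real (E N x)) s ((\<Sum>n<N. c * cpow (real (Suc n)) (- z)) - c * (cpow (real N) (1 - z) / (1 - z)))"
      unfolding has_mellin_def E_def
      by (simp add: sum_distrib_right scaleR_sum_right scaleR_diff_right left_diff_distrib)
    also have "(\<Sum>n<N. c * cpow (real (Suc n)) (- z)) - c * (cpow (real N) (1 - z) / (1 - z)) = c * zeta_partial N z"
    proof -
      have "of_nat m powr w = cpow (real m) w" if "m > 0" for m w
        using cpow_powr[of "real m" w] that by simp
      then show ?thesis using N by (simp add: zeta_partial_def sum_distrib_left right_diff_distrib del: of_nat_Suc)
    qed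
    finally show ?thesis .
  qed
  let ?g = "\<lambda>N x. indicator {0<..} x *\<^sub>R (complex_of_real (E (Suc N) x) * cpow x (s - 1))"
  let ?h = "\<lambda>x. indicator {0<..} x *\<^sub>R (complex_of_real (h x) * cpow x (s - 1))"
  have g_int: "has_bochner_integral lborel (?g N) (c * zeta_partial (Suc N) z)" for N
    using mE[of "Suc N"] by (simp add: has_mellin_def)
  have lim': "AE x in lborel. (\<lambda>N. ?g N x) \<longlonglongrightarrow> ?h x"
  proof (rule AE_I2)
    fix x :: real
    show "(\<lambda>N. ?g N x) \<longlonglongrightarrow> ?h x"
    proof (cases "x > 0")
      case True
      have "(\<lambda>N. E (Suc N) x) \<longlonglongrightarrow> h x" unfolding E_def by (rule LIMSEQ_Suc[OF lim[OF True]])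
      then show ?thesis by (intro tendsto_intros)
    qed auto
  qed
  have bd: "AE x in lborel. norm (?g N x) \<le> indicator {0<..} x * (B x * x powr (Re s - 1))" for N
  proof (rule AE_I2)
    fix x :: real
    show "norm (?g N x) \<le> indicator {0<..} x * (B x * x powr (Re s - 1))"
    proof (cases "x > 0")
      case True
      have "\<bar>E (Suc N) x\<bar> \<le> B x" unfolding E_def by (rule dom[OF True]) simp
      then show ?thesis using True by (simp add: norm_mult norm_cpow mult_right_mono)
    qed auto
  qed
  have gm: "?g N \<in> borel_measurable lborel" for N
    by (rule borel_measurable_integrable[OF integrable.intros[OF g_int]])
  have "integrable lborel ?h"
    by (rule integrable_dominated_convergence[OF _ gm B lim' bd]) measurable
  moreover have "(\<lambda>N. integral\<^sup>L lborel (?g N)) \<longlonglongrightarrow> integral\<^sup>L lborel ?h"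
    by (rule integral_dominated_convergence[OF _ gm B lim' bd]) measurable
  then have "(\<lambda>N. c * zeta_partial (Suc N) z) \<longlonglongrightarrow> integral\<^sup>L lborel ?h"
    using g_int by (simp add: has_bochner_integral_iff)
  moreover have "(\<lambda>N. c * zeta_partial (Suc N) z) \<longlonglongrightarrow> c * zeta z"
    using z by (intro tendsto_intros LIMSEQ_Suc zeta_partial_tendsto) auto
  ultimately show ?thesis
    using LIMSEQ_unique by (auto simp: has_mellin_def has_bochner_integral_iff)
qed

text \<open>
  Subtracting \<open>1 / x\<close> removes the pole at \<open>0\<close>; the Mellin transform then converges for \<open>0 < Re s < 1\<close>.
\<close>
abbreviation bose_kernel :: "real \<Rightarrow> real" where
  "bose_kernel x \<equiv> 1 / (exp x - 1) - 1 / x"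

lemma bose_kernel_bounds:
  assumes x: "x > 0"
  shows "\<bar>bose_kernel x\<bar> \<le> min 1 (2 / x)"
proof -
  have e: "exp x - 1 \<ge> x" using exp_ge_add_one_self[of x] by linarith
  then have "1 / (exp x - 1) \<le> 1 / x" using x by (intro divide_left_mono) auto
  moreover have "1 / (exp x - 1) \<ge> 0" using e x by simp
  moreover have "bose_kernel x + 1 / 2 \<ge> 0"
    by (rule sums_le[OF _ sums_zero coth_partial_fractions[OF x]]) (use x in auto)
  moreover have "1 / x \<le> 2 / x" using x by (intro divide_right_mono) auto
  ultimately have "\<bar>bose_kernel x\<bar> \<le> 1" "\<bar>bose_kernel x\<bar> \<le> 2 / x" by linarith+
  then show ?thesis by simp
qed

lemma integrable_min_power:
  fixes a :: real
  assumes "0 < a" "a < 1"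
  shows "integrable lborel (\<lambda>x. indicator {0<..} x * (min 1 (2 / x) * x powr (a - 1)))"
proof (rule Bochner_Integration.integrable_bound)
  have "integrable lborel (\<lambda>x. indicator {0..1} x *\<^sub>R (x powr (a - 1)))"
  proof (rule integrable_lborel_nonneg)
    show "(\<lambda>x. x powr (a - 1)) integrable_on {0..1}" using assms by (intro integrable_on_powr_from_0) auto
  qed auto
  moreover have "integrable lborel (\<lambda>x. indicator {1..} x *\<^sub>R (2 * x powr (a - 2)))"
  proof (rule integrable_lborel_nonneg)
    have "(\<lambda>x. x powr (a - 2)) integrable_on {1..}"
      using assms has_integral_powr_to_inf[of "a - 2" 1] by (auto simp: integrable_on_def)
    then show "(\<lambda>x. 2 * x powr (a - 2)) integrable_on {1..}" by simp
  qed auto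
  ultimately show "integrable lborel (\<lambda>x. indicator {0..1} x *\<^sub>R (x powr (a - 1)) + indicator {1..} x *\<^sub>R (2 * x powr (a - 2)))"
    by (rule Bochner_Integration.integrable_add)
  show "AE x in lborel. norm (indicator {0<..} x * (min 1 (2 / x) * x powr (a - 1))) \<le> norm (indicator {0..1} x *\<^sub>R (x powr (a - 1)) + indicator {1..} x *\<^sub>R (2 * x powr (a - 2)))"
  proof (rule AE_I2)
    fix x :: real
    consider "x \<le> 0" | "0 < x" "x \<le> 1" | "x > 1" by linarith
    then show "norm (indicator {0<..} x * (min 1 (2 / x) * x powr (a - 1))) \<le> norm (indicator {0..1} x *\<^sub>R (x powr (a - 1)) + indicator {1..} x *\<^sub>R (2 * x powr (a - 2)))"
    proof cases
      case 2
      then have "min 1 (2 / x) * x powr (a - 1) \<le> 1 * x powr (a - 1)" by (intro mult_right_mono) auto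
      then show ?thesis using 2 by (auto simp: indicator_def abs_mult)
    next
      case 3
      have "min 1 (2 / x) * x powr (a - 1) \<le> 2 / x * x powr (a - 1)" using 3 by (intro mult_right_mono) auto
      also have "\<dots> = 2 * x powr (a - 2)" using 3 powr_diff[of x "a - 1" 1] by (simp add: powr_diff)
      finally show ?thesis using 3 by (auto simp: indicator_def abs_mult)
    qed auto
  qed
qed measurable

text \<open>
  Here \<open>1 / (exp x - 1)\<close> is expanded as a geometric series, the sum of the \<open>exp (- n * x)\<close>, and \<open>1 / x\<close> is the
  corresponding integral.
\<close>
lemma mellin_bose_zeta:
  assumes s: "0 < Re s" "Re s < 1"
  shows "has_mellin (\<lambda>x. of_real (bose_kernel x)) s (Gamma s * zeta s)"
proof (rule has_mellin_sum_minus_integral[where k = "\<lambda>x y. exp (- y * x)" and z = s and I = "\<lambda>N x. (1 - exp (- real N * x)) / x"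
      and B = "\<lambda>x. min 1 (2 / x)" and ?c0.0 = "Gamma (Re s)"])
  show "has_mellin (\<lambda>x. of_real (exp (- y * x))) s (Gamma s * cpow y (- s))" if "y > 0" for y
    using s that by (intro has_mellin_exp) auto
  show "has_mellin (\<lambda>x. of_real (exp (- y * x))) (of_real (Re s)) (of_real (Gamma (Re s)) * cpow y (- of_real (Re s)))" if "y > 0" for y
    using has_mellin_exp[of "of_real (Re s)" y] s that by (simp add: Gamma_complex_of_real)
  show "has_bochner_integral lborel (\<lambda>y. indicator {0<..<real N} y * exp (- y * x)) ((1 - exp (- real N * x)) / x)" if x: "x > 0" for x N
  proof -
    have "has_bochner_integral lborel (\<lambda>y. exp (- y * x) * indicator {0..real N} y) (- exp (- real N * x) / x - (- exp (- 0 * x) / x))"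
      using x by (intro has_bochner_integral_FTC_Icc_real[where F = "\<lambda>y. - exp (- y * x) / x"])
        (auto intro!: derivative_eq_intros continuous_intros)
    moreover have "AE y in lborel. exp (- y * x) * indicator {0..real N} y = indicator {0<..<real N} y * exp (- y * x)"
      using AE_lborel_singleton[of 0] AE_lborel_singleton[of "real N"] by eventually_elim (auto simp: indicator_def)
    ultimately have "has_bochner_integral lborel (\<lambda>y. indicator {0<..<real N} y * exp (- y * x)) (- exp (- real N * x) / x - (- exp (- 0 * x) / x))"
      by (subst has_bochner_integral_cong_AE[symmetric]) auto
    then show ?thesis by (simp add: diff_divide_distrib)
  qed
  have E: "(\<Sum>n<N. exp (- real (Suc n) * x)) - (1 - exp (- real N * x)) / x = (1 - exp (- real N * x)) * bose_kernel x" if x: "x > 0" for x N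
  proof -
    define q where "q = exp (- x)"
    have q: "0 < q" "q < 1" using x by (auto simp: q_def)
    have ex: "exp (- real n * x) = q ^ n" for n by (simp add: q_def exp_of_nat_mult[symmetric])
    have "(\<Sum>n<N. exp (- real (Suc n) * x)) = q * (\<Sum>n<N. q ^ n)"
      unfolding ex by (simp add: sum_distrib_left)
    also have "\<dots> = q * ((1 - q ^ N) / (1 - q))" using q by (simp add: sum_gp_strict)
    also have "\<dots> = (1 - q ^ N) * (1 / (exp x - 1))"
      using q x by (simp add: q_def exp_minus field_simps)
    finally show ?thesis unfolding ex by (simp add: right_diff_distrib)
  qed
  show "(\<lambda>N. (\<Sum>n<N. exp (- real (Suc n) * x)) - (1 - exp (- real N * x)) / x) \<longlonglongrightarrow> bose_kernel x" if x: "x > 0" for x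
  proof -
    have "(\<lambda>N. exp (- x) ^ N) \<longlonglongrightarrow> 0" using x by (intro LIMSEQ_power_zero) auto
    then have "(\<lambda>N. exp (- real N * x)) \<longlonglongrightarrow> 0" by (simp add: exp_of_nat_mult[symmetric])
    then have "(\<lambda>N. (1 - exp (- real N * x)) * bose_kernel x) \<longlonglongrightarrow> (1 - 0) * bose_kernel x" by (intro tendsto_intros)
    then show ?thesis unfolding E[OF x] by simp
  qed
  show "\<bar>(\<Sum>n<N. exp (- real (Suc n) * x)) - (1 - exp (- real N * x)) / x\<bar> \<le> min 1 (2 / x)" if x: "x > 0" for x N
  proof -
    have "\<bar>(1 - exp (- real N * x)) * bose_kernel x\<bar> \<le> 1 * \<bar>bose_kernel x\<bar>"
    proof -
      have "exp (- real N * x) \<le> 1" using x by simp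
      then show ?thesis unfolding abs_mult by (intro mult_right_mono) (auto simp: abs_if)
    qed
    then show ?thesis unfolding E[OF x] using bose_kernel_bounds[OF x] by (auto intro: order_trans)
  qed
  show "integrable lborel (\<lambda>x. indicator {0<..} x * (min 1 (2 / x) * x powr (Re s - 1)))"
    using s by (rule integrable_min_power)
qed (use s in auto)

text \<open>
  Here the kernel is expanded in partial fractions. The integral of
  \<open>2 * x / (x\<^sup>2 + (2 * pi * y)\<^sup>2)\<close> over \<open>y > 0\<close> is \<open>1 / 2\<close>, the constant term of that
  expansion, and the transform of this kernel in \<open>x\<close> is a multiple of \<open>y powr (s - 1)\<close>, so that
  \<open>\<zeta>(1 - s)\<close> appears.
\<close>
lemma mellin_bose_zeta_reflected:
  assumes s: "0 < Re s" "Re s < 1"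
  shows "has_mellin (\<lambda>x. of_real (bose_kernel x)) s (Gamma ((1 + s) / 2) * Gamma ((1 - s) / 2) * cpow (2 * pi) (s - 1) * zeta (1 - s))"
proof -
  define k where "k = (\<lambda>x y. 2 * x / (x\<^sup>2 + (2 * pi * y)\<^sup>2))"
  define I where "I = (\<lambda>N::nat. \<lambda>x. arctan (2 * pi * real N / x) / pi)"
  have M: "has_mellin (\<lambda>x. of_real (k x y)) w (Gamma ((1 + w) / 2) * Gamma ((1 - w) / 2) * cpow (2 * pi) (w - 1) * cpow y (w - 1))"
    if "y > 0" "0 < Re w" "Re w < 1" for y w
    using has_mellin_cauchy_kernel[of w "2 * pi * y"] that cpow_mult[of "2 * pi" y "w - 1"]
    by (simp add: k_def mult.assoc)
  have der: "((\<lambda>y. arctan (2 * pi * y / x) / pi) has_real_derivative k x y) (at y)" if "x > 0" for x y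
  proof -
    have "1 + (2 * pi * y / x)\<^sup>2 = (x\<^sup>2 + (2 * pi * y)\<^sup>2) / x\<^sup>2" using that by (simp add: field_simps)
    then have "inverse (1 + (2 * pi * y / x)\<^sup>2) * (2 * pi / x) / pi = k x y"
      using that by (simp add: k_def power2_eq_square)
    moreover have "((\<lambda>y. arctan (2 * pi * y / x) / pi) has_real_derivative inverse (1 + (2 * pi * y / x)\<^sup>2) * (2 * pi / x) / pi) (at y)"
      using that by (auto intro!: derivative_eq_intros)
    ultimately show ?thesis by simp
  qed
  have kc: "isCont (k x) y" if "x > 0" for x y
  proof -
    have "x\<^sup>2 + (2 * pi * y)\<^sup>2 > 0" using that by (intro add_pos_nonneg) auto
    then show ?thesis unfolding k_def by (intro continuous_intros) auto
  qed
  have dec: "k x y' \<le> k x y" if "x > 0" "0 \<le> y" "y \<le> y'" for x y y'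
    unfolding k_def using that by (intro divide_left_mono add_left_mono power_mono mult_pos_pos add_pos_nonneg) auto
  have k0: "k x y \<ge> 0" if "x > 0" for x y using that by (simp add: k_def)
  have incr: "k x (real (Suc N)) \<le> I (Suc N) x - I N x \<and> I (Suc N) x - I N x \<le> k x (real N)" if "x > 0" for x N
  proof -
    have "\<exists>z>real N. z < real (Suc N) \<and> arctan (2 * pi * real (Suc N) / x) / pi - arctan (2 * pi * real N / x) / pi = (real (Suc N) - real N) * k x z"
      using der[OF that] by (intro MVT2) auto
    then obtain z where z: "real N < z" "z < real (Suc N)" "I (Suc N) x - I N x = k x z" by (auto simp: I_def)
    show ?thesis unfolding z(3) using z that by (intro conjI dec) auto
  qed
  have bnd: "- I 1 x + k x (real N) \<le> (\<Sum>n<N. k x (real (Suc n))) - I N x \<and> (\<Sum>n<N. k x (real (Suc n))) - I N x \<le> 0" if "x > 0" "N \<ge> 1" for x N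
    using that(2)
  proof (induction N rule: dec_induct)
    case base then show ?case using incr[OF that(1), of 0] by (simp add: I_def)
  next
    case (step n)
    then show ?case using incr[OF that(1), of n] by simp
  qed
  have arctan_le: "arctan y \<le> y" if "y \<ge> 0" for y
    using arctan_le_self[OF that] .
  have I1: "I 1 x \<le> min 1 (2 / x)" if "x > 0" for x
  proof -
    have "arctan (2 * pi / x) \<le> pi * 1" using arctan_ubound[of "2 * pi / x"] pi_gt_zero by linarith
    moreover have "arctan (2 * pi / x) \<le> pi * (2 / x)" using arctan_le[of "2 * pi / x"] that by (simp add: mult.commute)
    ultimately show ?thesis by (simp add: I_def divide_le_eq mult.commute)
  qed
  define c where "c = (\<lambda>w. Gamma ((1 + w) / 2) * Gamma ((1 - w) / 2) * cpow (2 * pi) (w - 1))"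
  define c0 where "c0 = Gamma ((1 + Re s) / 2) * Gamma ((1 - Re s) / 2) * (2 * pi) powr (Re s - 1)"
  have c0: "c (of_real (Re s)) = of_real c0"
  proof -
    have "complex_of_real (Gamma ((1 + Re s) / 2)) = Gamma ((1 + of_real (Re s)) / 2)"
      "complex_of_real (Gamma ((1 - Re s) / 2)) = Gamma ((1 - of_real (Re s)) / 2)"
      by (simp_all flip: Gamma_complex_of_real)
    then show ?thesis using cpow_of_real[of "2 * pi" "Re s - 1"] by (simp add: c_def c0_def)
  qed
  have "has_mellin (\<lambda>x. of_real (bose_kernel x)) s (c s * zeta (1 - s))"
  proof (rule has_mellin_sum_minus_integral[where k = k and I = I and B = "\<lambda>x. min 1 (2 / x)" and ?c0.0 = c0])
    show "has_mellin (\<lambda>x. of_real (k x y)) s (c s * cpow y (- (1 - s)))" if "y > 0" for y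
      using M[OF that s] by (simp add: c_def)
    show "has_mellin (\<lambda>x. of_real (k x y)) (of_real (Re s)) (of_real c0 * cpow y (- of_real (Re (1 - s))))" if "y > 0" for y
      using M[of y "of_real (Re s)"] that s unfolding c0[symmetric] by (simp add: c_def)
    show "has_bochner_integral lborel (\<lambda>y. indicator {0<..<real N} y * k x y) (I N x)" if x: "x > 0" for x N
    proof -
      have "has_bochner_integral lborel (\<lambda>y. k x y * indicator {0..real N} y) (arctan (2 * pi * real N / x) / pi - arctan (2 * pi * 0 / x) / pi)"
        using x by (intro has_bochner_integral_FTC_Icc_real[where F = "\<lambda>y. arctan (2 * pi * y / x) / pi"] der kc) auto
      moreover have "AE y in lborel. k x y * indicator {0..real N} y = indicator {0<..<real N} y * k x y"
        using AE_lborel_singleton[of 0] AE_lborel_singleton[of "real N"] by eventually_elim (auto simp: indicator_def)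
      ultimately have "has_bochner_integral lborel (\<lambda>y. indicator {0<..<real N} y * k x y) (arctan (2 * pi * real N / x) / pi - arctan (2 * pi * 0 / x) / pi)"
        by (subst has_bochner_integral_cong_AE[symmetric]) (auto simp: k_def)
      then show ?thesis by (simp add: I_def)
    qed
    show "(\<lambda>N. (\<Sum>n<N. k x (real (Suc n))) - I N x) \<longlonglongrightarrow> bose_kernel x" if x: "x > 0" for x
    proof -
      have "filterlim (\<lambda>N. 2 * pi / x * real N) at_top sequentially"
        using x by (intro filterlim_tendsto_pos_mult_at_top[OF tendsto_const] filterlim_real_sequentially) auto
      then have "(\<lambda>N. arctan (2 * pi / x * real N)) \<longlonglongrightarrow> pi / 2"
        by (rule filterlim_compose[OF tendsto_arctan_at_top])
      then have "(\<lambda>N. arctan (2 * pi / x * real N) / pi) \<longlonglongrightarrow> pi / 2 / pi"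
        by (intro tendsto_intros) auto
      then have "(\<lambda>N. I N x) \<longlonglongrightarrow> 1 / 2" by (simp add: I_def)
      with coth_partial_fractions[OF x]
      have "(\<lambda>N. (\<Sum>n<N. k x (real (Suc n))) - I N x) \<longlonglongrightarrow> (1 / (exp x - 1) - 1 / x + 1 / 2) - 1 / 2"
        unfolding sums_def k_def by (intro tendsto_diff)
      then show ?thesis by simp
    qed
    show "\<bar>(\<Sum>n<N. k x (real (Suc n))) - I N x\<bar> \<le> min 1 (2 / x)" if "x > 0" "N \<ge> 1" for x N
      using bnd[OF that] I1[OF that(1)] k0[OF that(1), of "real N"] by linarith
    show "integrable lborel (\<lambda>x. indicator {0<..} x * (min 1 (2 / x) * x powr (Re s - 1)))"
      using s by (rule integrable_min_power)
    show "case_prod k \<in> borel_measurable (lborel \<Otimes>\<^sub>M lborel)" unfolding k_def by measurable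
  qed (use s k0 in auto)
  then show ?thesis by (simp add: c_def)
qed

text \<open>
  The two evaluations of the same Mellin transform.
\<close>
theorem zeta_functional_equation:
  assumes "0 < Re s" "Re s < 1"
  shows "Gamma s * zeta s = Gamma ((1 + s) / 2) * Gamma ((1 - s) / 2) * cpow (2 * pi) (s - 1) * zeta (1 - s)"
  using mellin_bose_zeta[OF assms] mellin_bose_zeta_reflected[OF assms]
  unfolding has_mellin_def by (rule has_bochner_integral_eq)

section \<open>The size of the zeta function to the left of the critical line\<close>

text \<open>
  Writing \<open>y k\<close> for the summands, \<open>1 + y k\<close> is the quotient of consecutive values of \<open>k\<^sup>2 + t\<^sup>2\<close>.
  So the logarithms of \<open>1 + y k\<close> telescope, and they differ from \<open>y k\<close> by a summable amount.
\<close>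
lemma sum_quotient_le_ln:
  assumes t: "t \<ge> (2::real)"
  shows "(\<Sum>k<n. (2 * real k + 1) / (real k ^ 2 + t\<^sup>2)) \<le> ln ((real n ^ 2 + t\<^sup>2) / t\<^sup>2) + 8 * (1 + pi\<^sup>2 / 6)"
proof -
  define y where "y = (\<lambda>k. (2 * real k + 1) / (real k ^ 2 + t\<^sup>2))"
  define L where "L = (\<lambda>k::nat. ln (real k ^ 2 + t\<^sup>2))"
  have t2: "t\<^sup>2 \<ge> 4" using power_mono[OF t, of 2] by simp
  have pos: "real k ^ 2 + t\<^sup>2 > 0" for k using t2 by (intro add_nonneg_pos) auto
  have y01: "0 \<le> y k" "y k \<le> 1" for k
  proof -
    show "0 \<le> y k" using pos[of k] by (simp add: y_def)
    have "2 * real k + 1 \<le> real k ^ 2 + 4" using zero_le_power2[of "real k - 1"] by (simp add: power2_eq_square algebra_simps)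
    then show "y k \<le> 1" using pos[of k] t2 by (simp add: y_def divide_le_eq)
  qed
  have ysq: "(y k)\<^sup>2 \<le> 8 * (1 / (real k ^ 2 + 1))" for k
  proof -
    have "(2 * real k + 1)\<^sup>2 \<le> 8 * (real k ^ 2 + 1)"
      using zero_le_power2[of "2 * real k - 1"] by (simp add: power2_eq_square algebra_simps)
    also have "\<dots> \<le> 8 * (real k ^ 2 + t\<^sup>2)" using t2 by simp
    finally have "(2 * real k + 1)\<^sup>2 / (real k ^ 2 + t\<^sup>2)\<^sup>2 \<le> 8 * (real k ^ 2 + t\<^sup>2) / (real k ^ 2 + t\<^sup>2)\<^sup>2"
      by (intro divide_right_mono) auto
    also have "\<dots> = 8 * (1 / (real k ^ 2 + t\<^sup>2))"
    proof -
      have "8 * q / q\<^sup>2 = 8 * (1 / q)" if "q > 0" for q :: real using that by (simp add: power2_eq_square)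
      then show ?thesis using pos by blast
    qed
    also have "\<dots> \<le> 8 * (1 / (real k ^ 2 + 1))" using t2 by (intro mult_left_mono frac_le add_nonneg_pos) auto
    finally show ?thesis by (simp add: y_def power_divide)
  qed
  have step: "y k \<le> (L (Suc k) - L k) + 8 * (1 / (real k ^ 2 + 1))" for k
  proof -
    have "1 + y k = (real (Suc k) ^ 2 + t\<^sup>2) / (real k ^ 2 + t\<^sup>2)"
    proof -
      have "1 + b / q = (q + b) / q" if "q > 0" for q b :: real using that by (simp add: add_divide_distrib)
      moreover have "real (Suc k) ^ 2 + t\<^sup>2 = (real k ^ 2 + t\<^sup>2) + (2 * real k + 1)"
        by (simp add: power2_eq_square algebra_simps)
      ultimately show ?thesis using pos[of k] unfolding y_def by metis
    qed
    then have "ln (1 + y k) = L (Suc k) - L k"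
      using pos[of k] pos[of "Suc k"] by (simp add: L_def ln_div)
    moreover have "y k - (y k)\<^sup>2 \<le> ln (1 + y k)" using y01 by (intro ln_one_plus_pos_lower_bound)
    ultimately show ?thesis using ysq[of k] by linarith
  qed
  have S: "(\<Sum>k<n. 1 / (real k ^ 2 + 1)) \<le> 1 + pi\<^sup>2 / 6"
  proof (cases n)
    case (Suc m)
    have s: "(\<lambda>n. 1 / real (n + 1)^2) sums (pi\<^sup>2 / 6)" using inverse_squares_sums by simp
    have "(\<Sum>k<Suc m. 1 / (real k ^ 2 + 1)) = 1 + (\<Sum>k<m. 1 / (real (k + 1) ^ 2 + 1))"
      by (subst sum.lessThan_Suc_shift) (simp add: add.commute)
    also have "(\<Sum>k<m. 1 / (real (k + 1) ^ 2 + 1)) \<le> (\<Sum>k<m. 1 / real (k + 1)^2)"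
      by (intro sum_mono frac_le) auto
    also have "\<dots> \<le> pi\<^sup>2 / 6" using sum_le_suminf[OF sums_summable[OF s], of "{..<m}"] s by (simp add: sums_iff)
    finally show ?thesis using Suc by simp
  qed simp
  have "(\<Sum>k<n. y k) \<le> (\<Sum>k<n. (L (Suc k) - L k) + 8 * (1 / (real k ^ 2 + 1)))" by (intro sum_mono step)
  also have "\<dots> = (\<Sum>k<n. L (Suc k) - L k) + 8 * (\<Sum>k<n. 1 / (real k ^ 2 + 1))"
    by (simp only: sum.distrib sum_distrib_left)
  also have "(\<Sum>k<n. L (Suc k) - L k) = L n - L 0" by (rule sum_lessThan_telescope)
  also have "\<dots> = ln ((real n ^ 2 + t\<^sup>2) / t\<^sup>2)"
  proof -
    have "ln (q / r) = ln q - ln r" if "q > 0" "r > 0" for q r :: real using that by (simp add: ln_div)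
    moreover have "t\<^sup>2 > 0" using t2 by linarith
    ultimately show ?thesis using pos[of n] by (simp add: L_def)
  qed
  finally show ?thesis using S by (simp add: y_def)
qed

text \<open>
  Euler's limit formula is compared on the two vertical lines factor by factor. Moving from \<open>\<sigma>\<close> to
  \<open>1 / 2\<close> multiplies the \<open>k\<close>-th squared factor by at most \<open>1 + a (2k + 1) / (k\<^sup>2 + t\<^sup>2)\<close> where
  \<open>a = 1 / 2 - \<sigma>\<close>. The product of these is about \<open>(n / t) powr (2a)\<close>; the power of \<open>n\<close> cancels
  against the one in the formula, and \<open>t powr (-2a)\<close> remains.
\<close>
lemma norm_Gamma_compare:
  assumes \<sigma>: "0 < \<sigma>" "\<sigma> \<le> 1 / 2" and t: "t \<ge> 2"
  shows "(norm (Gamma (Complex \<sigma> t)))\<^sup>2 \<le> exp (1 / 2 * (8 * (1 + pi\<^sup>2 / 6))) * t powr (2 * \<sigma> - 1) * (norm (Gamma (Complex (1/2) t)))\<^sup>2"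
proof -
  define a where "a = 1 / 2 - \<sigma>"
  define C where "C = 8 * (1 + pi\<^sup>2 / 6)"
  have a: "0 \<le> a" "a \<le> 1 / 2" using \<sigma> by (auto simp: a_def)
  define q where "q = (\<lambda>(\<sigma>::real) (k::nat). (\<sigma> + real k)\<^sup>2 + t\<^sup>2)"
  have t0: "t\<^sup>2 > 0" using t by simp
  have qpos: "q r k > 0" for r k unfolding q_def using t0 by (intro add_nonneg_pos) auto
  have nG: "(norm (Gamma_series (Complex r t) n))\<^sup>2 = (fact n)\<^sup>2 * real n powr (2 * r) / (\<Prod>k<Suc n. q r k)" if "n > 0" for r n
  proof -
    have "norm (exp (Complex r t * of_real (ln (of_nat n)))) = real n powr r"
      using that by (simp add: powr_def)
    then have e: "(norm (exp (Complex r t * of_real (ln (of_nat n)))))\<^sup>2 = real n powr (2 * r)"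
      using that by (simp add: power2_eq_square powr_add[symmetric])
    have p: "(norm (pochhammer (Complex r t) (n + 1)))\<^sup>2 = (\<Prod>k<Suc n. q r k)"
    proof -
      have "(norm (Complex r t + of_nat k))\<^sup>2 = q r k" for k by (simp add: cmod_power2 q_def)
      then show ?thesis
        by (simp add: pochhammer_prod prod_norm[symmetric] prod_power_distrib atLeast0LessThan del: prod.lessThan_Suc)
    qed
    show ?thesis unfolding Gamma_series_def
      by (simp only: norm_divide norm_mult power_divide power_mult_distrib e p) (simp add: norm_fact)
  qed
  have ratio: "(\<Prod>k<Suc n. q (1/2) k) \<le> (\<Prod>k<Suc n. q \<sigma> k) * exp (a * (\<Sum>k<Suc n. (2 * real k + 1) / (real k ^ 2 + t\<^sup>2)))" for n
  proof -
    have "q (1/2) k \<le> q \<sigma> k * exp (a * ((2 * real k + 1) / (real k ^ 2 + t\<^sup>2)))" for k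
    proof -
      have kt: "real k ^ 2 + t\<^sup>2 > 0" using t0 by (intro add_nonneg_pos) auto
      have "q (1/2) k = q \<sigma> k + a * (2 * real k + \<sigma> + 1 / 2)"
        by (simp add: q_def a_def power2_eq_square algebra_simps)
      also have "\<dots> \<le> q \<sigma> k + a * (2 * real k + 1)" using a \<sigma> by (intro add_left_mono mult_left_mono) auto
      also have "a * (2 * real k + 1) \<le> q \<sigma> k * (a * ((2 * real k + 1) / (real k ^ 2 + t\<^sup>2)))"
      proof -
        have "real k ^ 2 + t\<^sup>2 \<le> q \<sigma> k" using \<sigma> by (auto simp: q_def intro!: power_mono)
        then have "(2 * real k + 1) * (real k ^ 2 + t\<^sup>2) \<le> (2 * real k + 1) * q \<sigma> k" by (intro mult_left_mono) auto
        then have "2 * real k + 1 \<le> q \<sigma> k * ((2 * real k + 1) / (real k ^ 2 + t\<^sup>2))"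
          using kt by (simp add: le_divide_eq mult.commute)
        then have "a * (2 * real k + 1) \<le> a * (q \<sigma> k * ((2 * real k + 1) / (real k ^ 2 + t\<^sup>2)))" using a by (intro mult_left_mono) auto
        then show ?thesis by (simp add: mult_ac)
      qed
      also have "q \<sigma> k + q \<sigma> k * (a * ((2 * real k + 1) / (real k ^ 2 + t\<^sup>2))) = q \<sigma> k * (1 + a * ((2 * real k + 1) / (real k ^ 2 + t\<^sup>2)))"
        by (simp only: distrib_left mult_1_right)
      also have "\<dots> \<le> q \<sigma> k * exp (a * ((2 * real k + 1) / (real k ^ 2 + t\<^sup>2)))"
        using qpos[of \<sigma> k] by (intro mult_left_mono exp_ge_add_one_self) auto
      finally show ?thesis by simp
    qed
    then have "(\<Prod>k<Suc n. q (1/2) k) \<le> (\<Prod>k<Suc n. q \<sigma> k * exp (a * ((2 * real k + 1) / (real k ^ 2 + t\<^sup>2))))"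
      using qpos by (intro prod_mono) (auto intro: less_imp_le)
    then show ?thesis by (simp only: prod.distrib exp_sum[OF finite_lessThan, symmetric] sum_distrib_left)
  qed
  have bound: "(norm (Gamma_series (Complex \<sigma> t) n))\<^sup>2 \<le>
      exp (a * C) * ((real (Suc n) ^ 2 + t\<^sup>2) / (t\<^sup>2 * real n ^ 2)) powr a * (norm (Gamma_series (Complex (1/2) t) n))\<^sup>2" if n: "n > 0" for n
  proof -
    have pn: "real n powr (2 * \<sigma>) = real n powr (2 * (1/2)) * (1 / real n ^ 2) powr a"
    proof -
      have "(1 / real n ^ 2) powr a = real n powr (- 2 * a)"
        using n by (simp add: powr_divide powr_minus_divide powr_powr flip: powr_numeral)
      then show ?thesis using powr_add[of "real n" 1 "2 * \<sigma> - 1"] n by (simp add: a_def)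
    qed
    let ?P = "\<lambda>r. \<Prod>k<Suc n. q r k"
    let ?R = "(real (Suc n) ^ 2 + t\<^sup>2) / t\<^sup>2"
    have P: "?P r > 0" for r using qpos by (intro prod_pos) auto
    have R: "?R > 0" using t0 by (intro divide_pos_pos add_nonneg_pos) auto
    have "a * (\<Sum>k<Suc n. (2 * real k + 1) / (real k ^ 2 + t\<^sup>2)) \<le> a * (ln ?R + C)"
      unfolding C_def using a t by (intro mult_left_mono sum_quotient_le_ln) auto
    then have "exp (a * (\<Sum>k<Suc n. (2 * real k + 1) / (real k ^ 2 + t\<^sup>2))) \<le> exp (a * (ln ?R + C))" by simp
    also have "\<dots> = exp (a * C) * ?R powr a"
    proof -
      have "exp (a * (ln r + C)) = exp (a * C) * r powr a" if "r > 0" for r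
        using that by (simp add: powr_def exp_add ring_distribs)
      then show ?thesis using R by blast
    qed
    finally have "?P \<sigma> * exp (a * (\<Sum>k<Suc n. (2 * real k + 1) / (real k ^ 2 + t\<^sup>2))) \<le> ?P \<sigma> * (exp (a * C) * ?R powr a)"
      using P[of \<sigma>] by (intro mult_left_mono) auto
    with ratio[of n] have *: "?P (1/2) \<le> ?P \<sigma> * (exp (a * C) * ?R powr a)" by linarith
    have "1 / ?P \<sigma> \<le> (exp (a * C) * ?R powr a) / ?P (1/2)"
      using * P[of \<sigma>] P[of "1/2"] by (simp add: field_simps)
    then have "(fact n)\<^sup>2 * real n powr (2 * \<sigma>) * (1 / ?P \<sigma>) \<le> (fact n)\<^sup>2 * real n powr (2 * \<sigma>) * ((exp (a * C) * ?R powr a) / ?P (1/2))"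
      by (intro mult_left_mono) auto
    also note pn
    also have "(fact n)\<^sup>2 * (real n powr (2 * (1/2)) * (1 / real n ^ 2) powr a) * ((exp (a * C) * ?R powr a) / ?P (1/2))
       = exp (a * C) * (?R powr a * (1 / real n ^ 2) powr a) * ((fact n)\<^sup>2 * real n powr (2 * (1/2)) / ?P (1/2))"
      by (simp only: times_divide_eq_right times_divide_eq_left mult_ac)
    also have "?R powr a * (1 / real n ^ 2) powr a = ((real (Suc n) ^ 2 + t\<^sup>2) / (t\<^sup>2 * real n ^ 2)) powr a"
      using R t by (subst powr_mult[symmetric]) auto
    finally have "(fact n)\<^sup>2 * (real n powr (2 * (1/2)) * (1 / real n ^ 2) powr a) * (1 / ?P \<sigma>) \<le> exp (a * C) * ((real (Suc n) ^ 2 + t\<^sup>2) / (t\<^sup>2 * real n ^ 2)) powr a * ((fact n)\<^sup>2 * real n powr (2 * (1/2)) / ?P (1/2))" .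
    moreover note pn
    ultimately show ?thesis unfolding nG[OF n] by simp
  qed
  have L1: "(\<lambda>n. (norm (Gamma_series (Complex \<sigma> t) n))\<^sup>2) \<longlonglongrightarrow> (norm (Gamma (Complex \<sigma> t)))\<^sup>2"
    by (intro tendsto_intros)
  have "(\<lambda>n. (real (Suc n) ^ 2 + t\<^sup>2) / (t\<^sup>2 * real n ^ 2)) \<longlonglongrightarrow> inverse (t\<^sup>2)"
    using t0 by real_asymp
  then have "(\<lambda>n. (real (Suc n) ^ 2 + t\<^sup>2) / (t\<^sup>2 * real n ^ 2)) \<longlonglongrightarrow> 1 / t\<^sup>2"
    by (simp only: inverse_eq_divide)
  then have "(\<lambda>n. exp (a * C) * ((real (Suc n) ^ 2 + t\<^sup>2) / (t\<^sup>2 * real n ^ 2)) powr a * (norm (Gamma_series (Complex (1/2) t) n))\<^sup>2)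
     \<longlonglongrightarrow> exp (a * C) * (1 / t\<^sup>2) powr a * (norm (Gamma (Complex (1/2) t)))\<^sup>2"
    using t0 by (intro tendsto_mult[OF tendsto_mult[OF tendsto_const tendsto_powr[OF _ tendsto_const]]] tendsto_power tendsto_norm Gamma_series_LIMSEQ) auto
  with L1 have "(norm (Gamma (Complex \<sigma> t)))\<^sup>2 \<le> exp (a * C) * (1 / t\<^sup>2) powr a * (norm (Gamma (Complex (1/2) t)))\<^sup>2"
    by (rule LIMSEQ_le) (use bound in \<open>auto intro!: exI[of _ 1]\<close>)
  also have "(1 / t\<^sup>2) powr a = t powr (2 * \<sigma> - 1)"
    using t by (simp add: powr_divide powr_powr a_def powr_minus_divide[symmetric] flip: powr_numeral)
  also have "exp (a * C) * t powr (2 * \<sigma> - 1) * (norm (Gamma (Complex (1/2) t)))\<^sup>2 \<le> exp (1 / 2 * C) * t powr (2 * \<sigma> - 1) * (norm (Gamma (Complex (1/2) t)))\<^sup>2"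
  proof -
    have "a * C \<le> 1 / 2 * C" using a by (intro mult_right_mono) (auto simp: C_def)
    then show ?thesis by (intro mult_right_mono) auto
  qed
  finally show ?thesis unfolding C_def .
qed

text \<open>
  On this line \<open>cnj z = 1 - z\<close>, so the reflection formula evaluates the square exactly, as
  \<open>pi / cosh (pi * t)\<close>.
\<close>
lemma norm_Gamma_half:
  "(norm (Gamma (Complex (1/2) t)))\<^sup>2 \<le> 2 * pi * exp (- pi * t)"
proof -
  let ?z = "Complex (1/2) t"
  have "cnj ?z = 1 - ?z" by (simp add: complex_eq_iff)
  then have "of_real ((norm (Gamma ?z))\<^sup>2) = Gamma ?z * Gamma (1 - ?z)"
    by (simp only: complex_norm_square cnj_Gamma)
  also have "\<dots> = of_real pi / sin (of_real pi * ?z)" by (rule Gamma_reflection_complex)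
  also have "sin (of_real pi * ?z) = of_real (cosh (pi * t))"
  proof -
    have "of_real pi * ?z = of_real pi / 2 + \<i> * of_real (pi * t)" by (simp add: complex_eq_iff)
    then have "sin (of_real pi * ?z) = cos (\<i> * of_real (pi * t))"
      by (simp add: sin_add)
    then show ?thesis by (simp add: cos_exp_eq cosh_def scaleR_conv_of_real flip: exp_of_real)
  qed
  finally have "(norm (Gamma ?z))\<^sup>2 = pi / cosh (pi * t)" by (simp only: of_real_divide[symmetric] of_real_eq_iff)
  also have "\<dots> \<le> pi / (exp (pi * t) / 2)" 
    by (intro divide_left_mono) (auto simp: cosh_def intro!: mult_pos_pos add_pos_pos)
  finally show ?thesis by (simp add: exp_minus field_simps)
qed

lemma norm_Gamma_le:
  obtains K where "K > 0" "\<And>s. 0 < Re s \<Longrightarrow> Re s \<le> 1 / 2 \<Longrightarrow> Im s \<ge> 2 \<Longrightarrow>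
    norm (Gamma s) \<le> K * Im s powr (Re s - 1 / 2) * exp (- pi * Im s / 2)"
proof
  define K where "K = sqrt (exp (1 / 2 * (8 * (1 + pi\<^sup>2 / 6))) * (2 * pi))"
  show "K > 0" by (simp add: K_def)
  fix s assume s: "0 < Re s" "Re s \<le> 1 / 2" "Im s \<ge> 2"
  let ?t = "Im s"
  have "(norm (Gamma (Complex (Re s) ?t)))\<^sup>2 \<le> exp (1 / 2 * (8 * (1 + pi\<^sup>2 / 6))) * ?t powr (2 * Re s - 1) * (norm (Gamma (Complex (1/2) ?t)))\<^sup>2"
    by (rule norm_Gamma_compare[OF s])
  also have "\<dots> \<le> exp (1 / 2 * (8 * (1 + pi\<^sup>2 / 6))) * ?t powr (2 * Re s - 1) * (2 * pi * exp (- pi * ?t))"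
    by (intro mult_left_mono norm_Gamma_half) auto
  also have "\<dots> = (K * ?t powr (Re s - 1 / 2) * exp (- pi * ?t / 2))\<^sup>2"
  proof -
    have "?t powr (2 * Re s - 1) = (?t powr (Re s - 1 / 2))\<^sup>2" by (simp add: power2_eq_square flip: powr_add)
    moreover have "exp (- pi * ?t) = (exp (- pi * ?t / 2))\<^sup>2" by (simp add: power2_eq_square flip: exp_add)
    moreover have "K\<^sup>2 = exp (1 / 2 * (8 * (1 + pi\<^sup>2 / 6))) * (2 * pi)" by (simp add: K_def)
    ultimately show ?thesis by (simp only: power_mult_distrib mult_ac)
  qed
  finally have "norm (Gamma (Complex (Re s) ?t)) \<le> K * ?t powr (Re s - 1 / 2) * exp (- pi * ?t / 2)"
    by (rule power2_le_imp_le) (use \<open>K > 0\<close> in auto)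
  then show "norm (Gamma s) \<le> K * ?t powr (Re s - 1 / 2) * exp (- pi * ?t / 2)" by simp
qed

lemma norm_sin_le_exp: "norm (sin z) \<le> exp \<bar>Im z\<bar>"
proof -
  have "norm (sin z) = norm (exp (\<i> * z) - exp (- (\<i> * z))) / 2" by (simp add: sin_exp_eq norm_divide norm_mult)
  also have "norm (exp (\<i> * z) - exp (- (\<i> * z))) \<le> norm (exp (\<i> * z)) + norm (exp (- (\<i> * z)))" by (rule norm_triangle_ineq4)
  also have "\<dots> = exp (- Im z) + exp (Im z)" by simp
  also have "\<dots> \<le> exp \<bar>Im z\<bar> + exp \<bar>Im z\<bar>" by (intro add_mono) auto
  finally show ?thesis by simp
qed

text \<open>
  The two Gamma factors on the right of the functional equation combine to \<open>\<pi> / sin\<close> by the reflection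
  formula. This and \<open>\<Gamma>(s)\<close> decay at the same exponential rate, so that only the power of \<open>Im s\<close> survives:
  to the left of the critical line \<open>\<zeta>\<close> is large wherever its mirror value is not small.
\<close>
theorem zeta_reflection_lower_bound:
  obtains c where "c > 0" "\<And>s. 0 < Re s \<Longrightarrow> Re s \<le> 1 / 2 \<Longrightarrow> Im s \<ge> 2 \<Longrightarrow>
    c * Im s powr (1 / 2 - Re s) * norm (zeta (1 - s)) \<le> norm (zeta s)"
proof -
  obtain K where K: "K > 0" "\<And>s. 0 < Re s \<Longrightarrow> Re s \<le> 1 / 2 \<Longrightarrow> Im s \<ge> 2 \<Longrightarrow>
    norm (Gamma s) \<le> K * Im s powr (Re s - 1 / 2) * exp (- pi * Im s / 2)" using norm_Gamma_le by blast
  show thesis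
  proof (rule that[of "1 / (2 * K)"])
    show "1 / (2 * K) > 0" using K by simp
    fix s assume s: "0 < Re s" "Re s \<le> 1 / 2" "Im s \<ge> 2"
    let ?t = "Im s"
    define e where "e = exp (- pi * ?t / 2)"
    have e: "e > 0" by (simp add: e_def)
    have r: "Gamma ((1 + s) / 2) * Gamma ((1 - s) / 2) = of_real pi / sin (of_real pi * ((1 + s) / 2))"
    proof -
      have e: "1 - (1 + s) / 2 = (1 - s) / 2" by (simp add: field_simps)
      show ?thesis using Gamma_reflection_complex[of "(1 + s) / 2"] unfolding e .
    qed
    have sn: "sin (of_real pi * ((1 + s) / 2)) \<noteq> 0"
    proof
      assume "sin (of_real pi * ((1 + s) / 2)) = 0"
      then have "Im (of_real pi * ((1 + s) / 2)) = 0" by (auto simp: sin_eq_0 dest!: arg_cong[of "1 + s" _ Im])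
      then show False using s by simp
    qed
    have "norm (sin (of_real pi * ((1 + s) / 2))) \<le> exp \<bar>Im (of_real pi * ((1 + s) / 2))\<bar>" by (rule norm_sin_le_exp)
    also have "\<bar>Im (of_real pi * ((1 + s) / 2))\<bar> = pi * ?t / 2" using s by (simp add: abs_mult)
    also have "exp (pi * ?t / 2) = 1 / e" by (simp add: e_def exp_minus field_simps)
    finally have "norm (of_real pi / sin (of_real pi * ((1 + s) / 2))) \<ge> pi / (1 / e)"
      unfolding norm_divide using sn e by (intro frac_le) auto
    then have g: "norm (Gamma ((1 + s) / 2) * Gamma ((1 - s) / 2)) \<ge> pi * e" unfolding r by simp
    have "norm (cpow (2 * pi) (s - 1)) = (2 * pi) powr (Re s - 1)" by (simp add: norm_cpow)
    also have "\<dots> \<ge> (2 * pi) powr (- 1)" using s pi_gt3 by (intro powr_mono) auto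
    finally have p: "norm (cpow (2 * pi) (s - 1)) \<ge> 1 / (2 * pi)" by (simp add: powr_minus_divide)
    have "(pi * e) * (1 / (2 * pi)) * norm (zeta (1 - s)) \<le> norm (Gamma ((1 + s) / 2) * Gamma ((1 - s) / 2)) * norm (cpow (2 * pi) (s - 1)) * norm (zeta (1 - s))"
      using e by (intro mult_right_mono mult_mono g p) auto
    also have "\<dots> = norm (Gamma s) * norm (zeta s)"
      using arg_cong[OF zeta_functional_equation[of s], of norm] s by (simp add: norm_mult)
    also have "\<dots> \<le> (K * ?t powr (Re s - 1 / 2) * e) * norm (zeta s)"
      unfolding e_def by (intro mult_right_mono K s) auto
    finally have "e * (norm (zeta (1 - s)) / 2) \<le> e * (K * ?t powr (Re s - 1 / 2) * norm (zeta s))"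
      by (simp add: mult_ac)
    then have "norm (zeta (1 - s)) / 2 \<le> K * ?t powr (Re s - 1 / 2) * norm (zeta s)" using e by simp
    then have "?t powr (1 / 2 - Re s) * (norm (zeta (1 - s)) / 2) \<le> ?t powr (1 / 2 - Re s) * (K * ?t powr (Re s - 1 / 2) * norm (zeta s))"
      by (intro mult_left_mono) auto
    also have "\<dots> = K * norm (zeta s) * (?t powr (1 / 2 - Re s) * ?t powr (Re s - 1 / 2))" by (simp add: mult_ac)
    also have "?t powr (1 / 2 - Re s) * ?t powr (Re s - 1 / 2) = 1" using s by (simp flip: powr_add)
    finally show "1 / (2 * K) * ?t powr (1 / 2 - Re s) * norm (zeta (1 - s)) \<le> norm (zeta s)"
      using K(1) by (simp add: field_simps)
  qed
qed

section \<open>Laplace transforms and Landau's theorem\<close>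

definition laplace :: "(real \<Rightarrow> real) \<Rightarrow> complex \<Rightarrow> complex" where
  "laplace g s = (\<integral>u. of_real (g u) * exp (- (s * of_real u)) \<partial>lborel)"

definition laplace_conv :: "(real \<Rightarrow> real) \<Rightarrow> real \<Rightarrow> bool" where
  "laplace_conv g \<sigma> \<longleftrightarrow> integrable lborel (\<lambda>u. g u * exp (- (\<sigma> * u)))"

lemma laplace_conv_measurable:
  assumes "laplace_conv g \<sigma>"
  shows "g \<in> borel_measurable borel"
proof -
  have [measurable]: "(\<lambda>u. g u * exp (- (\<sigma> * u))) \<in> borel_measurable borel"
    using assms by (auto simp: laplace_conv_def)
  have "g = (\<lambda>u. (g u * exp (- (\<sigma> * u))) * exp (\<sigma> * u))"
    by (simp add: fun_eq_iff mult.assoc exp_minus)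
  also have "\<dots> \<in> borel_measurable borel" by measurable
  finally show ?thesis .
qed

lemma laplace_conv_mono:
  assumes "laplace_conv g \<sigma>" "\<sigma> \<le> \<tau>" and supp: "\<And>u. u < 0 \<Longrightarrow> g u = 0"
  shows "laplace_conv g \<tau>"
  unfolding laplace_conv_def
proof (rule Bochner_Integration.integrable_bound)
  show "integrable lborel (\<lambda>u. g u * exp (- (\<sigma> * u)))" using assms by (simp add: laplace_conv_def)
  show "(\<lambda>u. g u * exp (- (\<tau> * u))) \<in> borel_measurable lborel"
    using laplace_conv_measurable[OF assms(1)] by simp
  show "AE u in lborel. norm (g u * exp (- (\<tau> * u))) \<le> norm (g u * exp (- (\<sigma> * u)))"
  proof (rule AE_I2)
    fix u :: real
    show "norm (g u * exp (- (\<tau> * u))) \<le> norm (g u * exp (- (\<sigma> * u)))"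
      using supp[of u] assms(2) by (cases "u < 0") (auto simp: abs_mult intro!: mult_left_mono mult_right_mono)
  qed
qed

lemma laplace_integrable:
  assumes "laplace_conv g \<sigma>" "\<sigma> \<le> Re s" and supp: "\<And>u. u < 0 \<Longrightarrow> g u = 0"
  shows "integrable lborel (\<lambda>u. of_real (g u) * exp (- (s * of_real u)))"
proof (rule Bochner_Integration.integrable_bound)
  have "laplace_conv g (Re s)" by (rule laplace_conv_mono[OF assms])
  then show "integrable lborel (\<lambda>u. g u * exp (- (Re s * u)))" by (simp add: laplace_conv_def)
  show "(\<lambda>u. of_real (g u) * exp (- (s * of_real u))) \<in> borel_measurable lborel"
    using laplace_conv_measurable[OF assms(1)] by simp
qed (simp add: norm_mult abs_mult)

text \<open>
  The Taylor coefficients at \<open>c\<close> of the Laplace transform.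
\<close>
definition laplace_coeff :: "(real \<Rightarrow> real) \<Rightarrow> complex \<Rightarrow> nat \<Rightarrow> complex" where
  "laplace_coeff g c k = (\<integral>u. of_real (g u) * exp (- (c * of_real u)) * of_real ((- u) ^ k / fact k) \<partial>lborel)"

text \<open>
  The terms of the exponential series of \<open>exp (r * u)\<close>; they dominate those of \<open>exp (- ((s - c) * u))\<close> for
  \<open>|s - c| \<le> r\<close>, which allows termwise integration.
\<close>
lemma laplace_term_bounds:
  assumes conv: "laplace_conv g a" and supp: "\<And>u. u < 0 \<Longrightarrow> g u = 0"
    and r: "a + r < Re c" "r \<ge> 0"
  defines "p \<equiv> \<lambda>k u. \<bar>g u\<bar> * exp (- (Re c * u)) * (r * u) ^ k / fact k"
  shows "integrable lborel (p k)" "summable (\<lambda>k. \<integral>u. p k u \<partial>lborel)"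
    "\<And>u. (\<lambda>k. p k u) sums (\<bar>g u\<bar> * exp (- ((Re c - r) * u)))" "\<And>k u. p k u \<ge> 0"
proof -
  have [measurable]: "g \<in> borel_measurable borel" using conv by (rule laplace_conv_measurable)
  have p0: "p k u \<ge> 0" for k u
    using supp[of u] r by (cases "u < 0") (auto simp: p_def)
  then show "\<And>k u. p k u \<ge> 0" by blast
  have sums: "(\<lambda>k. p k u) sums (\<bar>g u\<bar> * exp (- ((Re c - r) * u)))" for u
  proof -
    have "(\<lambda>k. \<bar>g u\<bar> * exp (- (Re c * u)) * ((r * u) ^ k /\<^sub>R fact k)) sums (\<bar>g u\<bar> * exp (- (Re c * u)) * exp (r * u))"
      by (intro sums_mult exp_converges)
    moreover have "exp (- (Re c * u)) * exp (r * u) = exp (- ((Re c - r) * u))"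
      by (simp add: ring_distribs flip: exp_add)
    ultimately show ?thesis by (simp add: p_def divide_inverse mult_ac)
  qed
  then show "\<And>u. (\<lambda>k. p k u) sums (\<bar>g u\<bar> * exp (- ((Re c - r) * u)))" .
  have "laplace_conv g (Re c - r)" using r by (intro laplace_conv_mono[OF conv _ supp]) auto
  then have I: "integrable lborel (\<lambda>u. \<bar>g u\<bar> * exp (- ((Re c - r) * u)))"
    using integrable_norm by (fastforce simp: laplace_conv_def abs_mult)
  have fin: "(\<Sum>k<n. p k u) \<le> \<bar>g u\<bar> * exp (- ((Re c - r) * u))" for n u
    using sum_le_suminf[OF sums_summable[OF sums], of "{..<n}" u] p0 sums_unique[OF sums] by simp
  show int: "integrable lborel (p k)" for k
  proof (rule Bochner_Integration.integrable_bound[OF I])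
    show "p k \<in> borel_measurable lborel" unfolding p_def by measurable
    show "AE u in lborel. norm (p k u) \<le> norm (\<bar>g u\<bar> * exp (- ((Re c - r) * u)))"
    proof (rule AE_I2)
      fix u
      have "p k u \<le> (\<Sum>k<Suc k. p k u)" using p0 by (simp add: sum_nonneg)
      then show "norm (p k u) \<le> norm (\<bar>g u\<bar> * exp (- ((Re c - r) * u)))"
        using fin[where u = u and n = "Suc k"] p0[of k u] by simp
    qed
  qed
  show "summable (\<lambda>k. \<integral>u. p k u \<partial>lborel)"
  proof (rule summableI_nonneg_bounded)
    show "(\<integral>u. p k u \<partial>lborel) \<ge> 0" for k using p0 by (intro integral_nonneg_AE AE_I2)
    fix n
    have "(\<Sum>k<n. \<integral>u. p k u \<partial>lborel) = (\<integral>u. (\<Sum>k<n. p k u) \<partial>lborel)"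
      using int by (subst Bochner_Integration.integral_sum) auto
    also have "\<dots> \<le> (\<integral>u. \<bar>g u\<bar> * exp (- ((Re c - r) * u)) \<partial>lborel)"
      using int I fin by (intro integral_mono) auto
    finally show "(\<Sum>k<n. \<integral>u. p k u \<partial>lborel) \<le> (\<integral>u. \<bar>g u\<bar> * exp (- ((Re c - r) * u)) \<partial>lborel)" .
  qed
qed

lemma laplace_power_series:
  assumes conv: "laplace_conv g a" and supp: "\<And>u. u < 0 \<Longrightarrow> g u = 0"
    and s: "norm (s - c) < Re c - a"
  shows "(\<lambda>k. laplace_coeff g c k * (s - c) ^ k) sums laplace g s"
proof -
  have [measurable]: "g \<in> borel_measurable borel" using conv by (rule laplace_conv_measurable)
  define f where "f = (\<lambda>k u. of_real (g u) * exp (- (c * of_real u)) * of_real ((- u) ^ k / fact k) * (s - c) ^ k)"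
  define p where "p = (\<lambda>k u. \<bar>g u\<bar> * exp (- (Re c * u)) * (norm (s - c) * u) ^ k / fact k)"
  have r: "a + norm (s - c) < Re c" "norm (s - c) \<ge> 0" using s by auto
  have P: "integrable lborel (p k)" "summable (\<lambda>k. \<integral>u. p k u \<partial>lborel)"
    "(\<lambda>k. p k u) sums (\<bar>g u\<bar> * exp (- ((Re c - norm (s - c)) * u)))" "p k u \<ge> 0" for k u
    unfolding p_def by (rule laplace_term_bounds[OF conv supp r]; assumption)+
  have nf: "norm (f k u) = p k u" for k u
  proof (cases "u < 0")
    case True then show ?thesis using supp by (simp add: f_def p_def)
  next
    case False
    then have "norm (complex_of_real ((- u) ^ k / fact k)) = u ^ k / fact k"
      by (simp add: norm_divide norm_power)
    then show ?thesis unfolding f_def p_def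
      by (simp only: norm_mult norm_power norm_exp_eq_Re norm_of_real) (simp add: power_mult_distrib mult_ac)
  qed
  have f_int: "integrable lborel (f k)" for k
  proof (rule Bochner_Integration.integrable_bound[OF P(1)[of k]])
    show "f k \<in> borel_measurable lborel" unfolding f_def by measurable
  qed (simp add: nf P(4))
  have f_sums: "(\<lambda>k. f k u) sums (of_real (g u) * exp (- (s * of_real u)))" for u
  proof -
    have "(\<lambda>k. of_real (g u) * exp (- (c * of_real u)) * ((- (of_real u * (s - c))) ^ k /\<^sub>R fact k)) sums
       (of_real (g u) * exp (- (c * of_real u)) * exp (- (of_real u * (s - c))))"
      by (intro sums_mult exp_converges)
    moreover have "exp (- (c * of_real u)) * exp (- (of_real u * (s - c))) = exp (- (s * of_real u))"
      by (simp add: ring_distribs mult.commute flip: exp_add)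
    moreover have "of_real (g u) * exp (- (c * of_real u)) * ((- (of_real u * (s - c))) ^ k /\<^sub>R fact k) = f k u" for k
    proof -
      have "- (of_real u * (s - c)) = of_real (- u) * (s - c)" by simp
      then have "(- (of_real u * (s - c))) ^ k = of_real ((- u) ^ k) * (s - c) ^ k"
        by (simp only: power_mult_distrib of_real_power)
      then show ?thesis by (simp add: f_def scaleR_conv_of_real divide_inverse del: of_real_power)
    qed
    ultimately show ?thesis by (simp add: mult.assoc)
  qed
  have "(\<lambda>k. integral\<^sup>L lborel (f k)) sums (\<integral>u. (\<Sum>k. f k u) \<partial>lborel)"
  proof (rule sums_integral[OF f_int])
    show "AE u in lborel. summable (\<lambda>k. norm (f k u))" using P(3) by (auto simp: nf sums_iff)
    show "summable (\<lambda>k. \<integral>u. norm (f k u) \<partial>lborel)" using P(2) by (simp add: nf)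
  qed
  moreover have "integral\<^sup>L lborel (f k) = laplace_coeff g c k * (s - c) ^ k" for k
    unfolding f_def laplace_coeff_def by simp
  moreover have "(\<integral>u. (\<Sum>k. f k u) \<partial>lborel) = laplace g s"
    unfolding laplace_def using f_sums by (simp add: sums_iff)
  ultimately show ?thesis by simp
qed

lemma laplace_holomorphic:
  assumes conv: "laplace_conv g a" and supp: "\<And>u. u < 0 \<Longrightarrow> g u = 0"
  shows "laplace g holomorphic_on {s. Re s > a}"
  unfolding holomorphic_on_def
proof safe
  fix c assume c: "Re c > a"
  have hol: "laplace g holomorphic_on ball c (Re c - a)"
  proof (rule power_series_holomorphic)
    fix w assume "w \<in> ball c (Re c - a)"
    then have "norm (w - c) < Re c - a" by (simp add: dist_norm norm_minus_commute)
    then show "(\<lambda>k. laplace_coeff g c k * (w - c) ^ k) sums laplace g w"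
      by (intro laplace_power_series[OF conv supp])
  qed
  have "laplace g field_differentiable (at c)"
    by (rule holomorphic_on_imp_differentiable_at[OF hol open_ball]) (use c in simp)
  then show "laplace g field_differentiable (at c within {s. Re s > a})"
    by (rule field_differentiable_at_within)
qed

lemma laplace_holomorphic_halfplane:
  assumes conv: "\<And>\<sigma>. \<sigma> > \<kappa> \<Longrightarrow> laplace_conv g \<sigma>" and supp: "\<And>u. u < 0 \<Longrightarrow> g u = 0"
  shows "laplace g holomorphic_on {s. Re s > \<kappa>}"
  unfolding holomorphic_on_def
proof safe
  fix s assume s: "Re s > \<kappa>"
  have "laplace g holomorphic_on {z. Re z > (Re s + \<kappa>) / 2}"
    using s by (intro laplace_holomorphic conv supp) auto
  then have "laplace g field_differentiable (at s)"
    by (rule holomorphic_on_imp_differentiable_at[OF _ open_Re_gt]) (use s in auto)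
  then show "laplace g field_differentiable (at s within {s. \<kappa> < Re s})" by (rule field_differentiable_at_within)
qed

lemma power_series_coeffs_unique:
  fixes a b :: "nat \<Rightarrow> complex"
  assumes "r > 0" "\<And>w. norm w < r \<Longrightarrow> (\<lambda>k. a k * w ^ k) sums f w" "\<And>w. norm w < r \<Longrightarrow> (\<lambda>k. b k * w ^ k) sums f w"
  shows "a = b"
proof -
  have e: "eventually (\<lambda>w. norm w < r) (nhds (0::complex))"
    using eventually_nhds_in_open[of "ball 0 r" "0::complex"] assms(1) by simp
  have "f has_fps_expansion Abs_fps a"
    by (rule has_fps_expansionI) (use e assms(2) in \<open>auto elim!: eventually_mono\<close>)
  moreover have "f has_fps_expansion Abs_fps b"
    by (rule has_fps_expansionI) (use e assms(3) in \<open>auto elim!: eventually_mono\<close>)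
  ultimately have "Abs_fps a = Abs_fps b" using fps_expansion_unique_complex by metis
  then show ?thesis by (metis ext fps_nth_Abs_fps)
qed

text \<open>
  Landau's theorem. Suppose that the abscissa of convergence \<open>\<sigma>0\<close> of a nonnegative function exceeded
  \<open>\<beta>\<close>. As \<open>\<Phi>\<close> is holomorphic at \<open>\<sigma>0\<close>, its Taylor series around a point \<open>c\<close> slightly to
  the right converges at a real point to the left of \<open>\<sigma>0\<close>. At such a point all terms
  of the Taylor series are integrals of nonnegative functions, so sum and integral may be
  interchanged and the Laplace integral itself converges there, which contradicts the choice of \<open>\<sigma>0\<close>.
\<close>
theorem landau_nonneg_laplace:
  assumes nonneg: "\<And>u. g u \<ge> 0" and supp: "\<And>u. u < 0 \<Longrightarrow> g u = 0"
    and conv: "laplace_conv g b"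
    and S: "open S" "convex S" "\<And>x. \<beta> < x \<Longrightarrow> x \<le> b \<Longrightarrow> of_real x \<in> S"
    and \<Phi>: "\<Phi> holomorphic_on S" "\<And>s. s \<in> S \<Longrightarrow> Re s > b \<Longrightarrow> \<Phi> s = laplace g s"
    and \<beta>: "\<beta> < \<sigma>"
  shows "laplace_conv g \<sigma>"
proof (rule ccontr)
  assume nconv: "\<not> laplace_conv g \<sigma>"
  have [measurable]: "g \<in> borel_measurable borel" using conv by (rule laplace_conv_measurable)
  define A where "A = {\<tau>. laplace_conv g \<tau>}"
  have lower: "\<sigma> < \<tau>" if "\<tau> \<in> A" for \<tau>
    using nconv laplace_conv_mono[OF _ _ supp, where \<sigma> = \<tau> and \<tau> = \<sigma>] that by (force simp: A_def)
  have bA: "b \<in> A" using conv by (simp add: A_def)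
  have bdd: "bdd_below A" using lower by (intro bdd_belowI[of _ \<sigma>]) (auto intro: less_imp_le)
  define \<sigma>0 where "\<sigma>0 = Inf A"
  have s0: "\<sigma> \<le> \<sigma>0" unfolding \<sigma>0_def using bA lower by (intro cInf_greatest) (auto intro: less_imp_le)
  have s0b: "\<sigma>0 \<le> b" unfolding \<sigma>0_def using bA bdd by (rule cInf_lower)
  have above: "laplace_conv g \<tau>" if "\<tau> > \<sigma>0" for \<tau>
  proof -
    have "\<exists>\<tau>'\<in>A. \<tau>' < \<tau>" using that bA unfolding \<sigma>0_def by (intro cInf_lessD) auto
    then obtain \<tau>' where "\<tau>' \<in> A" "\<tau>' < \<tau>" by blast
    then show ?thesis using laplace_conv_mono[OF _ _ supp, where \<sigma> = \<tau>' and \<tau> = \<tau>] by (simp add: A_def)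
  qed
  have hol: "laplace g holomorphic_on {s. Re s > \<sigma>0}"
    by (rule laplace_holomorphic_halfplane[OF above supp])
  have "complex_of_real \<sigma>0 \<in> S" using S(3)[of \<sigma>0] s0 s0b \<beta> by simp
  then obtain R where R: "R > 0" "ball (complex_of_real \<sigma>0) R \<subseteq> S" using S(1) openE by blast
  have agree: "\<Phi> s = laplace g s" if s: "s \<in> S" "Re s > \<sigma>0" for s
  proof (rule analytic_continuation_open[of "S \<inter> {s. Re s > b}" "S \<inter> {s. Re s > \<sigma>0}" \<Phi> "laplace g"])
    show "open (S \<inter> {s. Re s > b})" "open (S \<inter> {s. Re s > \<sigma>0})" using S by (auto intro!: open_Int open_Re_gt)
    show "connected (S \<inter> {s. Re s > \<sigma>0})"
      using S by (intro convex_connected convex_Int convex_halfspace_Re_gt)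
    show "S \<inter> {s. Re s > b} \<noteq> {}"
    proof -
      have "complex_of_real b \<in> S" using S(3)[of b] s0 s0b \<beta> by simp
      then obtain e where e: "e > 0" "ball (complex_of_real b) e \<subseteq> S" using S(1) openE by blast
      have "complex_of_real (b + e / 2) \<in> ball (of_real b) e" using e by (simp add: dist_norm)
      then have "complex_of_real (b + e / 2) \<in> S \<inter> {s. Re s > b}" using e by auto
      then show ?thesis by blast
    qed
    show "\<Phi> holomorphic_on S \<inter> {s. Re s > \<sigma>0}" "laplace g holomorphic_on S \<inter> {s. Re s > \<sigma>0}"
      using \<Phi>(1) hol by (auto elim: holomorphic_on_subset)
  qed (use \<Phi>(2) s s0b in auto)
  \<comment> \<open>With this choice the disc of radius \<open>2 r\<close> around \<open>c = \<sigma>0 + r\<close> stays inside the domain of \<open>\<Phi>\<close>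
    and contains \<open>c - 3 / 2 * r = \<sigma>0 - r / 2\<close>, which lies to the left of the abscissa.\<close>
  define r where "r = R / 3"
  define c where "c = complex_of_real (\<sigma>0 + r)"
  have r: "r > 0" using R by (simp add: r_def)
  have cball: "ball c (2 * r) \<subseteq> S"
  proof -
    have "dist (complex_of_real \<sigma>0) c = r" using r by (simp add: c_def dist_norm)
    then have "ball c (2 * r) \<subseteq> ball (complex_of_real \<sigma>0) R"
      by (auto simp: r_def) (smt (verit) dist_triangle)
    then show ?thesis using R by blast
  qed
  define d where "d = (\<lambda>k. (deriv ^^ k) \<Phi> c / fact k)"
  have d_sums: "(\<lambda>k. d k * (w - c) ^ k) sums \<Phi> w" if "norm (w - c) < 2 * r" for w
    unfolding d_def
  proof (rule holomorphic_power_series)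
    show "\<Phi> holomorphic_on ball c (2 * r)" using \<Phi>(1) cball by (rule holomorphic_on_subset)
    show "w \<in> ball c (2 * r)" using that by (simp add: dist_norm norm_minus_commute)
  qed
  have "laplace_coeff g c = d"
  proof (rule power_series_coeffs_unique)
    show "r / 2 > 0" using r by simp
    fix w :: complex assume w: "norm w < r / 2"
    show "(\<lambda>k. d k * w ^ k) sums \<Phi> (w + c)" using d_sums[of "w + c"] w r by simp
    have "(\<lambda>k. laplace_coeff g c k * w ^ k) sums laplace g (w + c)"
      using laplace_power_series[OF above supp, of "\<sigma>0 + r / 2" "w + c" c] w r by (simp add: c_def)
    moreover have "\<Phi> (w + c) = laplace g (w + c)"
    proof (rule agree)
      have "w + c \<in> ball c (2 * r)" using w r by (simp add: dist_norm)
      then show "w + c \<in> S" using cball by blast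
      show "Re (w + c) > \<sigma>0" using w r abs_Re_le_cmod[of w] by (simp add: c_def)
    qed
    ultimately show "(\<lambda>k. laplace_coeff g c k * w ^ k) sums \<Phi> (w + c)" by simp
  qed
  moreover have "(\<lambda>k. d k * (of_real (- (3 / 2 * r))) ^ k) sums \<Phi> (c + of_real (- (3 / 2 * r)))"
    using d_sums[of "c + of_real (- (3 / 2 * r))"] r by (simp add: norm_mult)
  ultimately have summ: "summable (\<lambda>k. laplace_coeff g c k * (of_real (- (3 / 2 * r))) ^ k)"
    by (auto simp: sums_iff)
  define f where "f = (\<lambda>k u. g u * exp (- (Re c * u)) * (3 / 2 * r * u) ^ k / fact k)"
  have f0: "f k u \<ge> 0" for k u
    using supp[of u] nonneg[of u] r by (cases "u < 0") (auto simp: f_def)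
  have gint: "integrable lborel (\<lambda>u. \<bar>g u\<bar> * exp (- (Re c * u)) * (r / 2 * u) ^ k / fact k)" for k
    using r by (intro laplace_term_bounds(1)[OF above supp, of "\<sigma>0 + r / 4"]) (auto simp: c_def)
  have fk: "f k u = (\<bar>g u\<bar> * exp (- (Re c * u)) * (r / 2 * u) ^ k / fact k) * 3 ^ k" for k u
  proof -
    have "3 / 2 * r * u = (r / 2 * u) * 3" by simp
    then have "(3 / 2 * r * u) ^ k = (r / 2 * u) ^ k * 3 ^ k" by (simp only: power_mult_distrib)
    then show ?thesis using nonneg[of u] by (simp add: f_def)
  qed
  have f_int: "integrable lborel (f k)" for k
    unfolding fk by (rule integrable_mult_left) (rule gint)
  have coeff: "laplace_coeff g c k * (of_real (- (3 / 2 * r))) ^ k = of_real (\<integral>u. f k u \<partial>lborel)" for k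
  proof -
    have "laplace_coeff g c k * (of_real (- (3 / 2 * r))) ^ k = (\<integral>u. of_real (g u) * exp (- (c * of_real u)) * of_real ((- u) ^ k / fact k) * (of_real (- (3 / 2 * r))) ^ k \<partial>lborel)"
      unfolding laplace_coeff_def by simp
    also have "\<dots> = (\<integral>u. of_real (f k u) \<partial>lborel)"
    proof (rule Bochner_Integration.integral_cong[OF refl])
      fix u :: real
      have "- (c * of_real u) = complex_of_real (- (Re c * u))" by (simp add: c_def)
      then have "exp (- (c * of_real u)) = complex_of_real (exp (- (Re c * u)))" by (simp only: exp_of_real)
      moreover have "(- u) * (- (3 / 2 * r)) = 3 / 2 * r * u" by simp
      then have "(- u) ^ k * (- (3 / 2 * r)) ^ k = (3 / 2 * r * u) ^ k" by (simp only: power_mult_distrib[symmetric])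
      then have "(- u) ^ k / fact k * (- (3 / 2 * r)) ^ k = (3 / 2 * r * u) ^ k / fact k" by simp
      ultimately show "of_real (g u) * exp (- (c * of_real u)) * of_real ((- u) ^ k / fact k) * (of_real (- (3 / 2 * r))) ^ k = complex_of_real (f k u)"
        unfolding f_def
        by (simp only: of_real_mult[symmetric] of_real_power[symmetric] of_real_eq_iff mult.assoc times_divide_eq_right[symmetric])
    qed
    also have "\<dots> = of_real (\<integral>u. f k u \<partial>lborel)" by simp
    finally show ?thesis .
  qed
  have f_sums: "(\<lambda>k. f k u) sums (g u * exp (- ((\<sigma>0 - r / 2) * u)))" for u
  proof -
    have "f k u = g u * exp (- (Re c * u)) * ((3 / 2 * r * u) ^ k /\<^sub>R fact k)" for k
      unfolding f_def real_scaleR_def by (simp only: divide_inverse mult_ac)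
    then have 1: "(\<lambda>k. f k u) sums (g u * exp (- (Re c * u)) * exp (3 / 2 * r * u))"
      by (simp only:) (intro sums_mult exp_converges)
    have e: "exp (- (Re c * u)) * exp (3 / 2 * r * u) = exp (- ((\<sigma>0 - r / 2) * u))"
    proof -
      have "- (Re c * u) + 3 / 2 * r * u = - ((\<sigma>0 - r / 2) * u)" by (simp add: c_def algebra_simps)
      then show ?thesis by (simp only: exp_add[symmetric])
    qed
    show ?thesis using 1 unfolding mult.assoc[of "g u"] e .
  qed
  have "integrable lborel (\<lambda>u. \<Sum>k. f k u)"
  proof (rule integrable_suminf[OF f_int])
    show "AE u in lborel. summable (\<lambda>k. norm (f k u))" using f_sums f0 by (auto simp: sums_iff)
    show "summable (\<lambda>k. \<integral>u. norm (f k u) \<partial>lborel)" using summ f0 unfolding coeff by (simp add: summable_of_real_iff)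
  qed
  also have "(\<lambda>u. \<Sum>k. f k u) = (\<lambda>u. g u * exp (- ((\<sigma>0 - r / 2) * u)))" using f_sums by (auto simp: sums_iff)
  finally have "\<sigma>0 - r / 2 \<in> A" by (simp add: A_def laplace_conv_def)
  then have "\<sigma>0 \<le> \<sigma>0 - r / 2" unfolding \<sigma>0_def using bdd by (intro cInf_lower)
  then show False using r by simp
qed

section \<open>A Bessel inequality for the Fourier transform\<close>

text \<open>
  The characteristic function of the standard normal distribution, rescaled.
\<close>
lemma gaussian_fourier:
  assumes S: "S > 0"
  shows "has_bochner_integral lborel (\<lambda>t. of_real (exp (- t\<^sup>2 / (2 * S\<^sup>2))) * exp (\<i> * of_real (t * y)))
    (complex_of_real (S * sqrt (2 * pi) * exp (- (S * y)\<^sup>2 / 2)))"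
proof -
  have std: "has_bochner_integral lborel (\<lambda>x. of_real (std_normal_density x) * exp (\<i> * of_real (S * y * x))) (complex_of_real (exp (- (S * y)\<^sup>2 / 2)))"
  proof -
    have "(CLINT x|std_normal_distribution. iexp (S * y * x)) = complex_of_real (exp (- (S * y)\<^sup>2 / 2))"
      using fun_cong[OF char_std_normal_distribution, of "S * y"] by (simp add: char_def)
    moreover have "(CLINT x|std_normal_distribution. iexp (S * y * x)) = (\<integral>x. std_normal_density x *\<^sub>R iexp (S * y * x) \<partial>lborel)"
      by (subst integral_density) auto
    moreover have "integrable lborel (\<lambda>x. std_normal_density x *\<^sub>R iexp (S * y * x))"
      by (rule Bochner_Integration.integrable_bound[OF integrable_normal_density[of 1 0]]) auto
    ultimately show ?thesis by (simp add: has_bochner_integral_iff scaleR_conv_of_real)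
  qed
  have "has_bochner_integral lborel (\<lambda>t. of_real (std_normal_density (0 + (1 / S) * t)) * exp (\<i> * of_real (S * y * (0 + (1 / S) * t)))) (complex_of_real (exp (- (S * y)\<^sup>2 / 2)) /\<^sub>R \<bar>1 / S\<bar>)"
    using S by (subst lborel_has_bochner_integral_real_affine_iff[symmetric, where t = 0 and c = "1 / S"]) (use std S in auto)
  then have "has_bochner_integral lborel (\<lambda>t. of_real (sqrt (2 * pi)) * (of_real (std_normal_density (0 + (1 / S) * t)) * exp (\<i> * of_real (S * y * (0 + (1 / S) * t))))) (of_real (sqrt (2 * pi)) * (complex_of_real (exp (- (S * y)\<^sup>2 / 2)) /\<^sub>R \<bar>1 / S\<bar>))"
    by (rule has_bochner_integral_mult_right)
  moreover have "of_real (sqrt (2 * pi)) * (of_real (std_normal_density (0 + (1 / S) * t)) * exp (\<i> * of_real (S * y * (0 + (1 / S) * t)))) = of_real (exp (- t\<^sup>2 / (2 * S\<^sup>2))) * exp (\<i> * of_real (t * y))" for t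
  proof -
    have "sqrt (2 * pi) * std_normal_density (0 + (1 / S) * t) = exp (- t\<^sup>2 / (2 * S\<^sup>2))"
      by (simp add: std_normal_density_def power_divide)
    then have "complex_of_real (sqrt (2 * pi)) * of_real (std_normal_density (0 + (1 / S) * t)) = of_real (exp (- t\<^sup>2 / (2 * S\<^sup>2)))"
      by (simp only: of_real_mult[symmetric])
    moreover have "S * y * (0 + (1 / S) * t) = t * y" using S by simp
    ultimately show ?thesis by (simp only: mult.assoc[symmetric])
  qed
  moreover have "of_real (sqrt (2 * pi)) * (complex_of_real (exp (- (S * y)\<^sup>2 / 2)) /\<^sub>R \<bar>1 / S\<bar>) = complex_of_real (S * sqrt (2 * pi) * exp (- (S * y)\<^sup>2 / 2))"
    using S by (simp add: scaleR_conv_of_real)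
  ultimately show ?thesis by (simp only:)
qed

lemma gaussian_total:
  assumes S: "S > 0"
  shows "has_bochner_integral lborel (\<lambda>v. S * sqrt (2 * pi) * exp (- (S * (u - v))\<^sup>2 / 2)) (2 * pi)"
proof -
  have "has_bochner_integral lborel (\<lambda>v. std_normal_density (S * u + (- S) * v)) (1 /\<^sub>R \<bar>- S\<bar>)"
    using S by (subst lborel_has_bochner_integral_real_affine_iff[symmetric, where t = "S * u" and c = "- S"])
      (auto simp: has_bochner_integral_iff)
  then have "has_bochner_integral lborel (\<lambda>v. (S * (2 * pi)) * std_normal_density (S * u + (- S) * v)) ((S * (2 * pi)) * (1 /\<^sub>R \<bar>- S\<bar>))"
    by (rule has_bochner_integral_mult_right)
  moreover have "(S * (2 * pi)) * std_normal_density (S * u + (- S) * v) = S * sqrt (2 * pi) * exp (- (S * (u - v))\<^sup>2 / 2)" for v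
  proof -
    have "2 * pi / sqrt (2 * pi) = sqrt (2 * pi)" by (simp add: real_div_sqrt)
    moreover have "S * u + (- S) * v = S * (u - v)" by (simp add: algebra_simps)
    moreover have "S * (2 * pi) * (1 / sqrt (2 * pi) * E) = S * (2 * pi / sqrt (2 * pi)) * E" for E by simp
    ultimately show ?thesis by (simp only: std_normal_density_def)
  qed
  moreover have "(S * (2 * pi)) * (1 /\<^sub>R \<bar>- S\<bar>) = 2 * pi" using S by simp
  ultimately show ?thesis by (simp only:)
qed

text \<open>
  Plancherel's theorem with a Gaussian weight, as an inequality. The weight lets Fubini's theorem apply to
  an integrable \<open>k\<close> and turns the left-hand side into the double integral of \<open>k(u) k(v) W(v - u)\<close>,
  where \<open>W\<close>, the transform of the weight, is nonnegative, even and of total mass \<open>2\<pi>\<close>. Then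
  \<open>|k(u) k(v)| \<le> (k(u)\<^sup>2 + k(v)\<^sup>2) / 2\<close> finishes the proof. The bound is uniform in \<open>S\<close>.
\<close>
theorem fourier_gaussian_bessel:
  fixes k :: "real \<Rightarrow> real"
  assumes k1: "integrable lborel k" and k2: "integrable lborel (\<lambda>u. (k u)\<^sup>2)" and S: "S > 0"
  defines "F \<equiv> \<lambda>t. \<integral>u. of_real (k u) * exp (- (\<i> * of_real (t * u))) \<partial>lborel"
  shows "integrable lborel (\<lambda>t. exp (- t\<^sup>2 / (2 * S\<^sup>2)) * (norm (F t))\<^sup>2)"
    and "(\<integral>t. exp (- t\<^sup>2 / (2 * S\<^sup>2)) * (norm (F t))\<^sup>2 \<partial>lborel) \<le> 2 * pi * (\<integral>u. (k u)\<^sup>2 \<partial>lborel)"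
proof -
  have [measurable]: "k \<in> borel_measurable borel" using k1 by auto
  define w where "w = (\<lambda>t. exp (- t\<^sup>2 / (2 * S\<^sup>2)))"
  define W where "W = (\<lambda>y. S * sqrt (2 * pi) * exp (- (S * y)\<^sup>2 / 2))"
  have [measurable]: "w \<in> borel_measurable borel" "W \<in> borel_measurable borel" by (simp_all add: w_def W_def)
  have W0: "W y \<ge> 0" for y using S by (simp add: W_def)
  have WI: "has_bochner_integral lborel (\<lambda>v. W (u - v)) (2 * pi)" for u
    unfolding W_def by (rule gaussian_total[OF S])
  have wI: "has_bochner_integral lborel (\<lambda>t. of_real (w t) * exp (\<i> * of_real (t * y))) (of_real (W y))" for y
    unfolding w_def W_def by (rule gaussian_fourier[OF S])
  have w1: "integrable lborel w"
    using wI[of 0] by (simp add: has_bochner_integral_iff complex_of_real_integrable_eq)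
  have [measurable]: "F \<in> borel_measurable borel" unfolding F_def by measurable
  define K where "K = (\<integral>u. \<bar>k u\<bar> \<partial>lborel)"
  have FK: "norm (F t) \<le> K" for t
  proof -
    have "norm (F t) \<le> (\<integral>u. norm (of_real (k u) * exp (- (\<i> * of_real (t * u)))) \<partial>lborel)"
      unfolding F_def by (rule integral_norm_bound)
    then show ?thesis by (simp add: K_def norm_mult)
  qed
  have K0: "K \<ge> 0" unfolding K_def by simp
  show "integrable lborel (\<lambda>t. exp (- t\<^sup>2 / (2 * S\<^sup>2)) * (norm (F t))\<^sup>2)"
  proof (rule Bochner_Integration.integrable_bound)
    show "integrable lborel (\<lambda>t. w t * K\<^sup>2)" using w1 by simp
    show "AE t in lborel. norm (exp (- t\<^sup>2 / (2 * S\<^sup>2)) * (norm (F t))\<^sup>2) \<le> norm (w t * K\<^sup>2)"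
      using FK by (intro AE_I2) (auto simp: w_def intro!: power_mono)
  qed measurable
  have kint: "integrable lborel (\<lambda>u. of_real (k u) * exp (\<i> * of_real (t * u)))" for t
    by (rule Bochner_Integration.integrable_bound[OF k1]) (auto simp: norm_mult)
  have cF: "cnj (F t) = (\<integral>u. of_real (k u) * exp (\<i> * of_real (t * u)) \<partial>lborel)" for t
  proof -
    have "cnj (F t) = (\<integral>u. cnj (of_real (k u) * exp (- (\<i> * of_real (t * u)))) \<partial>lborel)"
      unfolding F_def
    proof (rule integral_bounded_linear[OF bounded_linear_cnj, symmetric])
      show "integrable lborel (\<lambda>u. of_real (k u) * exp (- (\<i> * of_real (t * u))))"
        by (rule Bochner_Integration.integrable_bound[OF k1]) (auto simp: norm_mult)
    qed
    also have "\<dots> = (\<integral>u. of_real (k u) * exp (\<i> * of_real (t * u)) \<partial>lborel)"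
      by (rule Bochner_Integration.integral_cong) (simp_all add: exp_cnj)
    finally show ?thesis .
  qed
  define G where "G = (\<lambda>u. \<integral>v. k v * W (v - u) \<partial>lborel)"
  have inner: "(\<integral>t. of_real (w t) * (cnj (F t) * exp (- (\<i> * of_real (t * u)))) \<partial>lborel) = of_real (G u)" for u
  proof -
    define f where "f = (\<lambda>(v, t). complex_of_real (k v) * (of_real (w t) * exp (\<i> * of_real (t * (v - u)))))"
    have [measurable]: "f \<in> borel_measurable (lborel \<Otimes>\<^sub>M lborel)" unfolding f_def by measurable
    have "integrable (lborel \<Otimes>\<^sub>M lborel) f"
    proof (rule lborel_pair.Fubini_integrable)
      have "(\<integral>t. norm (f (v, t)) \<partial>lborel) = \<bar>k v\<bar> * (\<integral>t. w t \<partial>lborel)" for v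
        by (simp add: f_def norm_mult w_def)
      then show "integrable lborel (\<lambda>v. \<integral>t. norm (f (v, t)) \<partial>lborel)" using k1 by simp
    next
      show "AE v in lborel. integrable lborel (\<lambda>t. f (v, t))"
        unfolding f_def prod.case by (intro AE_I2 integrable_mult_right integrable.intros[OF wI])
    qed measurable
    then have "(\<integral>t. (\<integral>v. f (v, t) \<partial>lborel) \<partial>lborel) = (\<integral>v. (\<integral>t. f (v, t) \<partial>lborel) \<partial>lborel)"
      using lborel_pair.Fubini_integral[of "\<lambda>v t. f (v, t)"] by simp
    moreover have "(\<integral>v. f (v, t) \<partial>lborel) = of_real (w t) * (cnj (F t) * exp (- (\<i> * of_real (t * u))))" for t
    proof -
      have "f (v, t) = of_real (w t) * ((of_real (k v) * exp (\<i> * of_real (t * v))) * exp (- (\<i> * of_real (t * u))))" for v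
        by (simp add: f_def exp_diff exp_minus algebra_simps divide_inverse)
      then have "(\<integral>v. f (v, t) \<partial>lborel) = (\<integral>v. of_real (w t) * ((of_real (k v) * exp (\<i> * of_real (t * v))) * exp (- (\<i> * of_real (t * u)))) \<partial>lborel)"
        by simp
      also have "\<dots> = of_real (w t) * (cnj (F t) * exp (- (\<i> * of_real (t * u))))"
        unfolding cF by (simp only: integral_mult_right_zero integral_mult_left_zero)
      finally show ?thesis .
    qed
    moreover have "(\<integral>t. f (v, t) \<partial>lborel) = of_real (k v * W (v - u))" for v
      using wI[of "v - u"] by (simp add: f_def has_bochner_integral_iff)
    ultimately show ?thesis by (simp add: G_def del: of_real_mult)
  qed
  have "complex_of_real (\<integral>t. w t * (norm (F t))\<^sup>2 \<partial>lborel) = (\<integral>t. of_real (w t * (norm (F t))\<^sup>2) \<partial>lborel)"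
    by (rule integral_complex_of_real[symmetric])
  also have "\<dots> = (\<integral>t. (\<integral>u. of_real (k u) * (of_real (w t) * (cnj (F t) * exp (- (\<i> * of_real (t * u))))) \<partial>lborel) \<partial>lborel)"
  proof (rule Bochner_Integration.integral_cong[OF refl])
    fix t
    have "(\<integral>u. of_real (k u) * (of_real (w t) * (cnj (F t) * exp (- (\<i> * of_real (t * u))))) \<partial>lborel) = (\<integral>u. (of_real (w t) * cnj (F t)) * (of_real (k u) * exp (- (\<i> * of_real (t * u)))) \<partial>lborel)"
      by (simp only: mult_ac)
    also have "\<dots> = (of_real (w t) * cnj (F t)) * F t" unfolding F_def by (simp only: integral_mult_right_zero)
    also have "\<dots> = of_real (w t) * (F t * cnj (F t))" by (simp only: mult_ac)
    also have "F t * cnj (F t) = of_real ((norm (F t))\<^sup>2)" by (simp only: complex_norm_square)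
    finally show "complex_of_real (w t * (norm (F t))\<^sup>2) = (\<integral>u. of_real (k u) * (of_real (w t) * (cnj (F t) * exp (- (\<i> * of_real (t * u))))) \<partial>lborel)"
      by simp
  qed
  also have "\<dots> = (\<integral>u. (\<integral>t. of_real (k u) * (of_real (w t) * (cnj (F t) * exp (- (\<i> * of_real (t * u))))) \<partial>lborel) \<partial>lborel)"
  proof -
    define Fc where "Fc = (\<lambda>t. cnj (F t))"
    have [measurable]: "Fc \<in> borel_measurable borel"
      unfolding Fc_def by (intro borel_measurable_continuous_on[OF _ \<open>F \<in> _\<close>] continuous_intros)
    define f where "f = (\<lambda>(u, t). complex_of_real (k u) * (of_real (w t) * (Fc t * exp (- (\<i> * of_real (t * u))))))"
    have [measurable]: "f \<in> borel_measurable (lborel \<Otimes>\<^sub>M lborel)" unfolding f_def by measurable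
    have wF: "integrable lborel (\<lambda>t. w t * norm (F t))"
    proof (rule Bochner_Integration.integrable_bound)
      show "integrable lborel (\<lambda>t. w t * K)" using w1 by simp
      show "AE t in lborel. norm (w t * norm (F t)) \<le> norm (w t * K)"
        using FK K0 by (intro AE_I2) (auto simp: w_def)
    qed measurable
    have "integrable (lborel \<Otimes>\<^sub>M lborel) f"
    proof (rule lborel_pair.Fubini_integrable)
      have "(\<integral>t. norm (f (u, t)) \<partial>lborel) = \<bar>k u\<bar> * (\<integral>t. w t * norm (F t) \<partial>lborel)" for u
        by (simp add: f_def Fc_def norm_mult w_def)
      then show "integrable lborel (\<lambda>u. \<integral>t. norm (f (u, t)) \<partial>lborel)" using k1 by simp
    next
      show "AE u in lborel. integrable lborel (\<lambda>t. f (u, t))"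
      proof (rule AE_I2)
        fix u
        show "integrable lborel (\<lambda>t. f (u, t))"
        proof (rule Bochner_Integration.integrable_bound[OF integrable_mult_right[OF wF, of "k u"]])
          show "(\<lambda>t. f (u, t)) \<in> borel_measurable lborel" by measurable
          show "AE t in lborel. norm (f (u, t)) \<le> norm (k u * (w t * norm (F t)))"
            by (intro AE_I2) (simp add: f_def Fc_def norm_mult abs_mult w_def)
        qed
      qed
    qed measurable
    then show ?thesis
      using lborel_pair.Fubini_integral[of "\<lambda>v t. f (v, t)"] by (simp add: f_def Fc_def)
  qed
  also have "\<dots> = (\<integral>u. of_real (k u * G u) \<partial>lborel)"
    by (simp only: integral_mult_right_zero inner) simp
  also have "\<dots> = of_real (\<integral>u. k u * G u \<partial>lborel)" by (rule integral_complex_of_real)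
  finally have eq: "(\<integral>t. w t * (norm (F t))\<^sup>2 \<partial>lborel) = (\<integral>u. k u * G u \<partial>lborel)" by (simp only: of_real_eq_iff)
  \<comment> \<open>\<open>A\<close> and its mirror image dominate the double integrand \<open>B\<close>, and both integrate to \<open>2\<pi>\<close> times
    the integral of \<open>k\<^sup>2\<close>.\<close>
  define A where "A = (\<lambda>(u, v). (k u)\<^sup>2 * W (v - u))"
  have Wsym: "W (v - u) = W (u - v)" for u v by (simp add: W_def power2_eq_square algebra_simps)
  have [measurable]: "A \<in> borel_measurable (lborel \<Otimes>\<^sub>M lborel)" unfolding A_def by measurable
  have A_u: "has_bochner_integral lborel (\<lambda>v. A (u, v)) ((k u)\<^sup>2 * (2 * pi))" for u
    unfolding A_def prod.case Wsym[of _ u] by (intro has_bochner_integral_mult_right WI)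
  have A0: "A p \<ge> 0" for p using W0 by (auto simp: A_def split: prod.splits)
  have A_int: "integrable (lborel \<Otimes>\<^sub>M lborel) A"
  proof (rule lborel_pair.Fubini_integrable)
    show "integrable lborel (\<lambda>u. \<integral>v. norm (A (u, v)) \<partial>lborel)"
      using A_u A0 k2 by (simp add: has_bochner_integral_iff)
  qed (use A_u in \<open>auto simp: has_bochner_integral_iff\<close>)
  have A'_int: "integrable (lborel \<Otimes>\<^sub>M lborel) (\<lambda>(u, v). A (v, u))"
    using lborel_pair.integrable_product_swap[OF A_int] by (simp add: case_prod_unfold)
  define B where "B = (\<lambda>(u, v). k u * (k v * W (v - u)))"
  have [measurable]: "B \<in> borel_measurable (lborel \<Otimes>\<^sub>M lborel)" unfolding B_def by measurable
  have BA: "\<bar>B (u, v)\<bar> \<le> (A (u, v) + A (v, u)) / 2" for u v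
  proof -
    have "\<bar>k u * k v\<bar> \<le> ((k u)\<^sup>2 + (k v)\<^sup>2) / 2"
      using sum_squares_bound[of "\<bar>k u\<bar>" "\<bar>k v\<bar>"] by (simp add: abs_mult)
    then have "\<bar>k u * k v\<bar> * W (v - u) \<le> ((k u)\<^sup>2 + (k v)\<^sup>2) / 2 * W (v - u)"
      using W0 by (intro mult_right_mono) auto
    then show ?thesis using W0[of "v - u"] Wsym[of u v] by (simp add: A_def B_def abs_mult algebra_simps)
  qed
  have AA_int: "integrable (lborel \<Otimes>\<^sub>M lborel) (\<lambda>p. (A p + (case p of (u, v) \<Rightarrow> A (v, u))) / 2)"
    using A_int A'_int by simp
  have B_int: "integrable (lborel \<Otimes>\<^sub>M lborel) B"
    by (rule Bochner_Integration.integrable_bound[OF AA_int]) (use BA A0 in \<open>auto split: prod.splits intro!: AE_I2\<close>)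
  have "(\<integral>u. k u * G u \<partial>lborel) = (\<integral>u. (\<integral>v. B (u, v) \<partial>lborel) \<partial>lborel)"
    by (simp add: B_def G_def)
  also have "\<dots> = integral\<^sup>L (lborel \<Otimes>\<^sub>M lborel) B" by (rule lborel_pair.integral_fst'[OF B_int])
  also have "\<dots> \<le> integral\<^sup>L (lborel \<Otimes>\<^sub>M lborel) (\<lambda>p. (A p + (case p of (u, v) \<Rightarrow> A (v, u))) / 2)"
  proof (rule integral_mono[OF B_int AA_int])
    fix p :: "real \<times> real"
    obtain u v where p: "p = (u, v)" by (cases p)
    show "B p \<le> (A p + (case p of (u, v) \<Rightarrow> A (v, u))) / 2"
      using abs_le_D1[OF BA[of u v]] by (simp add: p)
  qed
  also have "\<dots> = (integral\<^sup>L (lborel \<Otimes>\<^sub>M lborel) A + integral\<^sup>L (lborel \<Otimes>\<^sub>M lborel) (\<lambda>(u, v). A (v, u))) / 2"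
    using A_int A'_int by simp
  also have "integral\<^sup>L (lborel \<Otimes>\<^sub>M lborel) (\<lambda>(u, v). A (v, u)) = integral\<^sup>L (lborel \<Otimes>\<^sub>M lborel) A"
    using lborel_pair.integral_product_swap[of A] by simp
  also have "(integral\<^sup>L (lborel \<Otimes>\<^sub>M lborel) A + integral\<^sup>L (lborel \<Otimes>\<^sub>M lborel) A) / 2 = integral\<^sup>L (lborel \<Otimes>\<^sub>M lborel) A" by simp
  also have "\<dots> = (\<integral>u. (\<integral>v. A (u, v) \<partial>lborel) \<partial>lborel)" by (rule lborel_pair.integral_fst'[OF A_int, symmetric])
  also have "\<dots> = 2 * pi * (\<integral>u. (k u)\<^sup>2 \<partial>lborel)" using A_u by (simp add: has_bochner_integral_iff mult.commute)
  finally show "(\<integral>t. exp (- t\<^sup>2 / (2 * S\<^sup>2)) * (norm (F t))\<^sup>2 \<partial>lborel) \<le> 2 * pi * (\<integral>u. (k u)\<^sup>2 \<partial>lborel)"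
    using eq by (simp add: w_def)
qed

section \<open>The mean square of the zeta function\<close>

lemma sum_powr_le:
  fixes x :: real
  assumes x: "0 < x" "x < 1"
  shows "(\<Sum>n<N. real (Suc n) powr (- x)) \<le> real N powr (1 - x) / (1 - x)"
proof (induction N)
  case (Suc N)
  have "real (Suc N) powr (- x) \<le> (real (Suc N) powr (1 - x) - real N powr (1 - x)) / (1 - x)"
  proof (cases "N = 0")
    case True then show ?thesis using x by simp
  next
    case False
    then show ?thesis using x by (intro powr_Suc_le_diff) auto
  qed
  then show ?case using Suc by (simp add: diff_divide_distrib)
qed (use x in simp)

lemma integral_cos_bound:
  assumes b: "b \<noteq> (0::real)" and T: "T \<ge> 0"
  shows "\<bar>integral {T..2 * T} (\<lambda>t. cos (b * t))\<bar> \<le> 2 / \<bar>b\<bar>"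
proof -
  have "((\<lambda>t. cos (b * t)) has_integral (sin (b * (2 * T)) / b - sin (b * T) / b)) {T..2 * T}"
    using T b by (intro fundamental_theorem_of_calculus)
      (auto intro!: derivative_eq_intros simp flip: has_real_derivative_iff_has_vector_derivative)
  then have "integral {T..2 * T} (\<lambda>t. cos (b * t)) = (sin (b * (2 * T)) - sin (b * T)) / b"
    by (simp add: integral_unique diff_divide_distrib)
  moreover have "\<bar>sin (b * (2 * T)) - sin (b * T)\<bar> \<le> 2"
    using abs_sin_le_one[of "b * (2 * T)"] abs_sin_le_one[of "b * T"] by linarith
  ultimately show ?thesis using b by (simp add: divide_right_mono)
qed

lemma ln_diff_ge:
  assumes "m < (n::nat)"
  shows "real (n - m) / real (Suc n) \<le> ln (real (Suc n)) - ln (real (Suc m))"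
proof -
  have "ln (real (Suc m) / real (Suc n)) \<le> real (Suc m) / real (Suc n) - 1"
    by (intro ln_le_minus_one) auto
  also have "\<dots> = - (real (n - m) / real (Suc n))" using assms by (simp add: field_simps of_nat_diff)
  finally show ?thesis by (simp add: ln_div)
qed

lemma sum_inverse_dist_le:
  assumes "m < N"
  shows "(\<Sum>n\<in>{..<N} - {m}. 1 / \<bar>real n - real m\<bar>) \<le> 2 * (\<Sum>r<N. 1 / real (Suc r))"
proof -
  have split: "{..<N} - {m} = {..<m} \<union> {m<..<N}" using assms by auto
  have "(\<Sum>n<m. 1 / \<bar>real n - real m\<bar>) = (\<Sum>r<m. 1 / real (Suc r))"
    by (rule sum.reindex_bij_witness[of _ "\<lambda>r. m - Suc r" "\<lambda>n. m - Suc n"]) (auto simp: of_nat_diff)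
  also have "\<dots> \<le> (\<Sum>r<N. 1 / real (Suc r))" using assms by (intro sum_mono2) auto
  finally have 1: "(\<Sum>n<m. 1 / \<bar>real n - real m\<bar>) \<le> (\<Sum>r<N. 1 / real (Suc r))" .
  have "(\<Sum>n\<in>{m<..<N}. 1 / \<bar>real n - real m\<bar>) = (\<Sum>r<N - Suc m. 1 / real (Suc r))"
    by (rule sum.reindex_bij_witness[of _ "\<lambda>r. m + Suc r" "\<lambda>n. n - Suc m"]) (auto simp: of_nat_diff)
  also have "\<dots> \<le> (\<Sum>r<N. 1 / real (Suc r))" by (intro sum_mono2) auto
  finally have 2: "(\<Sum>n\<in>{m<..<N}. 1 / \<bar>real n - real m\<bar>) \<le> (\<Sum>r<N. 1 / real (Suc r))" .
  have "(\<Sum>n\<in>{..<N} - {m}. 1 / \<bar>real n - real m\<bar>) = (\<Sum>n<m. 1 / \<bar>real n - real m\<bar>) + (\<Sum>n\<in>{m<..<N}. 1 / \<bar>real n - real m\<bar>)"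
    unfolding split by (intro sum.union_disjoint) auto
  then show ?thesis using 1 2 by linarith
qed

lemma of_nat_powr_Complex:
  "of_nat (Suc n) powr (- Complex \<sigma> t) = of_real (real (Suc n) powr (- \<sigma>)) * exp (- (\<i> * of_real (t * ln (real (Suc n)))))"
proof -
  have "of_nat (Suc n) powr (- Complex \<sigma> t) = exp (- Complex \<sigma> t * of_real (ln (real (Suc n))))"
    by (simp only: powr_def Ln_of_nat[OF zero_less_Suc]) (simp del: of_nat_Suc)
  also have "- Complex \<sigma> t * of_real (ln (real (Suc n))) = of_real (- \<sigma> * ln (real (Suc n))) + - (\<i> * of_real (t * ln (real (Suc n))))"
    by (simp add: complex_eq_iff)
  finally show ?thesis by (simp only: exp_add exp_of_real powr_def) (simp del: of_nat_Suc)
qed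

lemma norm_dirichlet_poly_squared:
  fixes a l :: "nat \<Rightarrow> real"
  shows "(norm (\<Sum>n<N. of_real (a n) * exp (- (\<i> * of_real (t * l n)))))\<^sup>2 = (\<Sum>m<N. \<Sum>n<N. a m * a n * cos ((l m - l n) * t))"
proof -
  let ?P = "\<Sum>n<N. complex_of_real (a n) * exp (- (\<i> * of_real (t * l n)))"
  have "(norm ?P)\<^sup>2 = Re (?P * cnj ?P)" by (simp only: complex_norm_square[symmetric] Re_complex_of_real)
  also have "?P * cnj ?P = (\<Sum>m<N. \<Sum>n<N. (of_real (a m) * exp (- (\<i> * of_real (t * l m)))) * cnj (of_real (a n) * exp (- (\<i> * of_real (t * l n)))))"
    by (simp only: cnj_sum sum_product)
  also have "Re \<dots> = (\<Sum>m<N. \<Sum>n<N. a m * a n * cos ((l m - l n) * t))"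
    unfolding Re_sum
  proof (intro sum.cong refl)
    fix m n
    have c: "exp (- (\<i> * of_real x)) = cis (- x)" for x by (simp add: cis_conv_exp)
    have "(of_real (a m) * exp (- (\<i> * of_real (t * l m)))) * cnj (of_real (a n) * exp (- (\<i> * of_real (t * l n)))) =
      of_real (a m * a n) * (cis (- (t * l m)) * cis (t * l n))"
      unfolding c by (simp add: cis_cnj)
    also have "cis (- (t * l m)) * cis (t * l n) = cis (- ((l m - l n) * t))"
      by (simp add: cis_mult algebra_simps)
    finally show "Re ((of_real (a m) * exp (- (\<i> * of_real (t * l m)))) * cnj (of_real (a n) * exp (- (\<i> * of_real (t * l n))))) = a m * a n * cos ((l m - l n) * t)"
      by (simp only: Re_complex_of_real times_complex.sel Im_complex_of_real cis.sel cos_minus)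
  qed
  finally show ?thesis .
qed

text \<open>
  The diagonal of the expanded square contributes the first term. For \<open>m < n\<close> the integral of the
  cosine with frequency \<open>2 ln ((m + 1) / (n + 1))\<close> is at most \<open>(n + 1) / (n - m)\<close>, and one factor
  \<open>(n + 1) powr (1 - \<sigma>)\<close> is estimated by its maximum.
\<close>
lemma zeta_poly_mean_square:
  assumes \<sigma>: "0 < \<sigma>" "\<sigma> < 1" and T: "T \<ge> 0"
  shows "integral {T..2 * T} (\<lambda>t. (norm (\<Sum>n<N. of_nat (Suc n) powr (- Complex \<sigma> (2 * t))))\<^sup>2)
    \<le> T * (\<Sum>n<N. real (Suc n) powr (- 2 * \<sigma>)) +
       4 * real N powr (1 - \<sigma>) * (\<Sum>n<N. real (Suc n) powr (- \<sigma>)) * (\<Sum>r<N. 1 / real (Suc r))"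
proof -
  define a where "a = (\<lambda>n. real (Suc n) powr (- \<sigma>))"
  define l where "l = (\<lambda>n. 2 * ln (real (Suc n)))"
  have a0: "a n > 0" for n by (simp add: a_def)
  have eq: "(norm (\<Sum>n<N. of_nat (Suc n) powr (- Complex \<sigma> (2 * t))))\<^sup>2 = (\<Sum>m<N. \<Sum>n<N. a m * a n * cos ((l m - l n) * t))" for t
    using norm_dirichlet_poly_squared[where a = a and l = l and t = t and N = N]
    by (simp only: of_nat_powr_Complex a_def l_def mult_ac)
  let ?c = "\<lambda>m n. integral {T..2 * T} (\<lambda>t. cos ((l m - l n) * t))"
  have ci: "(\<lambda>t. c * cos (b * t)) integrable_on {T..2 * T}" for b c :: real
    by (intro integrable_continuous_real continuous_intros)
  have "integral {T..2 * T} (\<lambda>t. (norm (\<Sum>n<N. of_nat (Suc n) powr (- Complex \<sigma> (2 * t))))\<^sup>2) = (\<Sum>m<N. \<Sum>n<N. a m * a n * ?c m n)"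
    unfolding eq by (simp add: integral_sum integrable_sum ci)
  also have "\<dots> \<le> (\<Sum>m<N. \<Sum>n<N. if n = m then T * real (Suc n) powr (- 2 * \<sigma>) else
      real N powr (1 - \<sigma>) * (a m + a n) / \<bar>real n - real m\<bar>)"
  proof (intro sum_mono)
    fix m n assume mn: "m \<in> {..<N}" "n \<in> {..<N}"
    have off: "a m * a n * ?c m n \<le> real N powr (1 - \<sigma>) * a m / \<bar>real n - real m\<bar>" if "m < n" "n < N" for m n
    proof -
      have d: "real (n - m) / real (Suc n) \<le> ln (real (Suc n)) - ln (real (Suc m))" by (rule ln_diff_ge[OF that(1)])
      have d0: "real (n - m) / real (Suc n) > 0" using that by simp
      have lb: "\<bar>l m - l n\<bar> = 2 * (ln (real (Suc n)) - ln (real (Suc m)))"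
      proof -
        have "0 < ln (real (Suc n)) - ln (real (Suc m))" using d0 d by (rule less_le_trans)
        then show ?thesis unfolding l_def by (simp add: abs_if)
      qed
      have "l m - l n \<noteq> 0" using less_le_trans[OF d0 d] by (auto simp: l_def)
      then have "?c m n \<le> 2 / \<bar>l m - l n\<bar>" by (rule abs_le_D1[OF integral_cos_bound[OF _ T]])
      also have "\<dots> \<le> 2 / (2 * (real (n - m) / real (Suc n)))" unfolding lb
      proof (rule frac_le)
        show "0 < 2 * (real (n - m) / real (Suc n))" using d0 by (rule mult_pos_pos[rotated]) simp
        show "2 * (real (n - m) / real (Suc n)) \<le> 2 * (ln (real (Suc n)) - ln (real (Suc m)))"
          using d by (rule mult_left_mono) simp
      qed simp_all
      also have "\<dots> = real (Suc n) / \<bar>real n - real m\<bar>"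
      proof -
        have "2 / (2 * (d / q)) = q / d" if "d > 0" "q > 0" for d q :: real using that by simp
        moreover have "real (n - m) = \<bar>real n - real m\<bar>" using that by (simp add: of_nat_diff)
        ultimately show ?thesis using that(1) by (metis of_nat_0_less_iff zero_less_Suc zero_less_diff)
      qed
      finally have "a m * a n * ?c m n \<le> a m * a n * (real (Suc n) / \<bar>real n - real m\<bar>)"
        using a0[of m] a0[of n] by (intro mult_left_mono) auto
      also have "\<dots> = (a n * real (Suc n)) * a m / \<bar>real n - real m\<bar>" by simp
      also have "a n * real (Suc n) = real (Suc n) powr (1 - \<sigma>)" using powr_add[of "real (Suc n)" "- \<sigma>" 1] by (simp add: a_def)
      also have "real (Suc n) powr (1 - \<sigma>) * a m / \<bar>real n - real m\<bar> \<le> real N powr (1 - \<sigma>) * a m / \<bar>real n - real m\<bar>"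
        using that \<sigma> a0[of m] by (intro divide_right_mono mult_right_mono powr_mono2) auto
      finally show ?thesis .
    qed
    have csym: "?c m n = ?c n m" for m n
    proof -
      have "cos ((l m - l n) * t) = cos ((l n - l m) * t)" for t
        using cos_minus[of "(l n - l m) * t"] by (simp add: algebra_simps)
      then show ?thesis by simp
    qed
    show "a m * a n * ?c m n \<le> (if n = m then T * real (Suc n) powr (- 2 * \<sigma>) else
      real N powr (1 - \<sigma>) * (a m + a n) / \<bar>real n - real m\<bar>)"
    proof (cases m n rule: linorder_cases)
      case equal
      have "a m * a m = real (Suc m) powr (- 2 * \<sigma>)" by (simp add: a_def flip: powr_add)
      then show ?thesis using equal T by simp
    next
      case less
      have "a m * a n * ?c m n \<le> real N powr (1 - \<sigma>) * a m / \<bar>real n - real m\<bar>" using mn less by (intro off) auto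
      also have "\<dots> \<le> real N powr (1 - \<sigma>) * (a m + a n) / \<bar>real n - real m\<bar>" using a0[of n] by (intro divide_right_mono mult_left_mono) auto
      finally show ?thesis using less by simp
    next
      case greater
      have "a n * a m * ?c n m \<le> real N powr (1 - \<sigma>) * a n / \<bar>real m - real n\<bar>" using mn greater by (intro off) auto
      also have "\<dots> \<le> real N powr (1 - \<sigma>) * (a m + a n) / \<bar>real m - real n\<bar>" using a0[of m] by (intro divide_right_mono mult_left_mono) auto
      finally show ?thesis using greater by (simp add: csym[of n m] mult.commute[of "a n"] abs_minus_commute)
    qed
  qed
  also have "\<dots> = T * (\<Sum>n<N. real (Suc n) powr (- 2 * \<sigma>)) + (\<Sum>m<N. \<Sum>n\<in>{..<N} - {m}. real N powr (1 - \<sigma>) * (a m + a n) / \<bar>real n - real m\<bar>)"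
  proof -
    have "(\<Sum>n<N. if n = m then T * real (Suc n) powr (- 2 * \<sigma>) else real N powr (1 - \<sigma>) * (a m + a n) / \<bar>real n - real m\<bar>)
      = T * real (Suc m) powr (- 2 * \<sigma>) + (\<Sum>n\<in>{..<N} - {m}. real N powr (1 - \<sigma>) * (a m + a n) / \<bar>real n - real m\<bar>)" if "m \<in> {..<N}" for m
      by (subst sum.remove[OF finite_lessThan that]) (auto intro!: sum.cong)
    then show ?thesis by (simp add: sum.distrib sum_distrib_left)
  qed
  also have "(\<Sum>m<N. \<Sum>n\<in>{..<N} - {m}. real N powr (1 - \<sigma>) * (a m + a n) / \<bar>real n - real m\<bar>)
     = 2 * (\<Sum>m<N. \<Sum>n\<in>{..<N} - {m}. real N powr (1 - \<sigma>) * a m / \<bar>real n - real m\<bar>)"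
  proof -
    have "(\<Sum>m<N. \<Sum>n\<in>{..<N} - {m}. real N powr (1 - \<sigma>) * a n / \<bar>real n - real m\<bar>) = (\<Sum>n<N. \<Sum>m\<in>{..<N} - {n}. real N powr (1 - \<sigma>) * a n / \<bar>real n - real m\<bar>)"
      unfolding sum.Sigma[OF finite_lessThan ballI[OF finite_Diff[OF finite_lessThan]]]
      by (rule sum.reindex_bij_witness[of _ "\<lambda>(m, n). (n, m)" "\<lambda>(m, n). (n, m)"]) auto
    also have "\<dots> = (\<Sum>m<N. \<Sum>n\<in>{..<N} - {m}. real N powr (1 - \<sigma>) * a m / \<bar>real n - real m\<bar>)"
      by (simp add: abs_minus_commute)
    finally show ?thesis by (simp add: distrib_left add_divide_distrib sum.distrib)
  qed
  also have "(\<Sum>m<N. \<Sum>n\<in>{..<N} - {m}. real N powr (1 - \<sigma>) * a m / \<bar>real n - real m\<bar>) \<le> (\<Sum>m<N. real N powr (1 - \<sigma>) * a m * (2 * (\<Sum>r<N. 1 / real (Suc r))))"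
  proof (intro sum_mono)
    fix m assume "m \<in> {..<N}"
    then have "real N powr (1 - \<sigma>) * a m * (\<Sum>n\<in>{..<N} - {m}. 1 / \<bar>real n - real m\<bar>) \<le> real N powr (1 - \<sigma>) * a m * (2 * (\<Sum>r<N. 1 / real (Suc r)))"
      using a0[of m] by (intro mult_left_mono sum_inverse_dist_le) auto
    then show "(\<Sum>n\<in>{..<N} - {m}. real N powr (1 - \<sigma>) * a m / \<bar>real n - real m\<bar>) \<le> real N powr (1 - \<sigma>) * a m * (2 * (\<Sum>r<N. 1 / real (Suc r)))"
      by (simp add: sum_distrib_left)
  qed
  also have "2 * (\<Sum>m<N. real N powr (1 - \<sigma>) * a m * (2 * (\<Sum>r<N. 1 / real (Suc r)))) = 4 * real N powr (1 - \<sigma>) * (\<Sum>n<N. real (Suc n) powr (- \<sigma>)) * (\<Sum>r<N. 1 / real (Suc r))"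
    by (simp add: a_def sum_distrib_left sum_distrib_right mult_ac)
  finally show ?thesis by simp
qed

text \<open>
  On \<open>[T, 2T]\<close> with \<open>T = M\<^sup>2\<close>, \<open>\<zeta>\<close> is approximated by a Dirichlet polynomial of length
  \<open>N = M ^ 3\<close>, that is \<open>T powr (3 / 2)\<close>. For \<open>\<sigma> > 2 / 3\<close> this is long enough for the error
  \<open>T N powr (-\<sigma>)\<close> to be bounded, and short enough for the off-diagonal terms,
  \<open>N powr (2 - 2\<sigma>) ln N\<close>, to be \<open>O(T)\<close>. The stronger hypothesis leaves room for bounding the
  logarithm by \<open>48 * N powr (1 / 48)\<close>. Restricting \<open>T\<close> to squares makes both lengths integral powers of \<open>M\<close>.
\<close>
theorem zeta_mean_square:
  assumes \<sigma>: "11 / 16 < \<sigma>" "\<sigma> < 1"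
  obtains K where "\<And>M::nat. M \<ge> 1 \<Longrightarrow> integral {real M ^ 2..2 * real M ^ 2} (\<lambda>t. (norm (zeta (Complex \<sigma> (2 * t))))\<^sup>2) \<le> K * real M ^ 2"
proof -
  define S where "S = (\<Sum>n. real (Suc n) powr (- 2 * \<sigma>))"
  define E where "E = 5 * (2 powr (\<sigma> + 1) / \<sigma>) + 1"
  define K where "K = 2 * (S + 4 * (1 / (1 - \<sigma>)) * 48) + 2 * E\<^sup>2"
  show thesis
  proof (rule that[of K])
    fix M :: nat assume M: "M \<ge> 1"
    define N where "N = M ^ 3"
    define T where "T = real M ^ 2"
    have N1: "N \<ge> 1" using M by (simp add: N_def)
    have T1: "T \<ge> 1" using M by (simp add: T_def)
    have M1: "real M \<ge> 1" using M by simp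
    have Np: "real N powr x = real M powr (3 * x)" for x
    proof -
      have "real N = real M powr 3" using M by (simp add: N_def powr_numeral)
      then show ?thesis by (simp only: powr_powr)
    qed
    have Tp: "T = real M powr 2" using M by (simp add: T_def powr_numeral)
    define P where "P = (\<lambda>t. \<Sum>n<N. of_nat (Suc n) powr (- Complex \<sigma> (2 * t)))"
    have zP: "norm (zeta (Complex \<sigma> (2 * t)) - P t) \<le> E * real M powr (2 - 3 * \<sigma>)" if t: "t \<in> {T..2 * T}" for t
    proof -
      let ?z = "Complex \<sigma> (2 * t)"
      have z1: "?z \<noteq> 1" using t T1 by (auto simp: complex_eq_iff)
      have nz: "norm ?z \<le> 5 * T" using cmod_le[of ?z] t T1 \<sigma> by simp
      have "norm (zeta ?z - zeta_partial N ?z) \<le> norm ?z * (2 powr (Re ?z + 1) / Re ?z) * real N powr (- Re ?z)"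
        using \<sigma> z1 N1 by (intro zeta_partial_error) auto
      also have "\<dots> \<le> (5 * T) * (2 powr (\<sigma> + 1) / \<sigma>) * real M powr (- 3 * \<sigma>)"
        using nz \<sigma> T1 unfolding Np by (intro mult_mono) auto
      also have "\<dots> = 5 * (2 powr (\<sigma> + 1) / \<sigma>) * (real M powr 2 * real M powr (- 3 * \<sigma>))" by (simp add: Tp)
      also have "real M powr 2 * real M powr (- 3 * \<sigma>) = real M powr (2 - 3 * \<sigma>)" by (simp only: powr_add[symmetric]) simp
      finally have 1: "norm (zeta ?z - zeta_partial N ?z) \<le> 5 * (2 powr (\<sigma> + 1) / \<sigma>) * real M powr (2 - 3 * \<sigma>)" .
      have "norm (of_nat N powr (1 - ?z) / (1 - ?z)) \<le> real M powr (3 - 3 * \<sigma>) / T"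
      proof -
        have "norm (of_nat N powr (1 - ?z)) = real N powr (1 - \<sigma>)" by (simp add: norm_powr_real_powr)
        moreover have "T \<le> norm (1 - ?z)" using abs_Im_le_cmod[of "1 - ?z"] t T1 by simp
        ultimately show ?thesis unfolding norm_divide using T1 by (simp add: Np frac_le algebra_simps)
      qed
      also have "\<dots> = real M powr (1 - 3 * \<sigma>)" using powr_diff[of "real M" "3 - 3 * \<sigma>" 2] by (simp add: Tp)
      also have "\<dots> \<le> 1 * real M powr (2 - 3 * \<sigma>)" using M1 by (simp add: powr_mono)
      finally have 2: "norm (of_nat N powr (1 - ?z) / (1 - ?z)) \<le> 1 * real M powr (2 - 3 * \<sigma>)" .
      have "zeta ?z - P t = (zeta ?z - zeta_partial N ?z) - of_nat N powr (1 - ?z) / (1 - ?z)" by (simp add: zeta_partial_def P_def)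
      also have "norm \<dots> \<le> norm (zeta ?z - zeta_partial N ?z) + norm (of_nat N powr (1 - ?z) / (1 - ?z))" by (rule norm_triangle_ineq4)
      finally show ?thesis using 1 2 by (simp add: E_def distrib_right)
    qed
    have E0: "E \<ge> 0" using \<sigma> by (simp add: E_def)
    have Pc: "continuous_on {T..2 * T} P" unfolding P_def
      by (intro continuous_intros continuous_on_powr_complex) (auto simp: Complex_eq intro!: continuous_intros simp del: of_nat_Suc)
    have zc: "continuous_on {T..2 * T} (\<lambda>t. zeta (Complex \<sigma> (2 * t)))"
    proof (rule continuous_on_compose2[of "- {1}" zeta _ "\<lambda>t. Complex \<sigma> (2 * t)"])
      show "continuous_on (- {1}) zeta" using is_zeta_zeta by (auto simp: is_zeta_def intro: holomorphic_on_imp_continuous_on)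
      show "continuous_on {T..2 * T} (\<lambda>t. Complex \<sigma> (2 * t))" by (auto simp: Complex_eq intro!: continuous_intros)
    qed (use T1 in \<open>auto simp: complex_eq_iff\<close>)
    have "integral {T..2 * T} (\<lambda>t. (norm (zeta (Complex \<sigma> (2 * t))))\<^sup>2) \<le> integral {T..2 * T} (\<lambda>t. 2 * (norm (P t))\<^sup>2 + 2 * (E * real M powr (2 - 3 * \<sigma>))\<^sup>2)"
    proof (rule integral_le)
      show "(\<lambda>t. (norm (zeta (Complex \<sigma> (2 * t))))\<^sup>2) integrable_on {T..2 * T}"
        "(\<lambda>t. 2 * (norm (P t))\<^sup>2 + 2 * (E * real M powr (2 - 3 * \<sigma>))\<^sup>2) integrable_on {T..2 * T}"
        by (intro integrable_continuous_real continuous_intros Pc zc)+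
      fix t assume t: "t \<in> {T..2 * T}"
      have "norm (zeta (Complex \<sigma> (2 * t))) \<le> norm (P t) + E * real M powr (2 - 3 * \<sigma>)"
        using norm_triangle_ineq2[of "zeta (Complex \<sigma> (2 * t))" "P t"] zP[OF t] by linarith
      then have "(norm (zeta (Complex \<sigma> (2 * t))))\<^sup>2 \<le> (norm (P t) + E * real M powr (2 - 3 * \<sigma>))\<^sup>2" by (intro power_mono) auto
      also have "\<dots> \<le> 2 * (norm (P t))\<^sup>2 + 2 * (E * real M powr (2 - 3 * \<sigma>))\<^sup>2"
        using sum_squares_bound[of "norm (P t)" "E * real M powr (2 - 3 * \<sigma>)"] by (simp add: power2_sum)
      finally show "(norm (zeta (Complex \<sigma> (2 * t))))\<^sup>2 \<le> 2 * (norm (P t))\<^sup>2 + 2 * (E * real M powr (2 - 3 * \<sigma>))\<^sup>2" .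
    qed
    also have "\<dots> = 2 * integral {T..2 * T} (\<lambda>t. (norm (P t))\<^sup>2) + T * (2 * (E * real M powr (2 - 3 * \<sigma>))\<^sup>2)"
      using T1 by (subst integral_add) (auto intro!: integrable_continuous_real continuous_intros Pc)
    also have "T * (2 * (E * real M powr (2 - 3 * \<sigma>))\<^sup>2) \<le> T * (2 * E\<^sup>2)"
    proof -
      have "real M powr (2 - 3 * \<sigma>) \<le> 1" using M1 \<sigma> powr_mono[of "2 - 3 * \<sigma>" 0 "real M"] by simp
      then have "(E * real M powr (2 - 3 * \<sigma>))\<^sup>2 \<le> (E * 1)\<^sup>2" using E0 by (intro power_mono mult_left_mono) auto
      then show ?thesis using T1 by simp
    qed
    also have "integral {T..2 * T} (\<lambda>t. (norm (P t))\<^sup>2) \<le> T * S + 4 * (1 / (1 - \<sigma>)) * 48 * T"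
    proof -
      have "integral {T..2 * T} (\<lambda>t. (norm (P t))\<^sup>2) \<le> T * (\<Sum>n<N. real (Suc n) powr (- 2 * \<sigma>)) +
         4 * real N powr (1 - \<sigma>) * (\<Sum>n<N. real (Suc n) powr (- \<sigma>)) * (\<Sum>r<N. 1 / real (Suc r))"
        unfolding P_def using \<sigma> T1 by (intro zeta_poly_mean_square) auto
      also have "(\<Sum>n<N. real (Suc n) powr (- 2 * \<sigma>)) \<le> S"
        unfolding S_def using \<sigma> by (intro sum_le_suminf summable_Suc_powr) auto
      also have "4 * real N powr (1 - \<sigma>) * (\<Sum>n<N. real (Suc n) powr (- \<sigma>)) * (\<Sum>r<N. 1 / real (Suc r))
         \<le> 4 * real N powr (1 - \<sigma>) * (real N powr (1 - \<sigma>) / (1 - \<sigma>)) * (48 * real N powr (1 / 48))"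
      proof (intro mult_mono)
        show "(\<Sum>n<N. real (Suc n) powr (- \<sigma>)) \<le> real N powr (1 - \<sigma>) / (1 - \<sigma>)" using \<sigma> by (intro sum_powr_le) auto
        have "(\<Sum>r<N. 1 / real (Suc r)) \<le> (\<Sum>r<N. real (Suc r) powr (- (47 / 48)))"
        proof (intro sum_mono)
          fix r
          have "real (Suc r) powr (- 1) \<le> real (Suc r) powr (- (47 / 48))" by (intro powr_mono) auto
          then show "1 / real (Suc r) \<le> real (Suc r) powr (- (47 / 48))" by (simp add: powr_minus_divide del: of_nat_Suc)
        qed
        also have "\<dots> \<le> real N powr (1 - 47 / 48) / (1 - 47 / 48)" by (intro sum_powr_le) auto
        finally show "(\<Sum>r<N. 1 / real (Suc r)) \<le> 48 * real N powr (1 / 48)" by simp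
      qed (use \<sigma> in \<open>auto intro!: sum_nonneg mult_nonneg_nonneg\<close>)
      also have "4 * real N powr (1 - \<sigma>) * (real N powr (1 - \<sigma>) / (1 - \<sigma>)) * (48 * real N powr (1 / 48))
         = 4 * (1 / (1 - \<sigma>)) * 48 * (real N powr (1 - \<sigma>) * real N powr (1 - \<sigma>) * real N powr (1 / 48))"
        by simp
      also have "real N powr (1 - \<sigma>) * real N powr (1 - \<sigma>) * real N powr (1 / 48) = real M powr (3 * (2 - 2 * \<sigma> + 1 / 48))"
        unfolding Np[symmetric] by (simp only: powr_add[symmetric]) (simp add: algebra_simps)
      also have "\<dots> \<le> T" unfolding Tp using M1 \<sigma> by (intro powr_mono) auto
      finally show ?thesis using \<sigma> T1 by (simp add: mult_left_mono divide_right_mono)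
    qed
    finally show "integral {real M ^ 2..2 * real M ^ 2} (\<lambda>t. (norm (zeta (Complex \<sigma> (2 * t))))\<^sup>2) \<le> K * real M ^ 2"
      unfolding T_def[symmetric] by (simp add: K_def algebra_simps)
  qed
qed

section \<open>The first moment of the product of four zeta factors\<close>

text \<open>
  The numerator of Ramanujan's product. Its poles are \<open>1\<close> and \<open>1 \<plusminus> \<i>\<theta>\<close>, whereas
  the quotient also has singularities at zeros of \<open>\<zeta>(2s)\<close>.
\<close>
definition zeta_quad :: "real \<Rightarrow> complex \<Rightarrow> complex" where
  "zeta_quad \<theta> s = zeta s ^ 2 * zeta (s + \<i> * of_real \<theta>) * zeta (s - \<i> * of_real \<theta>)"

lemma zeta_holomorphic: "1 \<notin> A \<Longrightarrow> zeta holomorphic_on A"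
  using is_zeta_zeta unfolding is_zeta_def by (auto elim!: holomorphic_on_subset)

lemma norm_mult_minus_one:
  fixes x y :: complex
  assumes "norm (x - 1) \<le> p" "norm (y - 1) \<le> q"
  shows "norm (x * y - 1) \<le> p + q + p * q"
proof -
  have "x * y - 1 = (x - 1) * (y - 1) + (x - 1) + (y - 1)" by (simp add: algebra_simps)
  also have "norm \<dots> \<le> norm (x - 1) * norm (y - 1) + norm (x - 1) + norm (y - 1)"
    by (intro norm_triangle_le add_mono) (auto simp: norm_mult)
  also have "\<dots> \<le> p * q + p + q" using assms by (intro add_mono mult_mono) (auto intro: order_trans[OF norm_ge_zero])
  finally show ?thesis by simp
qed

text \<open>
  For \<open>Re s = 5\<close> each of the four factors is within \<open>1 / 10\<close> of \<open>1\<close>.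
\<close>
lemma Re_zeta_quad_ge:
  assumes "Re s = 5"
  shows "Re (zeta_quad \<theta> s) \<ge> 1 / 2"
proof -
  have b: "norm (zeta z - 1) \<le> 1 / 10" if "Re z = 5" for z
  proof -
    have "norm (zeta z - 1) \<le> (pi\<^sup>2 / 6 - 1) * (1 / 2) powr (5 - 2)"
      using zeta_near_one[of z] that by simp
    also have "(1 / 2) powr (5 - 2) = (1 / 8 :: real)" by (simp add: powr_numeral power3_eq_cube)
    also have "pi\<^sup>2 \<le> 3.2 ^ 2" using pi_approx by (intro power_mono) auto
    finally show ?thesis by (simp add: power2_eq_square)
  qed
  have "norm (zeta s * zeta s - 1) \<le> 1 / 10 + 1 / 10 + 1 / 10 * (1 / 10)"
    "norm (zeta (s + \<i> * of_real \<theta>) * zeta (s - \<i> * of_real \<theta>) - 1) \<le> 1 / 10 + 1 / 10 + 1 / 10 * (1 / 10)"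
    using assms by (intro norm_mult_minus_one b; simp)+
  from norm_mult_minus_one[OF this] have "norm (zeta_quad \<theta> s - 1) \<le> 1 / 2"
    by (simp add: zeta_quad_def power2_eq_square mult.assoc)
  then show ?thesis using abs_Re_le_cmod[of "zeta_quad \<theta> s - 1"] by simp
qed

lemma zeta_quad_holomorphic:
  "zeta_quad \<theta> holomorphic_on {z. Im z < - (\<bar>\<theta>\<bar> + 1)}"
proof -
  have "(\<lambda>z. zeta (z + of_real x * \<i>)) holomorphic_on {z. Im z < - (\<bar>\<theta>\<bar> + 1)}" if "\<bar>x\<bar> \<le> \<bar>\<theta>\<bar>" for x
  proof (rule holomorphic_on_compose_gen[where g = zeta and t = "- {1}", unfolded o_def])
    have "z + of_real x * \<i> \<noteq> 1" if "Im z < - (\<bar>\<theta>\<bar> + 1)" for z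
      using that \<open>\<bar>x\<bar> \<le> \<bar>\<theta>\<bar>\<close> by (auto simp: complex_eq_iff)
    then show "(\<lambda>z. z + of_real x * \<i>) ` {z. Im z < - (\<bar>\<theta>\<bar> + 1)} \<subseteq> - {1}" by auto
  qed (auto intro!: holomorphic_intros zeta_holomorphic)
  from this[of 0] this[of \<theta>] this[of "- \<theta>"] show ?thesis
    unfolding zeta_quad_def by (auto intro!: holomorphic_intros simp: mult.commute)
qed

text \<open>
  The line of integration is moved to \<open>Re s = 5\<close>, where the product has real part at least \<open>1 / 2\<close>, so
  that its weighted integral is of order \<open>T\<close>. The two vertical integrals differ by the
  integrals over the horizontal sides at heights \<open>-T\<close> and \<open>-2T\<close>. The weight \<open>w\<close> makes these bounded: it is
  a polynomial with zeros of order four at \<open>5 - \<i>T\<close> and \<open>5 - 2\<i>T\<close>, hence of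
  order \<open>T powr (-4)\<close> on the horizontal sides, against a product of order at most \<open>T ^ 4\<close>. On the
  rectangle \<open>w\<close> is bounded by \<open>256\<close>, and on \<open>Re s = 5\<close> it is nonnegative.
\<close>
theorem zeta_quad_first_moment_lower:
  assumes a: "0 < a" "a \<le> 5"
  obtains c T0 where "c > 0" "\<And>T. T \<ge> T0 \<Longrightarrow> c * T \<le> integral {T..2 * T} (\<lambda>t. norm (zeta_quad \<theta> (Complex a (- t))))"
proof -
  obtain K where K: "K > 0" "\<And>s. a \<le> Re s \<Longrightarrow> Re s \<le> 5 \<Longrightarrow> \<bar>Im s\<bar> \<ge> 1 \<Longrightarrow> norm (zeta s) \<le> K * \<bar>Im s\<bar>"
    using zeta_growth[OF a(1)] by blast
  define \<kappa> where "\<kappa> = (3 / 16 :: real) ^ 4 / 8"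
  define C where "C = 10 * (30 * K) ^ 4"
  define T0 where "T0 = max (C / \<kappa>) (\<bar>\<theta>\<bar> + 10)"
  have \<kappa>: "\<kappa> > 0" by (simp add: \<kappa>_def)
  show thesis
  proof (rule that[of "\<kappa> / 256" T0])
    show "\<kappa> / 256 > 0" using \<kappa> by simp
    fix T assume T: "T \<ge> T0"
    have T10: "T \<ge> 10" "T \<ge> \<bar>\<theta>\<bar> + 10" "T > 0" using T by (auto simp: T0_def)
    have TC: "C \<le> \<kappa> * T" using T \<kappa> by (auto simp: T0_def field_simps)
    define \<Omega> where "\<Omega> = {z. Im z < - (\<bar>\<theta>\<bar> + 1)}"
    have \<Omega>: "open \<Omega>" "convex \<Omega>" unfolding \<Omega>_def by (auto simp: open_halfspace_Im_lt convex_halfspace_Im_lt)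
    define w where "w = (\<lambda>z. ((z - 5 + \<i> * of_real T) * (z - 5 + \<i> * of_real (2 * T)) / of_real (T\<^sup>2)) ^ 4)"
    define h where "h = (\<lambda>z. zeta_quad \<theta> z * w z)"
    have w_hol: "w holomorphic_on A" for A unfolding w_def by (intro holomorphic_intros) (use T10 in auto)
    have h_hol: "h holomorphic_on \<Omega>"
      unfolding h_def \<Omega>_def by (intro holomorphic_intros zeta_quad_holomorphic w_hol)
    \<comment> \<open>Integrals over the sides of the rectangle are differences of a primitive, so Cauchy's theorem
      takes the form of an identity between four values of \<open>\<Phi>\<close>.\<close>
    obtain \<Phi> where \<Phi>: "\<And>z. z \<in> \<Omega> \<Longrightarrow> (\<Phi> has_field_derivative h z) (at z within \<Omega>)"
      using holomorphic_convex_primitive'[OF \<Omega>(2,1) h_hol] by blast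
    have \<Phi>': "(\<Phi> has_field_derivative h z) (at z)" if "z \<in> \<Omega>" for z
      using \<Phi>[OF that] at_within_open[OF that \<Omega>(1)] by simp
    have in\<Omega>: "Complex x (- t) \<in> \<Omega>" if "t \<ge> T" for x t
      using that T10 by (simp add: \<Omega>_def)
    have vert: "((\<lambda>t. h (Complex x (- t))) has_integral \<i> * (\<Phi> (Complex x (- (2 * T))) - \<Phi> (Complex x (- T)))) {T..2 * T}" for x
    proof -
      have "((\<lambda>t. h (Complex x (- t))) has_integral (\<i> * \<Phi> (Complex x (- (2 * T))) - \<i> * \<Phi> (Complex x (- T)))) {T..2 * T}"
      proof (rule fundamental_theorem_of_calculus)
        fix t assume t: "t \<in> {T..2 * T}"
        have c: "Complex x (- t) = of_real x + (- \<i>) * of_real t" for t by (simp add: complex_eq_iff)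
        have "((\<lambda>t. of_real x + (- \<i>) * complex_of_real t) has_vector_derivative (0 + (- \<i>) * of_real 1)) (at t within {T..2 * T})"
          by (intro has_vector_derivative_add has_vector_derivative_mult_right has_vector_derivative_of_real) (auto intro!: derivative_eq_intros)
        then have p: "((\<lambda>t. Complex x (- t)) has_vector_derivative (- \<i>)) (at t within {T..2 * T})"
          by (simp only: c) simp
        have "(\<Phi> \<circ> (\<lambda>t. Complex x (- t)) has_vector_derivative ((- \<i>) * h (Complex x (- t)))) (at t within {T..2 * T})"
          by (rule field_vector_diff_chain_within[OF p]) (use \<Phi>'[OF in\<Omega>[of t x]] t in \<open>auto intro: has_field_derivative_at_within\<close>)
        then have "((\<lambda>t. \<i> * \<Phi> (Complex x (- t))) has_vector_derivative (\<i> * ((- \<i>) * h (Complex x (- t))))) (at t within {T..2 * T})"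
          unfolding o_def by (rule has_vector_derivative_mult_right)
        then show "((\<lambda>t. \<i> * \<Phi> (Complex x (- t))) has_vector_derivative h (Complex x (- t))) (at t within {T..2 * T})"
          by (simp add: mult.assoc[symmetric])
      qed (use T10 in auto)
      then show ?thesis by (simp add: right_diff_distrib)
    qed
    have quad_bd: "norm (zeta_quad \<theta> z) \<le> (K * (3 * T)) ^ 4" if z: "a \<le> Re z" "Re z \<le> 5" "T \<le> - Im z" "- Im z \<le> 2 * T" for z
    proof -
      have b: "norm (zeta (z + \<i> * of_real x)) \<le> K * (3 * T)" if "\<bar>x\<bar> \<le> \<bar>\<theta>\<bar>" for x
      proof -
        have "norm (zeta (z + \<i> * of_real x)) \<le> K * \<bar>Im (z + \<i> * of_real x)\<bar>"
          using z that T10 by (intro K) (auto simp: abs_if split: if_splits)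
        also have "\<dots> \<le> K * (3 * T)"
          using z that T10 K(1) by (intro mult_left_mono) (auto simp: abs_if split: if_splits)
        finally show ?thesis .
      qed
      have "norm (zeta_quad \<theta> z) = norm (zeta z) * norm (zeta z) * norm (zeta (z + \<i> * of_real \<theta>)) * norm (zeta (z - \<i> * of_real \<theta>))"
        by (simp add: zeta_quad_def norm_mult power2_eq_square)
      also have "\<dots> \<le> (K * (3 * T)) * (K * (3 * T)) * (K * (3 * T)) * (K * (3 * T))"
        using b[of 0] b[of \<theta>] b[of "- \<theta>"] K(1) T10 by (intro mult_mono) auto
      also have "\<dots> = (K * (3 * T)) ^ 4" by (simp only: power4_eq_xxxx)
      finally show ?thesis .
    qed
    have h_bd: "norm (h z) \<le> (30 * K) ^ 4"
      if z: "a \<le> Re z" "Re z \<le> 5" "Im z = - T \<or> Im z = - (2 * T)" for z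
    proof -
      have n1: "norm (Complex x 0) \<le> 5" if "\<bar>x\<bar> \<le> 5" for x using that by (simp add: complex_norm)
      have n2: "norm (Complex x y) \<le> 2 * T" if "\<bar>x\<bar> \<le> 5" "\<bar>y\<bar> = T" for x y
        using cmod_le[of "Complex x y"] that T10 by simp
      have "norm ((z - 5 + \<i> * of_real T) * (z - 5 + \<i> * of_real (2 * T))) \<le> 5 * (2 * T)"
        using z(3)
      proof
        assume i: "Im z = - T"
        have "z - 5 + \<i> * of_real T = Complex (Re z - 5) 0" "z - 5 + \<i> * of_real (2 * T) = Complex (Re z - 5) T"
          using i by (auto simp: complex_eq_iff)
        then show ?thesis unfolding norm_mult using z a T10 n1[of "Re z - 5"] n2[of "Re z - 5" T] by (intro mult_mono) auto
      next
        assume i: "Im z = - (2 * T)"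
        have "z - 5 + \<i> * of_real T = Complex (Re z - 5) (- T)" "z - 5 + \<i> * of_real (2 * T) = Complex (Re z - 5) 0"
          using i by (auto simp: complex_eq_iff)
        then have "norm ((z - 5 + \<i> * of_real T) * (z - 5 + \<i> * of_real (2 * T))) \<le> (2 * T) * 5"
          unfolding norm_mult using z a T10 n1[of "Re z - 5"] n2[of "Re z - 5" "- T"] by (intro mult_mono) auto
        then show ?thesis by simp
      qed
      then have "norm ((z - 5 + \<i> * of_real T) * (z - 5 + \<i> * of_real (2 * T)) / of_real (T\<^sup>2)) \<le> 5 * (2 * T) / T\<^sup>2"
        unfolding norm_divide norm_of_real abs_power2 by (rule divide_right_mono) simp
      also have "5 * (2 * T) / T\<^sup>2 = 10 / T" using T10 by (simp add: power2_eq_square)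
      finally have "norm (w z) \<le> (10 / T) ^ 4" unfolding w_def norm_power by (intro power_mono) auto
      moreover have "norm (zeta_quad \<theta> z) \<le> (K * (3 * T)) ^ 4" using z T10 by (intro quad_bd) auto
      ultimately have "norm (h z) \<le> (K * (3 * T)) ^ 4 * (10 / T) ^ 4"
        unfolding h_def norm_mult by (intro mult_mono) auto
      also have "\<dots> = (30 * K) ^ 4" using T10 by (simp flip: power_mult_distrib)
      finally show ?thesis .
    qed
    have horiz: "norm (\<Phi> (Complex 5 (- y)) - \<Phi> (Complex a (- y))) \<le> (30 * K) ^ 4 * 5" if y: "y = T \<or> y = 2 * T" for y
    proof -
      let ?S = "closed_segment (Complex a (- y)) (Complex 5 (- y))"
      have S: "Re z \<in> {a..5} \<and> Im z = - y" if "z \<in> ?S" for z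
        using that a by (auto simp: closed_segment_same_Im closed_segment_eq_real_ivl)
      have "norm (\<Phi> (Complex 5 (- y)) - \<Phi> (Complex a (- y))) \<le> (30 * K) ^ 4 * norm (Complex 5 (- y) - Complex a (- y))"
      proof (rule field_differentiable_bound[where S = ?S and f' = h])
        fix z assume z: "z \<in> ?S"
        have "z \<in> \<Omega>" using S[OF z] y T10 by (auto simp: \<Omega>_def)
        then show "(\<Phi> has_field_derivative h z) (at z within ?S)" using \<Phi>' has_field_derivative_at_within by blast
        show "norm (h z) \<le> (30 * K) ^ 4" using S[OF z] y by (intro h_bd) auto
      qed auto
      also have "norm (Complex 5 (- y) - Complex a (- y)) \<le> 5" using a by (simp add: complex_norm cmod_def)
      finally show ?thesis by (simp add: mult_left_mono)
    qed
    define J where "J = (\<lambda>x. integral {T..2 * T} (\<lambda>t. h (Complex x (- t))))"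
    have J: "J x = \<i> * (\<Phi> (Complex x (- (2 * T))) - \<Phi> (Complex x (- T)))" for x
      unfolding J_def using vert by (rule integral_unique)
    have "norm (J 5 - J a) = norm ((\<Phi> (Complex 5 (- (2 * T))) - \<Phi> (Complex a (- (2 * T)))) - (\<Phi> (Complex 5 (- T)) - \<Phi> (Complex a (- T))))"
      unfolding J right_diff_distrib[symmetric] norm_mult by (simp add: algebra_simps)
    also have "\<dots> \<le> (30 * K) ^ 4 * 5 + (30 * K) ^ 4 * 5"
      by (intro order_trans[OF norm_triangle_ineq4] add_mono horiz) auto
    finally have Jdiff: "norm (J 5 - J a) \<le> C" by (simp add: C_def)
    have Jlow: "Re (J 5) \<ge> 2 * \<kappa> * T"
    proof -
      have hi: "(\<lambda>t. h (Complex 5 (- t))) integrable_on {T..2 * T}" using vert by (auto simp: integrable_on_def)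
      have w5: "w (Complex 5 (- t)) = of_real (((t - T) * (2 * T - t) / T\<^sup>2) ^ 4)" for t
      proof -
        have "(Complex 5 (- t) - 5 + \<i> * of_real T) * (Complex 5 (- t) - 5 + \<i> * of_real (2 * T)) = of_real ((t - T) * (2 * T - t))"
          by (simp add: complex_eq_iff algebra_simps)
        then show ?thesis by (simp add: w_def)
      qed
      have Reh: "Re (h (Complex 5 (- t))) = Re (zeta_quad \<theta> (Complex 5 (- t))) * ((t - T) * (2 * T - t) / T\<^sup>2) ^ 4" for t
        unfolding h_def w5 by (simp del: of_real_power of_real_divide of_real_mult)
      have Reh0: "Re (h (Complex 5 (- t))) \<ge> 1 / 2 * ((t - T) * (2 * T - t) / T\<^sup>2) ^ 4" for t
        unfolding Reh by (intro mult_right_mono Re_zeta_quad_ge zero_le_even_power) auto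
      have Rehi: "(\<lambda>t. Re (h (Complex 5 (- t)))) integrable_on {T..2 * T}"
        using integrable_linear[OF hi bounded_linear_Re] by (simp add: o_def)
      have sub: "(\<lambda>t. Re (h (Complex 5 (- t)))) integrable_on {5/4 * T..7/4 * T}"
        by (rule integrable_subinterval_real[OF Rehi]) (use T10 in auto)
      have "2 * \<kappa> * T = integral {5/4 * T..7/4 * T} (\<lambda>t. 1 / 2 * (3 / 16) ^ 4)"
        using T10 by (simp add: \<kappa>_def)
      also have "\<dots> \<le> integral {5/4 * T..7/4 * T} (\<lambda>t. Re (h (Complex 5 (- t))))"
      proof (rule integral_le[OF integrable_const_ivl sub])
        fix t assume t: "t \<in> {5/4 * T..7/4 * T}"
        have "(3 / 16) * T\<^sup>2 \<le> (t - T) * (2 * T - t)"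
        proof -
          have "(t - 5/4 * T) * (7/4 * T - t) \<ge> 0" using t by (intro mult_nonneg_nonneg) auto
          then show ?thesis by (simp add: algebra_simps power2_eq_square)
        qed
        then have "3 / 16 \<le> (t - T) * (2 * T - t) / T\<^sup>2" using T10 by (simp add: le_divide_eq)
        then have "(3 / 16) ^ 4 \<le> ((t - T) * (2 * T - t) / T\<^sup>2) ^ 4" by (intro power_mono) auto
        then show "1 / 2 * (3 / 16) ^ 4 \<le> Re (h (Complex 5 (- t)))" using Reh0[of t] by linarith
      qed
      also have "\<dots> \<le> integral {T..2 * T} (\<lambda>t. Re (h (Complex 5 (- t))))"
      proof (rule integral_subset_le[OF _ sub Rehi])
        have "0 \<le> Re (h (Complex 5 (- t)))" for t using order_trans[OF _ Reh0[of t]] by (simp add: zero_le_even_power)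
        then show "\<forall>t\<in>{T..2 * T}. 0 \<le> Re (h (Complex 5 (- t)))" by blast
      qed (use T10 in auto)
      also have "\<dots> = Re (J 5)" unfolding J_def using integral_linear[OF hi bounded_linear_Re] by (simp add: o_def)
      finally show ?thesis .
    qed
    have "\<kappa> * T \<le> norm (J a)"
      using Jlow Jdiff TC abs_Re_le_cmod[of "J 5 - J a"] abs_Re_le_cmod[of "J a"] by (simp add: abs_if split: if_splits)
    also have "\<dots> \<le> integral {T..2 * T} (\<lambda>t. 256 * norm (zeta_quad \<theta> (Complex a (- t))))"
      unfolding J_def
    proof (rule integral_norm_bound_integral)
      show "(\<lambda>t. h (Complex a (- t))) integrable_on {T..2 * T}" using vert by (auto simp: integrable_on_def)
      have "continuous_on \<Omega> (zeta_quad \<theta>)"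
        unfolding \<Omega>_def by (rule holomorphic_on_imp_continuous_on[OF zeta_quad_holomorphic])
      then have "continuous_on {T..2 * T} (\<lambda>t. zeta_quad \<theta> (Complex a (- t)))"
        by (rule continuous_on_compose2) (use in\<Omega> in \<open>auto intro!: continuous_intros simp: Complex_eq\<close>)
      then show "(\<lambda>t. 256 * norm (zeta_quad \<theta> (Complex a (- t)))) integrable_on {T..2 * T}"
        by (intro integrable_continuous_real continuous_intros)
      fix t assume t: "t \<in> {T..2 * T}"
      have n: "norm (Complex x y) \<le> 2 * T" if "\<bar>x\<bar> \<le> 5" "\<bar>y\<bar> \<le> T" for x y
        using cmod_le[of "Complex x y"] that T10 by simp
      have "Complex a (- t) - 5 + \<i> * of_real T = Complex (a - 5) (T - t)" "Complex a (- t) - 5 + \<i> * of_real (2 * T) = Complex (a - 5) (2 * T - t)"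
        by (auto simp: complex_eq_iff)
      then have "norm ((Complex a (- t) - 5 + \<i> * of_real T) * (Complex a (- t) - 5 + \<i> * of_real (2 * T))) \<le> (2 * T) * (2 * T)"
        unfolding norm_mult using a t T10 n[of "a - 5" "T - t"] n[of "a - 5" "2 * T - t"] by (intro mult_mono) auto
      then have "norm ((Complex a (- t) - 5 + \<i> * of_real T) * (Complex a (- t) - 5 + \<i> * of_real (2 * T)) / of_real (T\<^sup>2)) \<le> (2 * T) * (2 * T) / T\<^sup>2"
        unfolding norm_divide norm_of_real abs_power2 by (rule divide_right_mono) simp
      also have "\<dots> = 4" using T10 by (simp add: power2_eq_square)
      finally have "norm (w (Complex a (- t))) \<le> 4 ^ 4" unfolding w_def norm_power by (intro power_mono) auto
      then have "norm (zeta_quad \<theta> (Complex a (- t))) * norm (w (Complex a (- t))) \<le> norm (zeta_quad \<theta> (Complex a (- t))) * 256"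
        by (intro mult_left_mono) auto
      then show "norm (h (Complex a (- t))) \<le> 256 * norm (zeta_quad \<theta> (Complex a (- t)))"
        by (simp add: h_def norm_mult mult.commute)
    qed
    finally show "\<kappa> / 256 * T \<le> integral {T..2 * T} (\<lambda>t. norm (zeta_quad \<theta> (Complex a (- t))))" by simp
  qed
qed

section \<open>The shape of the main term\<close>

text \<open>
  At a pole of order \<open>n + 1\<close> the residue is the \<open>n\<close>-th Taylor coefficient of the regular factor.
\<close>
lemma residue_times_powr:
  assumes A: "open A" "p \<in> A" "q holomorphic_on A" and x: "x > 0"
    and F: "\<And>s. s \<in> A - {p} \<Longrightarrow> F s = q s / (s - p) ^ Suc n"
    and F': "\<And>s. f s = F s * of_real x powr s"
  shows "residue f p = (deriv ^^ n) (\<lambda>s. q s * of_real x powr s) p / fact n"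
proof -
  have "residue f p = residue (\<lambda>s. q s * of_real x powr s / (s - p) ^ Suc n) p"
  proof (rule residue_cong)
    have "eventually (\<lambda>s. s \<in> A) (at p)" using A by (intro eventually_at_in_open') auto
    moreover have "eventually (\<lambda>s. s \<noteq> p) (at p)" by (rule eventually_neq_at_within)
    ultimately show "eventually (\<lambda>s. f s = q s * of_real x powr s / (s - p) ^ Suc n) (at p)"
      by eventually_elim (simp add: F F')
  qed simp
  also have "\<dots> = (deriv ^^ n) (\<lambda>s. q s * of_real x powr s) p / fact n"
    using A x by (intro residue_holomorphic_over_power[of A]) (auto intro!: holomorphic_intros)
  finally show ?thesis .
qed

lemma zeta_compose_holomorphic:
  assumes "f holomorphic_on A" "\<And>s. s \<in> A \<Longrightarrow> f s \<noteq> 1"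
  shows "(\<lambda>s. zeta (f s)) holomorphic_on A"
proof -
  have "1 \<notin> f ` A" using assms(2) by force
  then show ?thesis
    using holomorphic_on_compose[OF assms(1) zeta_holomorphic] by (simp add: o_def)
qed

lemma D_fun_minus: "D_fun (- \<theta>) = D_fun \<theta>"
  by (simp add: D_fun_def fun_eq_iff mult.commute)

lemma open_zeta_nonzero_near:
  assumes "Re p \<ge> 1" "open B" "p \<in> B"
  obtains r where "r > 0" "\<And>s. s \<in> ball p r \<Longrightarrow> Re s > 1 / 2 \<and> s \<in> B \<and> zeta (2 * s) \<noteq> 0"
proof -
  have cont: "continuous_on {s. Re s > 1 / 2} (\<lambda>s. zeta (2 * s))"
    by (rule continuous_on_compose2[of "- {1}" zeta _ "\<lambda>s. 2 * s"])
      (auto intro!: continuous_intros holomorphic_on_imp_continuous_on zeta_holomorphic simp: complex_eq_iff)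
  have "open ({s. Re s > 1 / 2} \<inter> (\<lambda>s. zeta (2 * s)) -` (- {0}))"
    using cont by (intro continuous_open_preimage open_Re_gt) auto
  then have "open (({s. Re s > 1 / 2} \<inter> (\<lambda>s. zeta (2 * s)) -` (- {0})) \<inter> B)" by (rule open_Int) (rule assms)
  moreover have "p \<in> ({s. Re s > 1 / 2} \<inter> (\<lambda>s. zeta (2 * s)) -` (- {0})) \<inter> B"
    using assms zeta_nonzero_Re_ge_2[of "2 * p"] by auto
  ultimately obtain r where "r > 0" "ball p r \<subseteq> ({s. Re s > 1 / 2} \<inter> (\<lambda>s. zeta (2 * s)) -` (- {0})) \<inter> B"
    using openE by blast
  then show thesis using that by blast
qed

text \<open>
  Since \<open>\<theta> \<noteq> 0\<close>, the only singular factor at \<open>1\<close> is the square of \<open>\<zeta>(s)\<close>; the double pole produces the logarithm.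
\<close>
lemma residue_D_fun_one:
  assumes \<theta>: "\<theta> \<noteq> 0"
  obtains a b where "\<And>x. x > 0 \<Longrightarrow> residue (\<lambda>s. D_fun \<theta> s * of_real x powr s / s) 1 = of_real x * (a * of_real (ln x) + b)"
proof -
  obtain h where h: "h holomorphic_on {s. Re s > 0}" "h 1 = 1" "\<And>s. Re s > 0 \<Longrightarrow> s \<noteq> 1 \<Longrightarrow> h s = (s - 1) * zeta s"
    using zeta_simple_pole by blast
  let ?i = "\<i> * complex_of_real \<theta>"
  define B where "B = - {1 - ?i, 1 + ?i}"
  have "open B" unfolding B_def by (intro open_Compl finite_imp_closed) auto
  moreover have "1 \<in> B" using \<theta> by (auto simp: B_def)
  ultimately obtain r where r: "r > 0" "\<And>s. s \<in> ball 1 r \<Longrightarrow> Re s > 1 / 2 \<and> s \<in> B \<and> zeta (2 * s) \<noteq> 0"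
    using open_zeta_nonzero_near[of 1 B] by auto
  define q where "q = (\<lambda>s. h s ^ 2 * zeta (s + ?i) * zeta (s - ?i) / (zeta (2 * s) * s))"
  have q: "q holomorphic_on ball 1 r"
    unfolding q_def
  proof (intro holomorphic_intros zeta_compose_holomorphic)
    show "h holomorphic_on ball 1 r" using h(1) by (rule holomorphic_on_subset) (use r(2) in force)
    fix s assume s: "s \<in> ball (1::complex) r"
    note rs = r(2)[OF s]
    show "s + ?i \<noteq> 1" "s - ?i \<noteq> 1" using rs by (auto simp: B_def algebra_simps)
    show "2 * s \<noteq> 1" using rs by (auto simp: complex_eq_iff)
    show "zeta (2 * s) * s \<noteq> 0" using rs by auto
  qed
  have qd: "q field_differentiable (at 1)"
    using q by (rule holomorphic_on_imp_differentiable_at) (use r in auto)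
  show thesis
  proof (rule that[of "q 1" "deriv q 1"])
    fix x :: real assume x: "x > 0"
    have "residue (\<lambda>s. D_fun \<theta> s * of_real x powr s / s) 1 = (deriv ^^ 1) (\<lambda>s. q s * of_real x powr s) 1 / fact 1"
    proof (rule residue_times_powr[OF open_ball _ q x])
      show "1 \<in> ball (1::complex) r" using r by simp
      fix s assume s: "s \<in> ball 1 r - {1::complex}"
      have "zeta s = h s / (s - 1)" using h(3)[of s] s r(2)[of s] by auto
      then show "D_fun \<theta> s / s = q s / (s - 1) ^ Suc 1"
        by (simp add: D_fun_def q_def power2_eq_square)
    qed simp
    also have "\<dots> = deriv (\<lambda>s. q s * of_real x powr s) 1" by simp
    also have "\<dots> = deriv q 1 * of_real x powr 1 + q 1 * (of_real (ln x) * of_real x powr 1)"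
    proof (rule DERIV_imp_deriv)
      have "(q has_field_derivative deriv q 1) (at 1)" using qd field_differentiable_derivI by blast
      moreover have "((\<lambda>s. complex_of_real x powr s) has_field_derivative (of_real (ln x) * of_real x powr 1)) (at 1)"
        using has_field_derivative_powr_right[of "complex_of_real x" 1] x unfolding Ln_of_real[OF x] by simp
      ultimately have "((\<lambda>s. q s * of_real x powr s) has_field_derivative (deriv q 1 * of_real x powr 1 + (of_real (ln x) * of_real x powr 1) * q 1)) (at 1)"
        by (rule DERIV_mult)
      then show "((\<lambda>s. q s * of_real x powr s) has_field_derivative (deriv q 1 * of_real x powr 1 + q 1 * (of_real (ln x) * of_real x powr 1))) (at 1)"
        by (simp only: mult.commute[of "q 1"])
    qed
    also have "\<dots> = of_real x * (q 1 * of_real (ln x) + deriv q 1)" using x by (simp add: algebra_simps)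
    finally show "residue (\<lambda>s. D_fun \<theta> s * of_real x powr s / s) 1 = of_real x * (q 1 * of_real (ln x) + deriv q 1)" .
  qed
qed

lemma residue_D_fun_shifted:
  assumes \<theta>: "\<theta> \<noteq> 0"
  obtains c where "\<And>x. x > 0 \<Longrightarrow> residue (\<lambda>s. D_fun \<theta> s * of_real x powr s / s) (1 + \<i> * of_real \<theta>) = c * of_real x powr (1 + \<i> * of_real \<theta>)"
proof -
  obtain h where h: "h holomorphic_on {s. Re s > 0}" "h 1 = 1" "\<And>s. Re s > 0 \<Longrightarrow> s \<noteq> 1 \<Longrightarrow> h s = (s - 1) * zeta s"
    using zeta_simple_pole by blast
  let ?i = "\<i> * complex_of_real \<theta>"
  let ?p = "1 + ?i"
  define B where "B = - {1, 1 - ?i}"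
  have "open B" unfolding B_def by (intro open_Compl finite_imp_closed) auto
  moreover have "?p \<in> B" using \<theta> by (auto simp: B_def complex_eq_iff)
  ultimately obtain r where r: "r > 0" "\<And>s. s \<in> ball ?p r \<Longrightarrow> Re s > 1 / 2 \<and> s \<in> B \<and> zeta (2 * s) \<noteq> 0"
    using open_zeta_nonzero_near[of ?p B] by auto
  define q where "q = (\<lambda>s. zeta s ^ 2 * zeta (s + ?i) * h (s - ?i) / (zeta (2 * s) * s))"
  have hc: "(\<lambda>s. h (s - ?i)) holomorphic_on ball ?p r"
    by (rule holomorphic_on_compose_gen[of "\<lambda>s. s - ?i" _ h "{s. Re s > 0}", unfolded o_def])
      (use h(1) r(2) in \<open>force intro!: holomorphic_intros\<close>)+
  have q: "q holomorphic_on ball ?p r"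
    unfolding q_def
  proof (intro holomorphic_intros zeta_compose_holomorphic hc)
    fix s assume s: "s \<in> ball ?p r"
    note rs = r(2)[OF s]
    show "s \<noteq> 1" "s + ?i \<noteq> 1" using rs by (auto simp: B_def algebra_simps)
    show "2 * s \<noteq> 1" using rs by (auto simp: complex_eq_iff)
    show "zeta (2 * s) * s \<noteq> 0" using rs by auto
  qed
  show thesis
  proof (rule that[of "q ?p"])
    fix x :: real assume x: "x > 0"
    have "residue (\<lambda>s. D_fun \<theta> s * of_real x powr s / s) ?p = (deriv ^^ 0) (\<lambda>s. q s * of_real x powr s) ?p / fact 0"
    proof (rule residue_times_powr[OF open_ball _ q x])
      show "?p \<in> ball ?p r" using r by simp
      fix s assume s: "s \<in> ball ?p r - {?p}"
      have e: "s - ?p = (s - ?i) - 1" by simp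
      have "s - ?i \<noteq> 1" using s by (auto simp: algebra_simps)
      then have "h (s - ?i) = (s - ?i - 1) * zeta (s - ?i)" using r(2)[of s] s by (intro h(3)) auto
      then have "zeta (s - ?i) = h (s - ?i) / (s - ?p)" unfolding e using \<open>s - ?i \<noteq> 1\<close> by simp
      then show "D_fun \<theta> s / s = q s / (s - ?p) ^ Suc 0"
        by (simp add: D_fun_def q_def)
    qed simp
    then show "residue (\<lambda>s. D_fun \<theta> s * of_real x powr s / s) ?p = q ?p * of_real x powr ?p" by simp
  qed
qed

text \<open>
  In the variable \<open>u = ln x\<close> the main term is a combination of functions whose Laplace transforms are
  principal parts at \<open>1\<close> and \<open>1 \<plusminus> \<i>\<theta>\<close>. Taking the real part mixes the last two
  exponentials, which are complex conjugates.
\<close>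
lemma main_term_exp:
  assumes \<theta>: "\<theta> \<noteq> 0"
  obtains a b c d where "\<And>u. complex_of_real (main_term \<theta> (exp u)) =
    a * of_real u * exp (of_real u) + b * exp (of_real u) + c * exp ((1 + \<i> * of_real \<theta>) * of_real u) + d * exp ((1 - \<i> * of_real \<theta>) * of_real u)"
proof -
  obtain A B where AB: "\<And>x. x > 0 \<Longrightarrow> residue (\<lambda>s. D_fun \<theta> s * of_real x powr s / s) 1 = of_real x * (A * of_real (ln x) + B)"
    using residue_D_fun_one[OF \<theta>] by blast
  obtain C where C: "\<And>x. x > 0 \<Longrightarrow> residue (\<lambda>s. D_fun \<theta> s * of_real x powr s / s) (1 + \<i> * of_real \<theta>) = C * of_real x powr (1 + \<i> * of_real \<theta>)"
    using residue_D_fun_shifted[OF \<theta>] by blast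
  obtain D where D: "\<And>x. x > 0 \<Longrightarrow> residue (\<lambda>s. D_fun \<theta> s * of_real x powr s / s) (1 - \<i> * of_real \<theta>) = D * of_real x powr (1 - \<i> * of_real \<theta>)"
    using residue_D_fun_shifted[of "- \<theta>"] \<theta> unfolding D_fun_minus by auto
  have pw: "complex_of_real (exp u) powr z = exp (z * of_real u)" for u z
    by (simp add: powr_def Ln_of_real)
  show thesis
  proof (rule that[of "of_real (Re A)" "of_real (Re B)" "(C + cnj D) / 2" "(cnj C + D) / 2"])
    fix u :: real
    let ?i = "\<i> * complex_of_real \<theta>"
    let ?E = "exp (complex_of_real u)" and ?P = "exp ((1 + ?i) * of_real u)" and ?M = "exp ((1 - ?i) * of_real u)"
    have dist: "1 \<noteq> 1 + ?i" "1 \<noteq> 1 - ?i" "1 + ?i \<noteq> 1 - ?i" using \<theta> by (auto simp: complex_eq_iff)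
    define S where "S = A * of_real u * ?E + B * ?E + C * ?P + D * ?M"
    have "(\<Sum>p \<in> {1, 1 + ?i, 1 - ?i}. residue (\<lambda>s. D_fun \<theta> s * of_real (exp u) powr s / s) p) = S"
    proof -
      have sum3: "(\<Sum>p \<in> {1, 1 + ?i, 1 - ?i}. R p) = R 1 + R (1 + ?i) + R (1 - ?i)" for R :: "complex \<Rightarrow> complex"
        using dist by (simp add: add.assoc)
      show ?thesis
        unfolding sum3 AB[OF exp_gt_zero] C[OF exp_gt_zero] D[OF exp_gt_zero]
        unfolding pw ln_exp S_def by (simp add: exp_of_real algebra_simps)
    qed
    then have "main_term \<theta> (exp u) = Re S" by (simp add: main_term_def)
    then have m: "complex_of_real (main_term \<theta> (exp u)) = (S + cnj S) / 2" by (simp add: complex_add_cnj)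
    have cP: "cnj ?P = ?M" "cnj ?M = ?P" "cnj ?E = ?E" by (simp_all add: exp_cnj)
    have "complex_of_real (Re A) = (A + cnj A) / 2" "complex_of_real (Re B) = (B + cnj B) / 2" by (simp_all add: complex_add_cnj)
    then show "complex_of_real (main_term \<theta> (exp u)) = of_real (Re A) * of_real u * ?E + of_real (Re B) * ?E + (C + cnj D) / 2 * ?P + (cnj C + D) / 2 * ?M"
      unfolding m S_def by (simp only: complex_cnj_add complex_cnj_mult complex_cnj_complex_of_real cP) (simp add: field_simps)
  qed
qed

section \<open>Laplace transforms of exponentials and of summatory functions\<close>

lemma has_vector_derivative_exp_mult:
  "((\<lambda>u. exp (z * complex_of_real u)) has_vector_derivative (z * exp (z * of_real u))) (at u)"
proof -
  have "((\<lambda>u. z * complex_of_real u) has_vector_derivative z * of_real 1) (at u)"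
    by (intro has_vector_derivative_mult_right has_vector_derivative_of_real) (auto intro!: derivative_eq_intros)
  from field_vector_diff_chain_at[OF this DERIV_exp] show ?thesis by (simp add: o_def)
qed

lemma has_bochner_integral_FTC_atLeast:
  fixes f F :: "real \<Rightarrow> complex"
  assumes F: "\<And>u. (F has_vector_derivative f u) (at u)" and f: "\<And>u. isCont f u"
    and int: "integrable lborel (\<lambda>u. indicator {c<..} u *\<^sub>R f u)" and lim: "(F \<longlongrightarrow> 0) at_top"
  shows "has_bochner_integral lborel (\<lambda>u. indicator {c..} u *\<^sub>R f u) (- F c)"
proof -
  have e: "einterval (ereal c) \<infinity> = {c<..}" by (auto simp: einterval_def)
  have "(LBINT u=ereal c..\<infinity>. f u) = 0 - F c"
  proof (rule interval_integral_FTC_integrable[of _ _ F])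
    show "set_integrable lborel (einterval (ereal c) \<infinity>) f" unfolding e set_integrable_def using int .
    show "((F \<circ> real_of_ereal) \<longlongrightarrow> F c) (at_right (ereal c))"
    proof -
      have "isCont F c" using F has_vector_derivative_continuous by blast
      then have "(F \<longlongrightarrow> F c) (at_right c)" by (simp add: isCont_def filterlim_at_split)
      then show ?thesis by (simp add: ereal_tendsto_simps)
    qed
    show "((F \<circ> real_of_ereal) \<longlongrightarrow> 0) (at_left \<infinity>)" using lim by (simp add: ereal_tendsto_simps)
  qed (use F f in auto)
  then have "(\<integral>u. indicator {c<..} u *\<^sub>R f u \<partial>lborel) = - F c"
    by (simp add: interval_lebesgue_integral_def e set_lebesgue_integral_def)
  then have "has_bochner_integral lborel (\<lambda>u. indicator {c<..} u *\<^sub>R f u) (- F c)" using int by (simp add: has_bochner_integral_iff)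
  moreover have "AE u in lborel. indicator {c<..} u *\<^sub>R f u = indicator {c..} u *\<^sub>R f u"
    using AE_lborel_singleton[of c] by eventually_elim (auto simp: indicator_def)
  moreover have "f \<in> borel_measurable borel" using f by (intro borel_measurable_continuous_onI continuous_at_imp_continuous_on) auto
  ultimately show ?thesis by (subst has_bochner_integral_cong_AE[symmetric]) auto
qed

lemma integrable_exp_tail:
  assumes "(\<sigma>::real) > 0" 
  shows "integrable lborel (\<lambda>u. indicator {c<..} u * exp (- \<sigma> * u))" "integrable lborel (\<lambda>u. indicator {0<..} u * (u * exp (- \<sigma> * u)))"
proof -
  have "has_mellin (\<lambda>x. of_real (exp (- \<sigma> * x))) (of_real (Re 1)) (Gamma (of_real (Re 1)) * cpow \<sigma> (- of_real (Re 1)))"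
    using assms by (intro has_mellin_exp) auto
  from has_mellin_real_nonneg[OF this] have 1: "integrable lborel (\<lambda>x. indicator {0<..} x *\<^sub>R (exp (- \<sigma> * x) * x powr (Re 1 - 1)))"
    by (auto simp: has_bochner_integral_iff)
  have "integrable lborel (\<lambda>u. exp (- \<sigma> * c) * (indicator {0<..} (- c + 1 * u) *\<^sub>R (exp (- \<sigma> * (- c + 1 * u)) * (- c + 1 * u) powr (Re 1 - 1))))"
    by (intro integrable_mult_right lborel_integrable_real_affine 1) simp
  also have "(\<lambda>u. exp (- \<sigma> * c) * (indicator {0<..} (- c + 1 * u) *\<^sub>R (exp (- \<sigma> * (- c + 1 * u)) * (- c + 1 * u) powr (Re 1 - 1)))) = (\<lambda>u. indicator {c<..} u * exp (- \<sigma> * u))"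
  proof
    fix u
    have "exp (- \<sigma> * c) * exp (- \<sigma> * (- c + 1 * u)) = exp (- \<sigma> * u)" by (simp add: algebra_simps flip: exp_add)
    then show "exp (- \<sigma> * c) * (indicator {0<..} (- c + 1 * u) *\<^sub>R (exp (- \<sigma> * (- c + 1 * u)) * (- c + 1 * u) powr (Re 1 - 1))) = indicator {c<..} u * exp (- \<sigma> * u)"
      by (auto simp: indicator_def)
  qed
  finally show "integrable lborel (\<lambda>u. indicator {c<..} u * exp (- \<sigma> * u))" .
  have "has_mellin (\<lambda>x. of_real (exp (- \<sigma> * x))) (of_real (Re 2)) (Gamma (of_real (Re 2)) * cpow \<sigma> (- of_real (Re 2)))"
    using assms by (intro has_mellin_exp) auto
  from has_mellin_real_nonneg[OF this] have "integrable lborel (\<lambda>x. indicator {0<..} x *\<^sub>R (exp (- \<sigma> * x) * x powr (Re 2 - 1)))"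
    by (auto simp: has_bochner_integral_iff)
  also have "(\<lambda>x. indicator {0<..} x *\<^sub>R (exp (- \<sigma> * x) * x powr (Re 2 - 1))) = (\<lambda>u. indicator {0<..} u * (u * exp (- \<sigma> * u)))"
    by (auto simp: indicator_def fun_eq_iff)
  finally show "integrable lborel (\<lambda>u. indicator {0<..} u * (u * exp (- \<sigma> * u)))" .
qed

lemma exp_neg_tendsto_0:
  assumes "Re z > 0"
  shows "((\<lambda>u. exp (- z * complex_of_real u)) \<longlongrightarrow> 0) at_top" "((\<lambda>u. complex_of_real u * exp (- z * complex_of_real u)) \<longlongrightarrow> 0) at_top"
proof -
  have "((\<lambda>u. exp (- Re z * u)) \<longlongrightarrow> 0) at_top" using assms by real_asymp
  then have "((\<lambda>u. norm (exp (- z * complex_of_real u))) \<longlongrightarrow> 0) at_top" by simp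
  then show "((\<lambda>u. exp (- z * complex_of_real u)) \<longlongrightarrow> 0) at_top" by (rule tendsto_norm_zero_cancel)
  have "((\<lambda>u. \<bar>u\<bar> * exp (- Re z * u)) \<longlongrightarrow> 0) at_top" using assms by real_asymp
  then have "((\<lambda>u. norm (complex_of_real u * exp (- z * complex_of_real u))) \<longlongrightarrow> 0) at_top" by (simp add: norm_mult)
  then show "((\<lambda>u. complex_of_real u * exp (- z * complex_of_real u)) \<longlongrightarrow> 0) at_top" by (rule tendsto_norm_zero_cancel)
qed

lemma has_bochner_integral_exp_tail:
  assumes z: "Re z > 0"
  shows "has_bochner_integral lborel (\<lambda>u. indicator {c..} u *\<^sub>R exp (- z * complex_of_real u)) (exp (- z * of_real c) / z)"
proof -
  have z0: "z \<noteq> 0" using z by auto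
  have "has_bochner_integral lborel (\<lambda>u. indicator {c..} u *\<^sub>R exp (- z * complex_of_real u)) (- (- inverse z * exp (- z * of_real c)))"
  proof (rule has_bochner_integral_FTC_atLeast)
    show "((\<lambda>u. - inverse z * exp (- z * complex_of_real u)) has_vector_derivative exp (- z * of_real u)) (at u)" for u
      using has_vector_derivative_mult_right[OF has_vector_derivative_exp_mult[of "- z" u], of "- inverse z"] z0 by (simp add: mult.assoc[symmetric])
    show "isCont (\<lambda>u. exp (- z * complex_of_real u)) u" for u by (intro continuous_intros)
    show "integrable lborel (\<lambda>u. indicator {c<..} u *\<^sub>R exp (- z * complex_of_real u))"
      by (rule Bochner_Integration.integrable_bound[OF integrable_exp_tail(1)[OF z, of c]]) auto
    show "((\<lambda>u. - inverse z * exp (- z * complex_of_real u)) \<longlongrightarrow> 0) at_top"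
      by (rule tendsto_mult_right_zero[OF exp_neg_tendsto_0(1)[OF z]])
  qed
  then show ?thesis by (simp add: divide_inverse mult.commute)
qed

lemma has_bochner_integral_linear_exp:
  assumes z: "Re z > 0"
  shows "has_bochner_integral lborel (\<lambda>u. indicator {0..} u *\<^sub>R (of_real u * exp (- z * complex_of_real u))) (1 / z\<^sup>2)"
proof -
  have z0: "z \<noteq> 0" using z by auto
  define F where "F = (\<lambda>u. - inverse z * (complex_of_real u * exp (- z * of_real u)) + - inverse (z\<^sup>2) * exp (- z * of_real u))"
  have "has_bochner_integral lborel (\<lambda>u. indicator {0..} u *\<^sub>R (of_real u * exp (- z * complex_of_real u))) (- F 0)"
  proof (rule has_bochner_integral_FTC_atLeast)
    show "(F has_vector_derivative (of_real u * exp (- z * complex_of_real u))) (at u)" for u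
    proof -
      have "((\<lambda>u. complex_of_real u * exp (- z * of_real u)) has_vector_derivative (of_real u * (- z * exp (- z * of_real u)) + of_real 1 * exp (- z * of_real u))) (at u)"
        by (intro has_vector_derivative_mult has_vector_derivative_of_real has_vector_derivative_exp_mult) (auto intro!: derivative_eq_intros)
      then have "(F has_vector_derivative (- inverse z * (of_real u * (- z * exp (- z * of_real u)) + of_real 1 * exp (- z * of_real u)) + - inverse (z\<^sup>2) * (- z * exp (- z * of_real u)))) (at u)"
        unfolding F_def by (intro has_vector_derivative_add has_vector_derivative_mult_right has_vector_derivative_exp_mult)
      moreover have "- inverse z * (of_real u * (- z * e) + of_real 1 * e) + - inverse (z\<^sup>2) * (- z * e) = of_real u * e" for e
        using z0 by (simp add: field_simps power2_eq_square)
      ultimately show ?thesis by simp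
    qed
    show "isCont (\<lambda>u. complex_of_real u * exp (- z * complex_of_real u)) u" for u by (intro continuous_intros)
    show "integrable lborel (\<lambda>u. indicator {0<..} u *\<^sub>R (of_real u * exp (- z * complex_of_real u)))"
      by (rule Bochner_Integration.integrable_bound[OF integrable_exp_tail(2)[OF z]]) (auto simp: norm_mult abs_mult)
    have "(F \<longlongrightarrow> - inverse z * 0 + - inverse (z\<^sup>2) * 0) at_top"
      unfolding F_def by (intro tendsto_intros exp_neg_tendsto_0[OF z])
    then show "(F \<longlongrightarrow> 0) at_top" by simp
  qed
  then show ?thesis by (simp add: F_def inverse_eq_divide)
qed

text \<open>
  The summatory function in the variable \<open>u = ln x\<close>, cut off at \<open>x = 1\<close>.
\<close>
definition log_sum :: "(nat \<Rightarrow> real) \<Rightarrow> real \<Rightarrow> real" where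
  "log_sum a u = (\<Sum>n | 1 \<le> n \<and> real n \<le> exp u. a n) * indicator {0..} u"

lemma finite_le_real: "finite {n. 1 \<le> n \<and> real n \<le> x}"
  by (rule finite_subset[of _ "{..nat \<lfloor>x\<rfloor>}"]) (auto simp: le_nat_floor)

lemma log_sum_sums:
  assumes a0: "\<And>n. a n \<ge> 0"
  shows "(\<lambda>n. a (Suc n) * indicator {ln (real (Suc n))..} u) sums log_sum a u"
proof (cases "u \<ge> 0")
  case True
  let ?A = "{n. 1 \<le> n \<and> real n \<le> exp u}"
  have iff: "ln (real (Suc n)) \<le> u \<longleftrightarrow> real (Suc n) \<le> exp u" for n
    by (metis exp_le_cancel_iff exp_ln of_nat_0_less_iff zero_less_Suc)
  have fin: "finite {n. real (Suc n) \<le> exp u}"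
    using finite_le_real[of "exp u"] by (rule finite_surj[of _ _ "\<lambda>n. n - 1"]) force
  have "(\<lambda>n. a (Suc n) * indicator {ln (real (Suc n))..} u) sums (\<Sum>n | real (Suc n) \<le> exp u. a (Suc n) * indicator {ln (real (Suc n))..} u)"
    by (rule sums_finite[OF fin]) (auto simp: indicator_def iff simp del: of_nat_Suc)
  also have "(\<Sum>n | real (Suc n) \<le> exp u. a (Suc n) * indicator {ln (real (Suc n))..} u) = (\<Sum>n | real (Suc n) \<le> exp u. a (Suc n))"
    by (intro sum.cong refl) (auto simp: indicator_def iff simp del: of_nat_Suc)
  also have "\<dots> = (\<Sum>n\<in>?A. a n)"
    by (rule sum.reindex_bij_witness[of _ "\<lambda>n. n - 1" Suc]) auto
  finally show ?thesis using True by (simp add: log_sum_def)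
next
  case False
  have "ln (real (Suc n)) \<ge> 0" for n by simp
  then have "u \<notin> {ln (real (Suc n))..}" for n using False order_trans by (metis atLeast_iff)
  then show ?thesis using False by (simp add: log_sum_def)
qed

text \<open>
  Each \<open>n\<close> contributes \<open>a n\<close> times the transform of the indicator of \<open>[ln n, \<infinity>)\<close>, which is
  \<open>n powr (-s) / s\<close>.
\<close>
lemma log_sum_laplace:
  assumes a0: "\<And>n. a n \<ge> 0" and s: "Re s > 0" and summ: "summable (\<lambda>n. a (Suc n) * real (Suc n) powr (- Re s))"
  shows "integrable lborel (\<lambda>u. of_real (log_sum a u) * exp (- (s * of_real u)))"
    "laplace (log_sum a) s = (\<Sum>n. of_real (a (Suc n)) * of_nat (Suc n) powr (- s)) / s"
proof -
  define f where "f = (\<lambda>n u. complex_of_real (a (Suc n)) * (indicator {ln (real (Suc n))..} u *\<^sub>R exp (- s * of_real u)))"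
  have f: "has_bochner_integral lborel (f n) (of_real (a (Suc n)) * (exp (- s * of_real (ln (real (Suc n)))) / s))" for n
    unfolding f_def by (intro has_bochner_integral_mult_right has_bochner_integral_exp_tail s)
  have nf: "(\<integral>u. norm (f n u) \<partial>lborel) = a (Suc n) * real (Suc n) powr (- Re s) / Re s" for n
  proof -
    have "has_bochner_integral lborel (\<lambda>u. indicator {ln (real (Suc n))..} u *\<^sub>R exp (- of_real (Re s) * complex_of_real u)) (exp (- of_real (Re s) * of_real (ln (real (Suc n)))) / of_real (Re s))"
      using s by (intro has_bochner_integral_exp_tail) auto
    from has_bochner_integral_mult_right[OF has_bochner_integral_bounded_linear[OF bounded_linear_Re this], of "a (Suc n)"]
    have A: "has_bochner_integral lborel (\<lambda>u. a (Suc n) * Re (indicator {ln (real (Suc n))..} u *\<^sub>R exp (- of_real (Re s) * complex_of_real u)))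
      (a (Suc n) * Re (exp (- of_real (Re s) * of_real (ln (real (Suc n)))) / of_real (Re s)))" .
    have B: "a (Suc n) * Re (indicator {ln (real (Suc n))..} u *\<^sub>R exp (- of_real (Re s) * complex_of_real u)) = norm (f n u)" for u
      using a0[of "Suc n"] by (simp add: f_def norm_mult Re_exp)
    have C: "exp (- of_real (Re s) * complex_of_real (ln (real (Suc n)))) = of_real (real (Suc n) powr (- Re s))"
      by (simp add: powr_def exp_of_real del: of_nat_Suc flip: of_real_mult of_real_minus)
    have "has_bochner_integral lborel (\<lambda>u. norm (f n u)) (a (Suc n) * Re (of_real (real (Suc n) powr (- Re s)) / of_real (Re s)))"
      using A unfolding B C .
    then show ?thesis by (simp add: has_bochner_integral_iff del: of_nat_Suc)
  qed
  have sums: "(\<lambda>n. f n u) sums (of_real (log_sum a u) * exp (- (s * of_real u)))" for u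
  proof -
    have "(\<lambda>n. complex_of_real (a (Suc n) * indicator {ln (real (Suc n))..} u) * exp (- (s * of_real u))) sums (of_real (log_sum a u) * exp (- (s * of_real u)))"
      by (intro sums_mult2 sums_of_real log_sum_sums a0)
    then show ?thesis by (simp add: f_def scaleR_conv_of_real mult.assoc del: of_nat_Suc)
  qed
  have norm_sums: "summable (\<lambda>n. norm (f n u))" for u
  proof -
    have "norm (f n u) = a (Suc n) * indicator {ln (real (Suc n))..} u * exp (- (Re s * u))" for n
      using a0[of "Suc n"] by (simp add: f_def norm_mult del: of_nat_Suc)
    then show ?thesis using sums_summable[OF sums_mult2[OF log_sum_sums[of a u, OF a0], of "exp (- (Re s * u))"]] by simp
  qed
  have int: "integrable lborel (f n)" for n using f by (rule integrable.intros)
  have summ_int: "summable (\<lambda>n. \<integral>u. norm (f n u) \<partial>lborel)" unfolding nf by (intro summable_divide summ)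
  have "integrable lborel (\<lambda>u. \<Sum>n. f n u)"
    by (rule integrable_suminf[OF int _ summ_int]) (simp add: norm_sums)
  then show "integrable lborel (\<lambda>u. of_real (log_sum a u) * exp (- (s * of_real u)))"
    by (simp only: sums_unique[OF sums, symmetric])
  have "(\<lambda>n. integral\<^sup>L lborel (f n)) sums (\<integral>u. (\<Sum>n. f n u) \<partial>lborel)"
    by (rule sums_integral[OF int _ summ_int]) (simp add: norm_sums)
  moreover have "(\<integral>u. (\<Sum>n. f n u) \<partial>lborel) = laplace (log_sum a) s"
    unfolding laplace_def by (simp only: sums_unique[OF sums, symmetric])
  moreover have "integral\<^sup>L lborel (f n) = of_real (a (Suc n)) * of_nat (Suc n) powr (- s) / s" for n
    using has_bochner_integral_integral_eq[OF f[of n]] of_nat_powr_exp[of "Suc n" "- s"] by (simp del: of_nat_Suc)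
  ultimately have "(\<lambda>n. of_real (a (Suc n)) * of_nat (Suc n) powr (- s) / s) sums laplace (log_sum a) s" by simp
  then have "(\<lambda>n. of_real (a (Suc n)) * of_nat (Suc n) powr (- s) / s * s) sums (laplace (log_sum a) s * s)"
    by (rule sums_mult2)
  moreover have "s \<noteq> 0" using s by auto
  ultimately have "(\<lambda>n. of_real (a (Suc n)) * of_nat (Suc n) powr (- s)) sums (laplace (log_sum a) s * s)" by simp
  then show "laplace (log_sum a) s = (\<Sum>n. of_real (a (Suc n)) * of_nat (Suc n) powr (- s)) / s"
    using \<open>s \<noteq> 0\<close> by (simp add: sums_iff)
qed

section \<open>Convergence of the Laplace transform under one-sided bounds\<close>

lemma laplace_conv_of_bound:
  assumes [measurable]: "g \<in> borel_measurable borel" and supp: "\<And>u. u < 0 \<Longrightarrow> g u = 0"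
    and bd: "AE u in lborel. u \<ge> 0 \<longrightarrow> \<bar>g u\<bar> \<le> C * exp (\<kappa> * u)" and \<sigma>: "\<sigma> > \<kappa>"
  shows "laplace_conv g \<sigma>"
  unfolding laplace_conv_def
proof (rule Bochner_Integration.integrable_bound)
  show "integrable lborel (\<lambda>u. C * (indicator {-1<..} u * exp (- (\<sigma> - \<kappa>) * u)))"
    using \<sigma> by (intro integrable_mult_right integrable_exp_tail) auto
  show "AE u in lborel. norm (g u * exp (- (\<sigma> * u))) \<le> norm (C * (indicator {-1<..} u * exp (- (\<sigma> - \<kappa>) * u)))"
    using bd
  proof eventually_elim
    case (elim u)
    show ?case
    proof (cases "u \<ge> 0")
      case True
      then have "\<bar>g u\<bar> * exp (- (\<sigma> * u)) \<le> C * exp (\<kappa> * u) * exp (- (\<sigma> * u))" using elim by (intro mult_right_mono) auto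
      also have "\<dots> = C * exp (- (\<sigma> - \<kappa>) * u)" by (simp add: algebra_simps flip: exp_add)
      also have "\<dots> \<le> \<bar>C\<bar> * exp (- (\<sigma> - \<kappa>) * u)" by (intro mult_right_mono) auto
      finally show ?thesis using True by (simp add: abs_mult)
    qed (use supp in auto)
  qed
qed measurable

text \<open>
  The Laplace transform of a main term of the form found above.
\<close>
definition polar_part :: "real \<Rightarrow> complex \<Rightarrow> complex \<Rightarrow> complex \<Rightarrow> complex \<Rightarrow> complex \<Rightarrow> complex" where
  "polar_part \<theta> a b c d s = a / (s - 1)\<^sup>2 + b / (s - 1) + c / (s - (1 + \<i> * of_real \<theta>)) + d / (s - (1 - \<i> * of_real \<theta>))"

text \<open>
  The poles of the principal part, of the product of four zeta factors and of \<open>\<zeta>(2s)\<close>.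
\<close>
definition exceptional :: "real \<Rightarrow> complex set" where
  "exceptional \<theta> = {1, 1 + \<i> * of_real \<theta>, 1 - \<i> * of_real \<theta>, 1 / 2}"

lemma Re_exceptional: "s \<in> exceptional \<theta> \<Longrightarrow> Re s = 1 \<or> Re s = 1 / 2"
  unfolding exceptional_def by (elim insertE emptyE; hypsubst; simp)

lemma polar_part_holomorphic: "A \<inter> exceptional \<theta> = {} \<Longrightarrow> polar_part \<theta> a b c d holomorphic_on A"
  unfolding polar_part_def exceptional_def by (intro holomorphic_intros) auto

lemma zeta_quad_holomorphic_exceptional: 
  assumes "A \<inter> exceptional \<theta> = {}" shows "zeta_quad \<theta> holomorphic_on A" "(\<lambda>s. zeta (2 * s)) holomorphic_on A"
proof -
  have ne: "s \<noteq> 1" "s + \<i> * of_real \<theta> \<noteq> 1" "s - \<i> * of_real \<theta> \<noteq> 1" "2 * s \<noteq> 1" if "s \<in> A" for s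
  proof -
    have "s \<notin> exceptional \<theta>" using assms that by auto
    then show "s \<noteq> 1" "s + \<i> * of_real \<theta> \<noteq> 1" "s - \<i> * of_real \<theta> \<noteq> 1" "2 * s \<noteq> 1"
      by (auto simp: exceptional_def algebra_simps eq_divide_eq)
  qed
  show "zeta_quad \<theta> holomorphic_on A" unfolding zeta_quad_def by (intro holomorphic_intros zeta_compose_holomorphic ne)
  show "(\<lambda>s. zeta (2 * s)) holomorphic_on A" by (intro holomorphic_intros zeta_compose_holomorphic ne)
qed

text \<open>
  With the denominator \<open>\<zeta>(2s)\<close> multiplied out, both sides are holomorphic apart from finitely
  many points in the half-plane of convergence of the Laplace integral, so the identity continues to it.
\<close>
lemma laplace_identity_continuation:
  assumes conv: "\<And>\<sigma>. \<sigma> > \<kappa> \<Longrightarrow> laplace_conv g \<sigma>" and supp: "\<And>u. u < 0 \<Longrightarrow> g u = 0"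
    and \<kappa>: "\<kappa> < 1"
    and id: "\<And>s. Re s > 1 \<Longrightarrow> s * (laplace g s + polar_part \<theta> a b c d s) * zeta (2 * s) = zeta_quad \<theta> s"
    and s: "Re s > \<kappa>" "s \<notin> exceptional \<theta>"
  shows "s * (laplace g s + polar_part \<theta> a b c d s) * zeta (2 * s) = zeta_quad \<theta> s"
proof -
  define S where "S = {s. Re s > \<kappa>} - exceptional \<theta>"
  have fin: "finite (exceptional \<theta>)" by (simp add: exceptional_def)
  have disj: "S \<inter> exceptional \<theta> = {}" by (auto simp: S_def)
  show ?thesis
  proof (rule analytic_continuation_open[of "{s. Re s > 1}" S "\<lambda>s. s * (laplace g s + polar_part \<theta> a b c d s) * zeta (2 * s)" "zeta_quad \<theta>"])
    show "{s. Re s > 1} \<noteq> {}" using exI[of "\<lambda>s. Re s > 1" 2] by auto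
    show "open S" unfolding S_def using fin by (intro open_Diff open_Re_gt finite_imp_closed)
    show "connected S" unfolding S_def
    proof (rule connected_open_diff_countable)
      show "countable (exceptional \<theta>)" using fin by (rule countable_finite)
    qed (auto intro: open_Re_gt convex_connected convex_halfspace_Re_gt)
    show "{s. 1 < Re s} \<subseteq> S" using \<kappa> by (auto simp: S_def exceptional_def)
    show "(\<lambda>s. s * (laplace g s + polar_part \<theta> a b c d s) * zeta (2 * s)) holomorphic_on S"
      using disj by (intro holomorphic_intros polar_part_holomorphic zeta_quad_holomorphic_exceptional
        holomorphic_on_subset[OF laplace_holomorphic_halfplane[OF conv supp]]) (auto simp: S_def)
    show "zeta_quad \<theta> holomorphic_on S" by (rule zeta_quad_holomorphic_exceptional(1)[OF disj])
  qed (use id s open_Re_gt in \<open>auto simp: S_def\<close>)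
qed

lemma zeta_nonzero_tube:
  assumes "0 < x" "x \<le> y" "y < 1"
  obtains \<rho> where "\<rho> > 0" "\<And>s. x \<le> Re s \<Longrightarrow> Re s \<le> y \<Longrightarrow> \<bar>Im s\<bar> < \<rho> \<Longrightarrow> zeta s \<noteq> 0"
proof -
  define K where "K = complex_of_real ` {x..y}"
  have "open ((- {1}) \<inter> zeta -` (- {0}))"
    using holomorphic_on_imp_continuous_on[OF zeta_holomorphic[of "- {1}"]] by (intro continuous_open_preimage) auto
  moreover have "K \<subseteq> (- {1}) \<inter> zeta -` (- {0})"
  proof
    fix z assume "z \<in> K"
    then obtain r where r: "z = of_real r" "x \<le> r" "r \<le> y" by (auto simp: K_def)
    then have "Re (zeta z) < 0" "r \<noteq> 1" using zeta_neg_real[of r] assms by auto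
    then show "z \<in> (- {1}) \<inter> zeta -` (- {0})" using r(1) by auto
  qed
  moreover have "compact K" unfolding K_def by (intro compact_continuous_image continuous_intros) auto
  moreover have "K \<noteq> {}" using assms by (auto simp: K_def)
  ultimately obtain e where e: "e > 0" "{z. infdist z K \<le> e} \<subseteq> (- {1}) \<inter> zeta -` (- {0})"
    using compact_in_open_separated[of K "(- {1}) \<inter> zeta -` (- {0})"] by metis
  show thesis
  proof (rule that[OF e(1)])
    fix s assume s: "x \<le> Re s" "Re s \<le> y" "\<bar>Im s\<bar> < e"
    have "infdist s K \<le> dist s (of_real (Re s))" using s by (intro infdist_le) (auto simp: K_def)
    also have "dist s (of_real (Re s)) = \<bar>Im s\<bar>" by (simp add: dist_norm cmod_def)
    finally have "s \<in> {z. infdist z K \<le> e}" using s(3) by simp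
    then have "s \<in> zeta -` (- {0})" using e(2) by blast
    then show "zeta s \<noteq> 0" by simp
  qed
qed

text \<open>
  Landau's theorem for the nonnegative function \<open>\<epsilon> g(u) + C exp (\<beta> u)\<close>. Its transform continues to a
  neighbourhood of the real segment from \<open>\<beta>\<close> to \<open>7 / 16\<close>, because \<open>\<zeta>(2s)\<close> has no zeros near that segment.
  So the two-sided bound, which gives convergence to the right of \<open>\<kappa>\<close> only, improves to convergence
  to the right of \<open>\<beta>\<close>.
\<close>
lemma laplace_conv_of_one_sided:
  assumes g [measurable]: "g \<in> borel_measurable borel" and supp: "\<And>u. u < 0 \<Longrightarrow> g u = 0"
    and \<theta>: "\<theta> \<noteq> 0"
    and conv: "\<And>\<sigma>. \<sigma> > \<kappa> \<Longrightarrow> laplace_conv g \<sigma>"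
    and id: "\<And>s. Re s > 1 \<Longrightarrow> s * (laplace g s + polar_part \<theta> a b c d s) * zeta (2 * s) = zeta_quad \<theta> s"
    and \<epsilon>: "\<epsilon> = 1 \<or> \<epsilon> = -1" and C: "C \<ge> 0"
    and one: "AE u in lborel. u \<ge> 0 \<longrightarrow> \<epsilon> * g u + C * exp (\<beta> * u) \<ge> 0"
    and \<beta>: "0 < \<beta>" "\<beta> < 7 / 16" and \<kappa>: "\<kappa> < 7 / 16" and \<sigma>: "\<sigma> > \<beta>"
  shows "laplace_conv g \<sigma>"
proof -
  define G where "G = (\<lambda>u. indicator {0..} u * max 0 (\<epsilon> * g u + C * exp (\<beta> * u)))"
  define E where "E = (\<lambda>\<tau> u. C * (indicator {-1<..} u * exp (- (\<tau> - \<beta>) * u)))"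
  have E: "integrable lborel (E \<tau>)" if "\<tau> > \<beta>" for \<tau>
    unfolding E_def using that by (intro integrable_mult_right integrable_exp_tail) auto
  have [measurable]: "G \<in> borel_measurable borel" unfolding G_def by measurable
  have abs\<epsilon>: "\<bar>\<epsilon> * x\<bar> = \<bar>x\<bar>" for x using \<epsilon> by (auto simp: abs_mult)
  have Eu: "C * exp (\<beta> * u) * exp (- (\<tau> * u)) = E \<tau> u" if "u \<ge> 0" for \<tau> u
    using that by (simp add: E_def mult.assoc algebra_simps flip: exp_add)
  have Gbound: "\<bar>G u * exp (- (\<tau> * u))\<bar> \<le> \<bar>g u * exp (- (\<tau> * u))\<bar> + E \<tau> u" for \<tau> u
  proof (cases "u \<ge> 0")
    case True
    have "\<bar>G u\<bar> \<le> \<bar>g u\<bar> + C * exp (\<beta> * u)"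
    proof -
      have "0 \<le> C * exp (\<beta> * u)" using C by simp
      then have "\<bar>max 0 (\<epsilon> * g u + C * exp (\<beta> * u))\<bar> \<le> \<bar>\<epsilon> * g u\<bar> + C * exp (\<beta> * u)" by (simp add: abs_if max_def)
      then show ?thesis unfolding abs\<epsilon> using True by (simp add: G_def)
    qed
    then have "\<bar>G u\<bar> * exp (- (\<tau> * u)) \<le> (\<bar>g u\<bar> + C * exp (\<beta> * u)) * exp (- (\<tau> * u))" by (intro mult_right_mono) auto
    then show ?thesis using Eu[OF True, of \<tau>] by (simp add: abs_mult distrib_right)
  qed (use C in \<open>auto simp: G_def E_def\<close>)
  have Gconv: "laplace_conv G \<tau>" if "\<tau> > \<kappa>" "\<tau> > \<beta>" for \<tau>
    unfolding laplace_conv_def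
  proof (rule Bochner_Integration.integrable_bound)
    show "integrable lborel (\<lambda>u. \<bar>g u * exp (- (\<tau> * u))\<bar> + E \<tau> u)"
      using conv[OF that(1)] E[OF that(2)] by (simp add: laplace_conv_def)
    show "AE u in lborel. norm (G u * exp (- (\<tau> * u))) \<le> norm (\<bar>g u * exp (- (\<tau> * u))\<bar> + E \<tau> u)"
      using Gbound by (intro AE_I2) (simp add: order_trans[OF _ abs_ge_self])
  qed measurable
  have lapG: "laplace G s = of_real \<epsilon> * laplace g s + of_real C / (s - of_real \<beta>)" if s: "Re s > \<kappa>" "Re s > \<beta>" for s
  proof -
    have 1: "integrable lborel (\<lambda>u. of_real (g u) * exp (- (s * of_real u)))"
      using laplace_integrable[OF conv[OF s(1)] order_refl supp] by simp
    have 2: "has_bochner_integral lborel (\<lambda>u. indicator {0..} u *\<^sub>R exp (- (s - of_real \<beta>) * complex_of_real u)) (exp (- (s - of_real \<beta>) * of_real 0) / (s - of_real \<beta>))"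
      using s by (intro has_bochner_integral_exp_tail) auto
    have "laplace G s = (\<integral>u. of_real \<epsilon> * (of_real (g u) * exp (- (s * of_real u))) + of_real C * (indicator {0..} u *\<^sub>R exp (- (s - of_real \<beta>) * complex_of_real u)) \<partial>lborel)"
      unfolding laplace_def
    proof (rule integral_cong_AE)
      show "AE u in lborel. of_real (G u) * exp (- (s * of_real u)) = of_real \<epsilon> * (of_real (g u) * exp (- (s * of_real u))) + of_real C * (indicator {0..} u *\<^sub>R exp (- (s - of_real \<beta>) * complex_of_real u))"
        using one
      proof eventually_elim
        case (elim u)
        show ?case
        proof (cases "u \<ge> 0")
          case True
          have "- (s - of_real \<beta>) * complex_of_real u = of_real (\<beta> * u) + - (s * of_real u)"
            by (simp add: algebra_simps)
          then have "exp (- (s - of_real \<beta>) * complex_of_real u) = of_real (exp (\<beta> * u)) * exp (- (s * of_real u))"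
            by (simp only: exp_add exp_of_real)
          moreover have "G u = \<epsilon> * g u + C * exp (\<beta> * u)" using elim True by (simp add: G_def)
          ultimately show ?thesis using True by (simp add: distrib_right mult.assoc)
        qed (simp add: G_def supp)
      qed
    qed measurable
    also have "\<dots> = of_real \<epsilon> * laplace g s + of_real C * (1 / (s - of_real \<beta>))"
    proof (rule has_bochner_integral_integral_eq)
      have "has_bochner_integral lborel (\<lambda>u. of_real (g u) * exp (- (s * of_real u))) (laplace g s)"
        unfolding laplace_def using 1 by (rule has_bochner_integral_integrable)
      then show "has_bochner_integral lborel (\<lambda>u. of_real \<epsilon> * (of_real (g u) * exp (- (s * of_real u))) + of_real C * (indicator {0..} u *\<^sub>R exp (- (s - of_real \<beta>) * complex_of_real u))) (of_real \<epsilon> * laplace g s + of_real C * (1 / (s - of_real \<beta>)))"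
        using 2 by (intro has_bochner_integral_add has_bochner_integral_mult_right) simp_all
    qed
    finally show ?thesis by simp
  qed
  \<comment> \<open>A strip around the segment that reaches beyond \<open>7 / 16\<close>, as the continuation has to overlap the
    half-plane of convergence, and stays to the left of the pole of \<open>\<zeta>(2s)\<close> at \<open>1 / 2\<close>.\<close>
  obtain \<rho> where \<rho>: "\<rho> > 0" "\<And>s. 2 * \<beta> \<le> Re s \<Longrightarrow> Re s \<le> 15 / 16 \<Longrightarrow> \<bar>Im s\<bar> < \<rho> \<Longrightarrow> zeta s \<noteq> 0"
    using zeta_nonzero_tube[of "2 * \<beta>" "15 / 16"] \<beta> by auto
  define S where "S = {s. Re s > \<beta>} \<inter> {s. Re s < 15 / 32} \<inter> {s. Im s > - (\<rho> / 2)} \<inter> {s. Im s < \<rho> / 2}"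
  define \<Phi> where "\<Phi> = (\<lambda>s. of_real \<epsilon> * (zeta_quad \<theta> s / (s * zeta (2 * s)) - polar_part \<theta> a b c d s) + of_real C / (s - of_real \<beta>))"
  have S_ex: "S \<inter> exceptional \<theta> = {}" by (auto simp: S_def exceptional_def)
  have S_nz: "zeta (2 * s) \<noteq> 0" "s \<noteq> 0" "s - of_real \<beta> \<noteq> 0" if "s \<in> S" for s
  proof -
    show "zeta (2 * s) \<noteq> 0" using that by (intro \<rho>(2)) (auto simp: S_def)
    show "s \<noteq> 0" "s - of_real \<beta> \<noteq> 0" using that \<beta> by (auto simp: S_def)
  qed
  have Gc: "laplace_conv G \<sigma>"
  proof (rule landau_nonneg_laplace[of G "7 / 16" S \<beta> \<Phi>])
    show "G u \<ge> 0" for u by (simp add: G_def)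
    show "G u = 0" if "u < 0" for u using that by (simp add: G_def)
    show "laplace_conv G (7 / 16)" using \<kappa> \<beta> by (intro Gconv) auto
    show "open S" unfolding S_def
      by (intro open_Int open_halfspace_Re_gt open_halfspace_Re_lt open_halfspace_Im_gt open_halfspace_Im_lt)
    show "convex S" unfolding S_def
      by (intro convex_Int convex_halfspace_Re_gt convex_halfspace_Re_lt convex_halfspace_Im_gt convex_halfspace_Im_lt)
    show "complex_of_real x \<in> S" if "\<beta> < x" "x \<le> 7 / 16" for x using that \<rho>(1) by (auto simp: S_def)
    show "\<Phi> holomorphic_on S" unfolding \<Phi>_def
      using S_nz by (intro holomorphic_intros zeta_quad_holomorphic_exceptional[OF S_ex] polar_part_holomorphic[OF S_ex]) auto
    show "\<Phi> s = laplace G s" if s: "s \<in> S" "Re s > 7 / 16" for s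
    proof -
      have "s * (laplace g s + polar_part \<theta> a b c d s) * zeta (2 * s) = zeta_quad \<theta> s"
        using s S_ex \<kappa> by (intro laplace_identity_continuation[OF conv supp _ id]) auto
      then have "zeta_quad \<theta> s / (s * zeta (2 * s)) = laplace g s + polar_part \<theta> a b c d s"
        using S_nz[OF s(1)] by (simp add: field_simps)
      then show ?thesis using s \<kappa> \<beta> by (subst lapG) (auto simp: \<Phi>_def)
    qed
  qed (use \<sigma> in auto)
  show ?thesis
    unfolding laplace_conv_def
  proof (rule Bochner_Integration.integrable_bound)
    show "integrable lborel (\<lambda>u. G u * exp (- (\<sigma> * u)) + E \<sigma> u)"
      using Gc E[OF \<sigma>] by (simp add: laplace_conv_def)
    show "AE u in lborel. norm (g u * exp (- (\<sigma> * u))) \<le> norm (G u * exp (- (\<sigma> * u)) + E \<sigma> u)"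
      using one
    proof eventually_elim
      case (elim u)
      show ?case
      proof (cases "u \<ge> 0")
        case True
        have "0 \<le> C * exp (\<beta> * u)" using C by simp
        moreover have "0 \<le> \<epsilon> * g u + C * exp (\<beta> * u)" using elim True by simp
        ultimately have "\<bar>\<epsilon> * g u\<bar> \<le> (\<epsilon> * g u + C * exp (\<beta> * u)) + C * exp (\<beta> * u)" by linarith
        moreover have "G u = \<epsilon> * g u + C * exp (\<beta> * u)" using elim True by (simp add: G_def)
        ultimately have "\<bar>g u\<bar> \<le> G u + C * exp (\<beta> * u)" unfolding abs\<epsilon> by (simp only:)
        then have "\<bar>g u\<bar> * exp (- (\<sigma> * u)) \<le> (G u + C * exp (\<beta> * u)) * exp (- (\<sigma> * u))" by (intro mult_right_mono) auto
        also have "\<dots> = G u * exp (- (\<sigma> * u)) + E \<sigma> u" unfolding distrib_right Eu[OF True] ..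
        finally show ?thesis by (simp add: abs_mult)
      qed (simp add: supp)
    qed
  qed measurable
qed

section \<open>The Laplace transform of the error term\<close>

definition tau_sq :: "real \<Rightarrow> nat \<Rightarrow> real" where
  "tau_sq \<theta> n = (cmod (tau n \<theta>))\<^sup>2"

text \<open>
  The error term in the variable \<open>u = ln x\<close>. The last term of the sum is counted in full; this
  changes it only at logarithms of integers, a null set.
\<close>
definition log_error :: "real \<Rightarrow> real \<Rightarrow> real" where
  "log_error \<theta> u = log_sum (tau_sq \<theta>) u - indicator {0..} u * main_term \<theta> (exp u)"

lemma log_error_neg: "u < 0 \<Longrightarrow> log_error \<theta> u = 0"
  by (simp add: log_error_def log_sum_def)

lemma main_term_exp_continuous:
  assumes "\<theta> \<noteq> 0"
  shows "continuous_on A (\<lambda>u. main_term \<theta> (exp u))"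
proof -
  obtain a b c d where m: "\<And>u. complex_of_real (main_term \<theta> (exp u)) =
    a * of_real u * exp (of_real u) + b * exp (of_real u) + c * exp ((1 + \<i> * of_real \<theta>) * of_real u) + d * exp ((1 - \<i> * of_real \<theta>) * of_real u)"
    using main_term_exp[OF assms] by blast
  have "main_term \<theta> (exp u) = Re (a * of_real u * exp (of_real u) + b * exp (of_real u) + c * exp ((1 + \<i> * of_real \<theta>) * of_real u) + d * exp ((1 - \<i> * of_real \<theta>) * of_real u))" for u
    using m[of u] by (metis Re_complex_of_real)
  then show ?thesis by (simp only:) (intro continuous_intros)
qed

lemma log_error_measurable:
  assumes "\<theta> \<noteq> 0"
  shows "log_error \<theta> \<in> borel_measurable borel"
proof -
  have [measurable]: "(\<lambda>u. main_term \<theta> (exp u)) \<in> borel_measurable borel"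
    using main_term_exp_continuous[OF assms] by (rule borel_measurable_continuous_onI)
  have "(\<lambda>u. \<Sum>n. tau_sq \<theta> (Suc n) * indicator {ln (real (Suc n))..} u) \<in> borel_measurable borel"
    by (rule borel_measurable_suminf) measurable
  moreover have "(\<lambda>u. \<Sum>n. tau_sq \<theta> (Suc n) * indicator {ln (real (Suc n))..} u) = log_sum (tau_sq \<theta>)"
    using log_sum_sums[of "tau_sq \<theta>"] by (intro ext sums_unique[symmetric]) (simp add: tau_sq_def)
  ultimately have [measurable]: "log_sum (tau_sq \<theta>) \<in> borel_measurable borel" by (simp only:)
  show ?thesis unfolding log_error_def[abs_def] by measurable
qed

lemma log_error_locally_bounded:
  assumes "\<theta> \<noteq> 0"
  obtains B where "\<And>u. u \<le> U \<Longrightarrow> \<bar>log_error \<theta> u\<bar> \<le> B"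
proof -
  have "bounded ((\<lambda>u. main_term \<theta> (exp u)) ` {0..U})"
    by (intro compact_imp_bounded compact_continuous_image main_term_exp_continuous[OF assms]) auto
  then obtain B where B: "\<And>u. u \<in> {0..U} \<Longrightarrow> \<bar>main_term \<theta> (exp u)\<bar> \<le> B"
    unfolding bounded_iff by (metis image_eqI real_norm_def)
  define A where "A = (\<Sum>n | 1 \<le> n \<and> real n \<le> exp U. tau_sq \<theta> n)"
  have A0: "A \<ge> 0" unfolding A_def by (intro sum_nonneg) (simp add: tau_sq_def)
  show thesis
  proof (rule that[of "A + \<bar>B\<bar>"])
    fix u assume u: "u \<le> U"
    show "\<bar>log_error \<theta> u\<bar> \<le> A + \<bar>B\<bar>"
    proof (cases "u \<ge> 0")
      case True
      have eu: "exp u \<le> exp U" using u by simp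
      have "(\<Sum>n | 1 \<le> n \<and> real n \<le> exp u. tau_sq \<theta> n) \<le> A" unfolding A_def
        by (intro sum_mono2 finite_le_real) (auto simp: tau_sq_def intro: order_trans[OF _ eu])
      moreover have "(\<Sum>n | 1 \<le> n \<and> real n \<le> exp u. tau_sq \<theta> n) \<ge> 0" by (intro sum_nonneg) (simp add: tau_sq_def)
      ultimately show ?thesis using B[of u] u True by (simp add: log_error_def log_sum_def abs_le_iff)
    qed (use A0 in \<open>simp add: log_error_neg\<close>)
  qed
qed

lemma log_error_eq_Delta_AE:
  "AE u in lborel. u \<ge> 0 \<longrightarrow> log_error \<theta> u = Delta \<theta> (exp u)"
proof (rule AE_I')
  let ?N = "range (\<lambda>n. ln (real n))"
  show "?N \<in> null_sets lborel" by (intro countable_imp_null_set_lborel) auto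
  show "{u \<in> space lborel. \<not> (0 \<le> u \<longrightarrow> log_error \<theta> u = Delta \<theta> (exp u))} \<subseteq> ?N"
  proof
    fix u assume "u \<in> {u \<in> space lborel. \<not> (0 \<le> u \<longrightarrow> log_error \<theta> u = Delta \<theta> (exp u))}"
    then have u: "u \<ge> 0" "log_error \<theta> u \<noteq> Delta \<theta> (exp u)" by auto
    have "exp u \<in> \<nat>"
    proof (rule ccontr)
      assume "exp u \<notin> \<nat>"
      then have "log_error \<theta> u = Delta \<theta> (exp u)"
        using u by (simp add: log_error_def log_sum_def Delta_def starred_sum_def tau_sq_def)
      then show False using u by simp
    qed
    then obtain n where "exp u = real n" by (auto simp: Nats_def)
    then have "u = ln (real n)" by (metis ln_exp)
    then show "u \<in> ?N" by blast
  qed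
qed

text \<open>
  Ramanujan's formula, after subtracting the transform of the main term.
\<close>
lemma log_error_laplace:
  assumes \<theta>: "\<theta> \<noteq> 0"
  obtains a b c d where "\<And>\<tau>. \<tau> > 1 \<Longrightarrow> laplace_conv (log_error \<theta>) \<tau>"
    "\<And>s. Re s > 1 \<Longrightarrow> s * (laplace (log_error \<theta>) s + polar_part \<theta> a b c d s) * zeta (2 * s) = zeta_quad \<theta> s"
proof -
  obtain a b c d where m: "\<And>u. complex_of_real (main_term \<theta> (exp u)) =
    a * of_real u * exp (of_real u) + b * exp (of_real u) + c * exp ((1 + \<i> * of_real \<theta>) * of_real u) + d * exp ((1 - \<i> * of_real \<theta>) * of_real u)"
    using main_term_exp[OF \<theta>] by blast
  have main: "has_bochner_integral lborel (\<lambda>u. of_real (log_error \<theta> u) * exp (- (s * of_real u)))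
     (laplace (log_sum (tau_sq \<theta>)) s - polar_part \<theta> a b c d s)"
    and sum: "zeta (2 * s) * (s * laplace (log_sum (tau_sq \<theta>)) s) = zeta_quad \<theta> s" if s: "Re s > 1" for s
  proof -
    have summ: "summable (\<lambda>n. tau_sq \<theta> (Suc n) * real (Suc n) powr (- Re s))"
      unfolding tau_sq_def by (rule ramanujan_identity(1)[OF s])
    have L: "integrable lborel (\<lambda>u. of_real (log_sum (tau_sq \<theta>) u) * exp (- (s * of_real u)))"
      "laplace (log_sum (tau_sq \<theta>)) s = (\<Sum>n. of_real (tau_sq \<theta> (Suc n)) * of_nat (Suc n) powr (- s)) / s"
      using s by (intro log_sum_laplace[OF _ _ summ]; simp add: tau_sq_def)+
    have "s \<noteq> 0" using s by auto
    then have "s * laplace (log_sum (tau_sq \<theta>)) s = (\<Sum>n. of_real (tau_sq \<theta> (Suc n)) * of_nat (Suc n) powr (- s))"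
      unfolding L(2) by simp
    then show "zeta (2 * s) * (s * laplace (log_sum (tau_sq \<theta>)) s) = zeta_quad \<theta> s"
      using ramanujan_identity(2)[OF s, of \<theta>] by (simp only: tau_sq_def zeta_quad_def)
    let ?i = "\<i> * complex_of_real \<theta>"
    let ?e = "\<lambda>z u. indicator {0..} u *\<^sub>R exp (- z * complex_of_real u)"
    let ?l = "\<lambda>z u. indicator {0..} u *\<^sub>R (of_real u * exp (- z * complex_of_real u))"
    have e: "has_bochner_integral lborel (?e z) (1 / z)" if "Re z > 0" for z
      using has_bochner_integral_exp_tail[OF that, of 0] by simp
    have L': "has_bochner_integral lborel (\<lambda>u. of_real (log_sum (tau_sq \<theta>) u) * exp (- (s * of_real u))) (laplace (log_sum (tau_sq \<theta>)) s)"
      unfolding laplace_def using L(1) by (rule has_bochner_integral_integrable)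
    have P: "has_bochner_integral lborel (\<lambda>u. a * ?l (s - 1) u + b * ?e (s - 1) u + c * ?e (s - (1 + ?i)) u + d * ?e (s - (1 - ?i)) u)
       (a * (1 / (s - 1)\<^sup>2) + b * (1 / (s - 1)) + c * (1 / (s - (1 + ?i))) + d * (1 / (s - (1 - ?i))))"
      using s by (intro has_bochner_integral_add has_bochner_integral_mult_right e has_bochner_integral_linear_exp) auto
    have "of_real (log_error \<theta> u) * exp (- (s * of_real u)) = of_real (log_sum (tau_sq \<theta>) u) * exp (- (s * of_real u)) -
      (a * ?l (s - 1) u + b * ?e (s - 1) u + c * ?e (s - (1 + ?i)) u + d * ?e (s - (1 - ?i)) u)" for u
    proof (cases "u \<ge> 0")
      case True
      have x: "exp (w * of_real u) * exp (- (s * of_real u)) = exp (- (s - w) * of_real u)" for w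
        by (subst exp_add[symmetric]) (simp add: algebra_simps)
      have "of_real (main_term \<theta> (exp u)) * exp (- (s * of_real u)) =
        a * (of_real u * exp (- (s - 1) * of_real u)) + b * exp (- (s - 1) * of_real u) + c * exp (- (s - (1 + ?i)) * of_real u) + d * exp (- (s - (1 - ?i)) * of_real u)"
        unfolding m x[symmetric] by (simp add: distrib_right mult.assoc)
      then show ?thesis using True by (simp add: log_error_def left_diff_distrib)
    qed (simp add: log_error_neg log_sum_def)
    then show "has_bochner_integral lborel (\<lambda>u. of_real (log_error \<theta> u) * exp (- (s * of_real u)))
      (laplace (log_sum (tau_sq \<theta>)) s - polar_part \<theta> a b c d s)"
      using has_bochner_integral_diff[OF L' P] by (simp add: polar_part_def)
  qed
  show thesis
  proof (rule that)
    fix \<tau> :: real assume "\<tau> > 1"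
    then have "integrable lborel (\<lambda>u. of_real (log_error \<theta> u) * exp (- (of_real \<tau> * complex_of_real u)))"
      using main[of "of_real \<tau>"] by (intro integrable.intros) simp
    then have "integrable lborel (\<lambda>u. complex_of_real (log_error \<theta> u * exp (- (\<tau> * u))))"
      by (simp flip: exp_of_real)
    then show "laplace_conv (log_error \<theta>) \<tau>" unfolding laplace_conv_def by (simp only: complex_of_real_integrable_eq)
  next
    fix s :: complex assume s: "Re s > 1"
    have "laplace (log_error \<theta>) s = laplace (log_sum (tau_sq \<theta>)) s - polar_part \<theta> a b c d s"
      unfolding laplace_def[of "log_error \<theta>"] by (rule has_bochner_integral_integral_eq[OF main[OF s]])
    then show "s * (laplace (log_error \<theta>) s + polar_part \<theta> a b c d s) * zeta (2 * s) = zeta_quad \<theta> s"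
      using sum[OF s] by (simp add: mult.commute mult.left_commute)
  qed
qed

section \<open>Moments on a vertical line\<close>

lemma continuous_on_vertical_line:
  assumes "f holomorphic_on {s. Re s = \<sigma>}" 
  shows "continuous_on A (\<lambda>t. f (Complex \<sigma> t))"
proof (rule continuous_on_compose2[of "{s. Re s = \<sigma>}" f A "Complex \<sigma>"])
  show "continuous_on {s. Re s = \<sigma>} f" using assms by (rule holomorphic_on_imp_continuous_on)
  show "continuous_on A (Complex \<sigma>)" unfolding Complex_eq by (intro continuous_intros)
qed auto

text \<open>
  The weighted inequality with \<open>S = T\<close>: on \<open>[T, 2T]\<close> the Gaussian weight is at least \<open>exp (-2)\<close>.
\<close>
lemma laplace_mean_square:
  assumes conv: "laplace_conv g \<sigma>" and L2: "integrable lborel (\<lambda>u. (g u * exp (- (\<sigma> * u)))\<^sup>2)"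
    and hol: "laplace g holomorphic_on {s. Re s = \<sigma>}"
  obtains B where "B \<ge> 0" "\<And>T. T > 0 \<Longrightarrow> integral {T..2 * T} (\<lambda>t. (norm (laplace g (Complex \<sigma> t)))\<^sup>2) \<le> B"
proof -
  define k where "k = (\<lambda>u. g u * exp (- (\<sigma> * u)))"
  define N where "N = (\<integral>u. (k u)\<^sup>2 \<partial>lborel)"
  have F: "laplace g (Complex \<sigma> t) = (\<integral>u. of_real (k u) * exp (- (\<i> * of_real (t * u))) \<partial>lborel)" for t
  proof -
    have "exp (- (Complex \<sigma> t * of_real u)) = of_real (exp (- (\<sigma> * u))) * exp (- (\<i> * of_real (t * u)))" for u
      unfolding exp_of_real[symmetric] by (subst exp_add[symmetric]) (simp add: Complex_eq algebra_simps)
    then show ?thesis unfolding laplace_def k_def by (simp add: mult.assoc)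
  qed
  show thesis
  proof (rule that)
    show "exp 2 * (2 * pi * N) \<ge> 0" unfolding N_def by (intro mult_nonneg_nonneg) auto
    fix T :: real assume T: "T > 0"
    define h where "h = (\<lambda>t. exp (- t\<^sup>2 / (2 * T\<^sup>2)) * (norm (laplace g (Complex \<sigma> t)))\<^sup>2)"
    have h: "integrable lborel h" "(\<integral>t. h t \<partial>lborel) \<le> 2 * pi * N"
      unfolding h_def F N_def
      by (rule fourier_gaussian_bessel[OF _ _ T]; use conv L2 in \<open>simp add: k_def laplace_conv_def\<close>)+
    have si: "set_integrable lborel {T..2 * T} h"
      using h(1) unfolding set_integrable_def by (intro integrable_mult_indicator) auto
    have cont: "continuous_on A (\<lambda>t. (norm (laplace g (Complex \<sigma> t)))\<^sup>2)" for A
      by (intro continuous_intros continuous_on_vertical_line hol)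
    have "integral {T..2 * T} (\<lambda>t. (norm (laplace g (Complex \<sigma> t)))\<^sup>2) \<le> integral {T..2 * T} (\<lambda>t. exp 2 * h t)"
    proof (rule integral_le)
      show "(\<lambda>t. (norm (laplace g (Complex \<sigma> t)))\<^sup>2) integrable_on {T..2 * T}"
        by (intro integrable_continuous_interval cont)
      show "(\<lambda>t. exp 2 * h t) integrable_on {T..2 * T}" unfolding h_def using T
        by (intro integrable_continuous_interval continuous_intros cont) auto
      fix t assume t: "t \<in> {T..2 * T}"
      have "t\<^sup>2 \<le> (2 * T)\<^sup>2" using t T by (intro power_mono) auto
      then have "t\<^sup>2 / (2 * T\<^sup>2) \<le> 2" using T by (simp add: field_simps power2_eq_square)
      then have "1 \<le> exp 2 * exp (- t\<^sup>2 / (2 * T\<^sup>2))" by (simp flip: exp_add)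
      then have "1 * (norm (laplace g (Complex \<sigma> t)))\<^sup>2 \<le> (exp 2 * exp (- t\<^sup>2 / (2 * T\<^sup>2))) * (norm (laplace g (Complex \<sigma> t)))\<^sup>2"
        by (intro mult_right_mono) auto
      then show "(norm (laplace g (Complex \<sigma> t)))\<^sup>2 \<le> exp 2 * h t" unfolding h_def by (simp only: mult_1 mult.assoc)
    qed
    also have "\<dots> = exp 2 * (LINT t:{T..2 * T}|lborel. h t)"
      using set_borel_integral_eq_integral(2)[OF si] by simp
    also have "\<dots> \<le> exp 2 * (\<integral>t. h t \<partial>lborel)"
      unfolding set_lebesgue_integral_def
      by (intro mult_left_mono integral_mono h(1) si[unfolded set_integrable_def]) (auto simp: h_def indicator_def)
    also have "\<dots> \<le> exp 2 * (2 * pi * N)" by (intro mult_left_mono h(2)) auto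
    finally show "integral {T..2 * T} (\<lambda>t. (norm (laplace g (Complex \<sigma> t)))\<^sup>2) \<le> exp 2 * (2 * pi * N)" .
  qed
qed

lemma norm_polar_part_le:
  assumes t: "t \<ge> 2 * \<bar>\<theta>\<bar> + 4"
  shows "norm (polar_part \<theta> a b c d (Complex \<sigma> t)) \<le> 2 * (norm a + norm b + norm c + norm d) / t"
proof -
  let ?s = "Complex \<sigma> t"
  have frac: "norm (x / y) \<le> 2 * norm x / t" if "norm y \<ge> t / 2" for x y :: complex
  proof -
    have "norm (x / y) \<le> norm x / (t / 2)" unfolding norm_divide using that t by (intro divide_left_mono mult_pos_pos) auto
    then show ?thesis by (simp add: mult.commute)
  qed
  have im: "norm y \<ge> t / 2" if "Im y \<ge> t / 2" for y :: complex
    using that abs_Im_le_cmod[of y] t by linarith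
  have 1: "norm (?s - 1) \<ge> t" using abs_Im_le_cmod[of "?s - 1"] t by simp
  have "t / 2 * 1 \<le> norm (?s - 1) * norm (?s - 1)" using 1 t by (intro mult_mono) auto
  then have "norm ((?s - 1)\<^sup>2) \<ge> t / 2" unfolding power2_eq_square norm_mult by simp
  then have n1: "norm (a / (?s - 1)\<^sup>2) \<le> 2 * norm a / t" by (rule frac)
  have n2: "norm (b / (?s - 1)) \<le> 2 * norm b / t" using t by (intro frac im) auto
  have n3: "norm (c / (?s - (1 + \<i> * of_real \<theta>))) \<le> 2 * norm c / t" using t by (intro frac im) auto
  have n4: "norm (d / (?s - (1 - \<i> * of_real \<theta>))) \<le> 2 * norm d / t" using t by (intro frac im) auto
  have "norm (polar_part \<theta> a b c d ?s) \<le> 2 * norm a / t + 2 * norm b / t + 2 * norm c / t + 2 * norm d / t"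
    unfolding polar_part_def by (intro norm_triangle_le add_mono n1 n2 n3 n4)
  also have "\<dots> = 2 * (norm a + norm b + norm c + norm d) / t" by (simp add: add_divide_distrib)
  finally show ?thesis .
qed

text \<open>
  The reflection bound is applied to each of the four factors; passing to \<open>1 - s\<close> exchanges the shifts by
  \<open>\<i>\<theta>\<close> and \<open>-\<i>\<theta>\<close>. For \<open>t \<ge> T\<close> the imaginary parts \<open>t \<plusminus> \<theta>\<close> are at least \<open>T / 2\<close>.
\<close>
lemma zeta_quad_reflection_lower:
  assumes \<sigma>: "0 < \<sigma>" "\<sigma> < 1 / 2"
  obtains c where "c > 0" "\<And>T t. T \<ge> 2 * \<bar>\<theta>\<bar> + 4 \<Longrightarrow> T \<le> t \<Longrightarrow>
    c * (T / 2) powr (2 - 4 * \<sigma>) * norm (zeta_quad \<theta> (Complex (1 - \<sigma>) (- t))) \<le> norm (zeta_quad \<theta> (Complex \<sigma> t))"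
proof -
  obtain c where c: "c > 0" "\<And>s. 0 < Re s \<Longrightarrow> Re s \<le> 1 / 2 \<Longrightarrow> Im s \<ge> 2 \<Longrightarrow>
    c * Im s powr (1 / 2 - Re s) * norm (zeta (1 - s)) \<le> norm (zeta s)" using zeta_reflection_lower_bound by blast
  show thesis
  proof (rule that[of "c ^ 4"])
    show "c ^ 4 > 0" using c by simp
    fix T t assume T: "T \<ge> 2 * \<bar>\<theta>\<bar> + 4" "T \<le> t"
    let ?s = "Complex \<sigma> t" and ?i = "\<i> * complex_of_real \<theta>"
    define q where "q = c * (T / 2) powr (1 / 2 - \<sigma>)"
    have q0: "q \<ge> 0" using c by (simp add: q_def)
    have z: "q * norm (zeta (1 - s)) \<le> norm (zeta s)" if s: "Re s = \<sigma>" "Im s \<ge> T / 2" for s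
    proof -
      have "(T / 2) powr (1 / 2 - \<sigma>) \<le> Im s powr (1 / 2 - \<sigma>)" using s T \<sigma> by (intro powr_mono2) auto
      then have "q * norm (zeta (1 - s)) \<le> c * Im s powr (1 / 2 - \<sigma>) * norm (zeta (1 - s))"
        unfolding q_def using c by (intro mult_right_mono mult_left_mono) auto
      also have "\<dots> \<le> norm (zeta s)" using c(2)[of s] s T \<sigma> by simp
      finally show ?thesis .
    qed
    have z0: "q * norm (zeta (1 - ?s)) \<le> norm (zeta ?s)"
      and zp: "q * norm (zeta (1 - (?s + ?i))) \<le> norm (zeta (?s + ?i))"
      and zm: "q * norm (zeta (1 - (?s - ?i))) \<le> norm (zeta (?s - ?i))"
      using T by (intro z; simp)+
    have rew: "Complex (1 - \<sigma>) (- t) = 1 - ?s" "1 - ?s + ?i = 1 - (?s - ?i)" "1 - ?s - ?i = 1 - (?s + ?i)"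
      by (simp_all add: complex_eq_iff)
    have q4: "c ^ 4 * (T / 2) powr (2 - 4 * \<sigma>) = q ^ 4"
    proof -
      have "((T / 2) powr (1 / 2 - \<sigma>)) ^ 4 = (T / 2) powr (2 - 4 * \<sigma>)"
        by (subst powr_power) (use T in \<open>auto simp: algebra_simps\<close>)
      then show ?thesis by (simp add: q_def power_mult_distrib)
    qed
    have "q ^ 4 * norm (zeta_quad \<theta> (1 - ?s)) = (q * norm (zeta (1 - ?s)))\<^sup>2 * (q * norm (zeta (1 - (?s - ?i)))) * (q * norm (zeta (1 - (?s + ?i))))"
      unfolding zeta_quad_def rew norm_mult norm_power by (simp add: power2_eq_square power4_eq_xxxx)
    also have "\<dots> \<le> (norm (zeta ?s))\<^sup>2 * norm (zeta (?s - ?i)) * norm (zeta (?s + ?i))"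
      using q0 by (intro mult_mono power_mono z0 zp zm mult_nonneg_nonneg) auto
    also have "\<dots> = norm (zeta_quad \<theta> ?s)" by (simp add: zeta_quad_def norm_mult norm_power)
    finally show "c ^ 4 * (T / 2) powr (2 - 4 * \<sigma>) * norm (zeta_quad \<theta> (Complex (1 - \<sigma>) (- t))) \<le> norm (zeta_quad \<theta> ?s)"
      unfolding q4 rew .
  qed
qed

text \<open>
  By the identity, the product of four zeta factors is \<open>s\<close>, of size \<open>T\<close>, times
  \<open>laplace g s + polar_part\<close>, whose square has a bounded integral over \<open>[T, 2T]\<close>, times \<open>\<zeta>(2s)\<close>, for which
  that integral is \<open>O(T)\<close>.
  The inequality between arithmetic and geometric mean, balanced by \<open>m = sqrt T\<close>, gives the order
  \<open>T powr (3 / 2) = M ^ 3\<close>.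
\<close>
lemma zeta_quad_first_moment_upper:
  assumes \<sigma>: "11 / 32 < \<sigma>" "\<sigma> < 3 / 8"
    and ms: "\<And>T. T > 0 \<Longrightarrow> integral {T..2 * T} (\<lambda>t. (norm (laplace g (Complex \<sigma> t)))\<^sup>2) \<le> B" and B: "B \<ge> 0"
    and hol: "laplace g holomorphic_on {s. Re s = \<sigma>}"
    and id: "\<And>s. Re s = \<sigma> \<Longrightarrow> s * (laplace g s + polar_part \<theta> a b c d s) * zeta (2 * s) = zeta_quad \<theta> s"
  obtains K where "\<And>M::nat. M \<ge> 1 \<Longrightarrow> real M ^ 2 \<ge> 2 * \<bar>\<theta>\<bar> + 4 \<Longrightarrow>
     integral {real M ^ 2..2 * real M ^ 2} (\<lambda>t. norm (zeta_quad \<theta> (Complex \<sigma> t))) \<le> K * real M ^ 3"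
proof -
  obtain K where K: "\<And>M::nat. M \<ge> 1 \<Longrightarrow> integral {real M ^ 2..2 * real M ^ 2} (\<lambda>t. (norm (zeta (Complex (2 * \<sigma>) (2 * t))))\<^sup>2) \<le> K * real M ^ 2"
    using zeta_mean_square[of "2 * \<sigma>"] \<sigma> by auto
  define P where "P = 2 * (norm a + norm b + norm c + norm d)"
  have line: "{s. Re s = \<sigma>} \<inter> exceptional \<theta> = {}" using \<sigma> by (auto simp: exceptional_def)
  show thesis
  proof (rule that[of "3 / 2 * (2 * B + 2 * P\<^sup>2 + K)"])
    fix M :: nat assume M: "M \<ge> 1" and big: "real M ^ 2 \<ge> 2 * \<bar>\<theta>\<bar> + 4"
    define m where "m = real M"
    define T where "T = m\<^sup>2"
    define F where "F = (\<lambda>t. norm (laplace g (Complex \<sigma> t)))"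
    define Z where "Z = (\<lambda>t. norm (zeta (Complex (2 * \<sigma>) (2 * t))))"
    have m: "m \<ge> 1" using M by (simp add: m_def)
    have T: "T \<ge> 2 * \<bar>\<theta>\<bar> + 4" "T \<ge> 1" using big m by (auto simp: T_def m_def)
    have two: "Complex (2 * \<sigma>) (2 * t) = 2 * Complex \<sigma> t" for t by (simp add: complex_eq_iff)
    have cF: "continuous_on A F" for A unfolding F_def by (intro continuous_intros continuous_on_vertical_line hol)
    have cZ: "continuous_on A Z" for A unfolding Z_def two
      by (intro continuous_on_norm continuous_on_vertical_line[where f = "\<lambda>s. zeta (2 * s)"] zeta_quad_holomorphic_exceptional(2)[OF line])
    have cQ: "continuous_on A (\<lambda>t. norm (zeta_quad \<theta> (Complex \<sigma> t)))" for A
      by (intro continuous_on_norm continuous_on_vertical_line zeta_quad_holomorphic_exceptional line)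
    have "integral {T..2 * T} (\<lambda>t. norm (zeta_quad \<theta> (Complex \<sigma> t)))
        \<le> integral {T..2 * T} (\<lambda>t. 3 * T * m * (F t)\<^sup>2 + 3 * P\<^sup>2 * m / T + 3 * T / (2 * m) * (Z t)\<^sup>2)"
    proof (rule integral_le)
      fix t assume t: "t \<in> {T..2 * T}"
      let ?s = "Complex \<sigma> t"
      let ?D = "norm (laplace g ?s + polar_part \<theta> a b c d ?s)"
      have s: "norm ?s \<le> 3 * T" using cmod_le[of ?s] t T \<sigma> by simp
      have "norm (polar_part \<theta> a b c d ?s) \<le> P / t"
        unfolding P_def using t T by (intro norm_polar_part_le) auto
      also have "P / t \<le> P / T" using t T by (intro divide_left_mono mult_pos_pos) (auto simp: P_def)
      finally have D: "?D \<le> F t + P / T" unfolding F_def by (intro norm_triangle_le add_left_mono) 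
      have F0: "F t \<ge> 0" "Z t \<ge> 0" "P / T \<ge> 0" using T by (auto simp: F_def Z_def P_def)
      have amgm: "x * y \<le> (m * x\<^sup>2 + y\<^sup>2 / m) / 2" for x y :: real
      proof -
        have "0 \<le> (m * x - y)\<^sup>2 / m" using m by simp
        also have "\<dots> = m * x\<^sup>2 + y\<^sup>2 / m - 2 * (x * y)" using m by (simp add: field_simps power2_eq_square)
        finally show ?thesis by simp
      qed
      have "norm (zeta_quad \<theta> ?s) = norm ?s * ?D * Z t"
        unfolding id[of ?s, symmetric, simplified] Z_def two norm_mult ..
      also have "\<dots> \<le> (3 * T) * (F t + P / T) * Z t"
        using s D F0 T by (intro mult_right_mono mult_mono) auto
      also have "\<dots> = 3 * T * ((F t + P / T) * Z t)" by (simp only: mult.assoc)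
      also have "\<dots> \<le> 3 * T * ((m * (F t + P / T)\<^sup>2 + (Z t)\<^sup>2 / m) / 2)"
        using T by (intro mult_left_mono amgm) auto
      also have "\<dots> \<le> 3 * T * ((m * (2 * (F t)\<^sup>2 + 2 * (P / T)\<^sup>2) + (Z t)\<^sup>2 / m) / 2)"
      proof -
        have "(F t + P / T)\<^sup>2 \<le> 2 * (F t)\<^sup>2 + 2 * (P / T)\<^sup>2"
          using zero_le_power2[of "F t - P / T"] by (simp add: power2_sum power2_diff)
        then show ?thesis using T m by (intro mult_left_mono divide_right_mono add_right_mono) auto
      qed
      also have "\<dots> = 3 * T * m * (F t)\<^sup>2 + 3 * P\<^sup>2 * m / T + 3 * T / (2 * m) * (Z t)\<^sup>2"
        using T m by (simp add: field_simps power2_eq_square)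
      finally show "norm (zeta_quad \<theta> ?s) \<le> 3 * T * m * (F t)\<^sup>2 + 3 * P\<^sup>2 * m / T + 3 * T / (2 * m) * (Z t)\<^sup>2" .
    qed (use T m in \<open>intro integrable_continuous_interval continuous_intros cF cZ cQ; simp\<close>)+
    also have "\<dots> = 3 * T * m * integral {T..2 * T} (\<lambda>t. (F t)\<^sup>2) + 3 * P\<^sup>2 * m / T * T + 3 * T / (2 * m) * integral {T..2 * T} (\<lambda>t. (Z t)\<^sup>2)"
    proof -
      have i: "(\<lambda>t. 3 * T * m * (F t)\<^sup>2) integrable_on {T..2 * T}" "(\<lambda>t. 3 * T / (2 * m) * (Z t)\<^sup>2) integrable_on {T..2 * T}"
        "(\<lambda>t. 3 * P\<^sup>2 * m / T) integrable_on {T..2 * T}"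
        by (intro integrable_continuous_interval continuous_intros cF cZ)+
      have c: "integral {T..2 * T} (\<lambda>t. 3 * P\<^sup>2 * m / T) = 3 * P\<^sup>2 * m / T * T" using T by simp
      show ?thesis
        unfolding integral_add[OF integrable_add[OF i(1) i(3)] i(2)] integral_add[OF i(1) i(3)] c integral_mult_right ..
    qed
    also have "\<dots> \<le> 3 * T * m * B + 3 * P\<^sup>2 * m / T * T + 3 * T / (2 * m) * (K * T)"
    proof (intro add_mono mult_left_mono order_refl)
      show "integral {T..2 * T} (\<lambda>t. (F t)\<^sup>2) \<le> B" unfolding F_def using T by (intro ms) auto
      show "integral {T..2 * T} (\<lambda>t. (Z t)\<^sup>2) \<le> K * T" using K[OF M] by (simp add: Z_def T_def m_def)
    qed (use T m in auto)
    also have "\<dots> = 3 * m ^ 3 * B + 3 * P\<^sup>2 * m + 3 / 2 * m ^ 3 * K"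
      using m by (simp add: T_def field_simps power2_eq_square power3_eq_cube)
    also have "\<dots> \<le> 3 * m ^ 3 * B + 3 * P\<^sup>2 * m ^ 3 + 3 / 2 * m ^ 3 * K"
    proof -
      have "m ^ 1 \<le> m ^ 3" using m by (intro power_increasing) auto
      then show ?thesis by (simp add: mult_left_mono)
    qed
    also have "\<dots> = 3 / 2 * (2 * B + 2 * P\<^sup>2 + K) * m ^ 3" by (simp add: field_simps)
    finally show "integral {real M ^ 2..2 * real M ^ 2} (\<lambda>t. norm (zeta_quad \<theta> (Complex \<sigma> t))) \<le> 3 / 2 * (2 * B + 2 * P\<^sup>2 + K) * real M ^ 3"
      by (simp only: T_def m_def)
  qed
qed

text \<open>
  The function \<open>g(u) exp (- \<sigma> u)\<close> is integrable for \<open>\<sigma> > \<beta>\<close>. Bounding one of the two factors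
  \<open>|g(u)|\<close> of its square by \<open>C exp (\<kappa> u)\<close> shows that it is also square-integrable when
  \<open>2 * \<sigma> - \<kappa> > \<beta>\<close>. Since \<open>\<kappa> + \<beta> < 3 / 4\<close>, some \<open>\<sigma> < 3 / 8\<close> qualifies. The
  first moment of the product of four zeta factors on the line \<open>Re s = \<sigma>\<close> is then of order at most \<open>T powr (3 / 2)\<close>, but the
  reflection to the line \<open>1 - \<sigma>\<close> shows that it is at least of order
  \<open>T powr (3 - 4 * \<sigma>)\<close>, where \<open>3 - 4 * \<sigma> > 3 / 2\<close>.
\<close>
theorem no_one_sided_small_error:
  assumes g [measurable]: "g \<in> borel_measurable borel" and supp: "\<And>u. u < 0 \<Longrightarrow> g u = 0"
    and \<theta>: "\<theta> \<noteq> 0"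
    and id: "\<And>s. Re s > 1 \<Longrightarrow> s * (laplace g s + polar_part \<theta> a b c d s) * zeta (2 * s) = zeta_quad \<theta> s"
    and bd: "AE u in lborel. u \<ge> 0 \<longrightarrow> \<bar>g u\<bar> \<le> C * exp (\<kappa> * u)"
    and \<epsilon>: "\<epsilon> = 1 \<or> \<epsilon> = -1" and C: "C \<ge> 0"
    and one: "AE u in lborel. u \<ge> 0 \<longrightarrow> \<epsilon> * g u + C * exp (\<beta> * u) \<ge> 0"
    and \<beta>: "0 < \<beta>" "\<beta> < 3 / 8" and \<kappa>: "\<beta> < \<kappa>" "\<kappa> < 7 / 16" "\<kappa> + \<beta> < 3 / 4"
  shows False
proof -
  have conv\<kappa>: "laplace_conv g \<tau>" if "\<tau> > \<kappa>" for \<tau> by (rule laplace_conv_of_bound[OF g supp bd that])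
  have conv: "laplace_conv g \<tau>" if "\<tau> > \<beta>" for \<tau>
    using \<beta> \<kappa> by (intro laplace_conv_of_one_sided[OF g supp \<theta> conv\<kappa> id \<epsilon> C one _ _ _ that]) auto
  have "max ((\<kappa> + \<beta>) / 2) (11 / 32) < 3 / 8" unfolding max_less_iff_conj using \<kappa>(3) by simp
  then obtain \<sigma> where \<sigma>: "11 / 32 < \<sigma>" "\<sigma> < 3 / 8" "(\<kappa> + \<beta>) / 2 < \<sigma>" "\<beta> < \<sigma>"
    using dense[of "max ((\<kappa> + \<beta>) / 2) (11 / 32)" "3 / 8"] \<kappa>(1) by auto
  have L2: "integrable lborel (\<lambda>u. (g u * exp (- (\<sigma> * u)))\<^sup>2)"
  proof (rule Bochner_Integration.integrable_bound)
    show "integrable lborel (\<lambda>u. C * (g u * exp (- ((2 * \<sigma> - \<kappa>) * u))))"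
      using conv[of "2 * \<sigma> - \<kappa>"] \<sigma> by (intro integrable_mult_right) (simp add: laplace_conv_def)
    show "AE u in lborel. norm ((g u * exp (- (\<sigma> * u)))\<^sup>2) \<le> norm (C * (g u * exp (- ((2 * \<sigma> - \<kappa>) * u))))"
      using bd
    proof eventually_elim
      case (elim u)
      show ?case
      proof (cases "u \<ge> 0")
        case True
        have e: "(exp (- (\<sigma> * u)))\<^sup>2 = exp (- (2 * \<sigma> * u))" by (simp add: power2_eq_square flip: exp_add)
        have "(g u * exp (- (\<sigma> * u)))\<^sup>2 = \<bar>g u\<bar> * (\<bar>g u\<bar> * exp (- (2 * \<sigma> * u)))"
          unfolding power_mult_distrib e by (simp add: power2_eq_square abs_mult_self_eq mult.assoc[symmetric])
        also have "\<dots> \<le> (C * exp (\<kappa> * u)) * (\<bar>g u\<bar> * exp (- (2 * \<sigma> * u)))"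
          using elim True by (intro mult_right_mono) auto
        also have "\<dots> = C * \<bar>g u\<bar> * (exp (\<kappa> * u) * exp (- (2 * \<sigma> * u)))" by (simp only: mult_ac)
        also have "exp (\<kappa> * u) * exp (- (2 * \<sigma> * u)) = exp (- ((2 * \<sigma> - \<kappa>) * u))"
          by (subst exp_add[symmetric]) (simp add: algebra_simps)
        finally show ?thesis using C by (simp add: abs_mult mult.assoc)
      qed (simp add: supp)
    qed
  qed measurable
  have hol: "laplace g holomorphic_on {s. Re s = \<sigma>}"
    by (rule holomorphic_on_subset[OF laplace_holomorphic_halfplane[OF conv supp]]) (use \<sigma> in auto)
  obtain B where B: "B \<ge> 0" "\<And>T. T > 0 \<Longrightarrow> integral {T..2 * T} (\<lambda>t. (norm (laplace g (Complex \<sigma> t)))\<^sup>2) \<le> B"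
    using laplace_mean_square[OF conv[OF \<sigma>(4)] L2 hol] by blast
  have id': "s * (laplace g s + polar_part \<theta> a b c d s) * zeta (2 * s) = zeta_quad \<theta> s" if "Re s = \<sigma>" for s
    using that \<beta> \<sigma> by (intro laplace_identity_continuation[OF conv supp _ id]) (auto dest: Re_exceptional)
  obtain K where K: "\<And>M::nat. M \<ge> 1 \<Longrightarrow> real M ^ 2 \<ge> 2 * \<bar>\<theta>\<bar> + 4 \<Longrightarrow>
     integral {real M ^ 2..2 * real M ^ 2} (\<lambda>t. norm (zeta_quad \<theta> (Complex \<sigma> t))) \<le> K * real M ^ 3"
    using zeta_quad_first_moment_upper[OF \<sigma>(1,2) B(2,1) hol id'] by blast
  obtain c1 where c1: "c1 > 0" "\<And>T t. T \<ge> 2 * \<bar>\<theta>\<bar> + 4 \<Longrightarrow> T \<le> t \<Longrightarrow>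
    c1 * (T / 2) powr (2 - 4 * \<sigma>) * norm (zeta_quad \<theta> (Complex (1 - \<sigma>) (- t))) \<le> norm (zeta_quad \<theta> (Complex \<sigma> t))"
    using zeta_quad_reflection_lower[of \<sigma> \<theta>] \<sigma> by auto
  obtain c2 T0 where c2: "c2 > 0" "\<And>T. T \<ge> T0 \<Longrightarrow> c2 * T \<le> integral {T..2 * T} (\<lambda>t. norm (zeta_quad \<theta> (Complex (1 - \<sigma>) (- t))))"
    using zeta_quad_first_moment_lower[of "1 - \<sigma>" \<theta>] \<sigma> by auto
  have line: "{s. Re s = \<sigma>} \<inter> exceptional \<theta> = {}" "{s. Re s = 1 - \<sigma>} \<inter> exceptional \<theta> = {}" using \<sigma> by (auto simp: exceptional_def)
  have lower: "c1 * ((real M)\<^sup>2 / 2) powr (2 - 4 * \<sigma>) * (c2 * (real M)\<^sup>2) \<le> K * real M ^ 3"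
    if M: "M \<ge> 1" "(real M)\<^sup>2 \<ge> 2 * \<bar>\<theta>\<bar> + 4" "(real M)\<^sup>2 \<ge> T0" for M :: nat
  proof -
    define T where "T = (real M)\<^sup>2"
    define q where "q = c1 * (T / 2) powr (2 - 4 * \<sigma>)"
    have q: "q \<ge> 0" using c1 by (simp add: q_def)
    have cR: "continuous_on {T..2 * T} (\<lambda>t. norm (zeta_quad \<theta> (Complex (1 - \<sigma>) (- t))))"
    proof -
      have "continuous_on UNIV (\<lambda>t. norm (zeta_quad \<theta> (Complex (1 - \<sigma>) t)))"
        by (intro continuous_on_norm continuous_on_vertical_line zeta_quad_holomorphic_exceptional line)
      then show ?thesis
        by (rule continuous_on_compose2[where f = uminus]) (auto intro!: continuous_intros)
    qed
    have cQ: "continuous_on {T..2 * T} (\<lambda>t. norm (zeta_quad \<theta> (Complex \<sigma> t)))"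
      by (intro continuous_on_norm continuous_on_vertical_line zeta_quad_holomorphic_exceptional line)
    have "q * (c2 * T) \<le> q * integral {T..2 * T} (\<lambda>t. norm (zeta_quad \<theta> (Complex (1 - \<sigma>) (- t))))"
      using M q by (intro mult_left_mono c2) (auto simp: T_def)
    also have "\<dots> = integral {T..2 * T} (\<lambda>t. q * norm (zeta_quad \<theta> (Complex (1 - \<sigma>) (- t))))" by simp
    also have "\<dots> \<le> integral {T..2 * T} (\<lambda>t. norm (zeta_quad \<theta> (Complex \<sigma> t)))"
      using M unfolding q_def
      by (intro integral_le integrable_continuous_interval continuous_on_mult_left cR cQ c1(2)) (auto simp: T_def)
    also have "\<dots> \<le> K * real M ^ 3" unfolding T_def by (rule K[OF M(1,2)])
    finally show ?thesis by (simp only: q_def T_def)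
  qed
  have "filterlim (\<lambda>x::real. c1 * (x\<^sup>2 / 2) powr (2 - 4 * \<sigma>) * (c2 * x\<^sup>2) / x ^ 3) at_top at_top"
  proof -
    define e where "e = 3 / 2 - 4 * \<sigma>"
    have e: "e > 0" "2 - 4 * \<sigma> = 1 / 2 + e" using \<sigma> by (auto simp: e_def)
    show ?thesis unfolding e(2) using e(1) c1(1) c2(1) by real_asymp
  qed
  then have "eventually (\<lambda>x::real. c1 * (x\<^sup>2 / 2) powr (2 - 4 * \<sigma>) * (c2 * x\<^sup>2) / x ^ 3 > K) at_top"
    by (simp add: filterlim_at_top_dense)
  then have ev: "eventually (\<lambda>M::nat. c1 * ((real M)\<^sup>2 / 2) powr (2 - 4 * \<sigma>) * (c2 * (real M)\<^sup>2) / real M ^ 3 > K) sequentially"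
    by (rule eventually_compose_filterlim[OF _ filterlim_real_sequentially])
  have big: "eventually (\<lambda>M::nat. (real M)\<^sup>2 \<ge> X) sequentially" for X by real_asymp
  have "eventually (\<lambda>M::nat. False) sequentially"
    using ev big[of "2 * \<bar>\<theta>\<bar> + 4"] big[of T0] eventually_ge_at_top[of 1]
  proof eventually_elim
    case (elim M)
    then show False using lower[of M] by (simp add: pos_less_divide_eq)
  qed
  then show False by simp
qed

section \<open>Omega results for the error term\<close>

text \<open>
  The bounds for large \<open>x\<close> extend to all \<open>u \<ge> 0\<close> at the cost of a constant, because the error term is bounded
  on bounded ranges.
\<close>
lemma Delta_not_one_sided:
  assumes \<theta>: "\<theta> \<noteq> 0"
    and big: "eventually (\<lambda>x. \<bar>Delta \<theta> x\<bar> \<le> x powr \<kappa>) at_top"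
    and \<epsilon>: "\<epsilon> = 1 \<or> \<epsilon> = -1"
    and one: "eventually (\<lambda>x. \<epsilon> * Delta \<theta> x + x powr \<beta> \<ge> 0) at_top"
    and \<beta>: "0 < \<beta>" "\<beta> < 3 / 8" and \<kappa>: "\<beta> < \<kappa>" "\<kappa> < 7 / 16" "\<kappa> + \<beta> < 3 / 4"
  shows False
proof -
  obtain X where X: "\<And>x. x \<ge> X \<Longrightarrow> \<bar>Delta \<theta> x\<bar> \<le> x powr \<kappa> \<and> \<epsilon> * Delta \<theta> x + x powr \<beta> \<ge> 0"
    using eventually_conj[OF big one] unfolding eventually_at_top_linorder by blast
  obtain B where B: "\<And>u. u \<le> ln (max X 1) \<Longrightarrow> \<bar>log_error \<theta> u\<bar> \<le> B"
    using log_error_locally_bounded[OF \<theta>] by blast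
  have B0: "B \<ge> 0" using B[of 0] abs_ge_zero[of "log_error \<theta> 0"] by force
  obtain a b c d where id: "\<And>s. Re s > 1 \<Longrightarrow> s * (laplace (log_error \<theta>) s + polar_part \<theta> a b c d s) * zeta (2 * s) = zeta_quad \<theta> s"
    using log_error_laplace[OF \<theta>] by metis
  define C where "C = B + 1"
  have both: "AE u in lborel. u \<ge> 0 \<longrightarrow> \<bar>log_error \<theta> u\<bar> \<le> C * exp (\<kappa> * u) \<and> \<epsilon> * log_error \<theta> u + C * exp (\<beta> * u) \<ge> 0"
    using log_error_eq_Delta_AE[of \<theta>]
  proof eventually_elim
    case (elim u)
    have "\<bar>log_error \<theta> u\<bar> \<le> C * exp (\<kappa> * u) \<and> \<epsilon> * log_error \<theta> u + C * exp (\<beta> * u) \<ge> 0" if u: "u \<ge> 0"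
    proof (cases "u \<le> ln (max X 1)")
      case True
      have e: "1 \<le> exp (\<kappa> * u)" "1 \<le> exp (\<beta> * u)" using u \<beta> \<kappa> by auto
      have "B * 1 \<le> C * exp (\<kappa> * u)" "B * 1 \<le> C * exp (\<beta> * u)" using e B0 unfolding C_def by (intro mult_mono; simp)+
      moreover have "\<bar>\<epsilon> * log_error \<theta> u\<bar> \<le> B" "\<bar>log_error \<theta> u\<bar> \<le> B" using B[OF True] \<epsilon> by auto
      ultimately show ?thesis by linarith
    next
      case False
      have "max X 1 = exp (ln (max X 1))" by simp
      also have "\<dots> \<le> exp u" using False by (simp only: exp_le_cancel_iff)
      finally have "X \<le> exp u" by simp
      moreover have "exp u powr r = exp (r * u)" for r by (simp add: powr_def)
      ultimately have "\<bar>log_error \<theta> u\<bar> \<le> 1 * exp (\<kappa> * u)" "\<epsilon> * log_error \<theta> u + 1 * exp (\<beta> * u) \<ge> 0"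
        using X[of "exp u"] elim u by auto
      moreover have "1 * exp r \<le> C * exp r" for r using B0 unfolding C_def by (intro mult_right_mono) auto
      ultimately show ?thesis by (meson order_trans add_left_mono)
    qed
    then show ?case by blast
  qed
  show False
  proof (rule no_one_sided_small_error[OF log_error_measurable[OF \<theta>] log_error_neg \<theta> id _ \<epsilon> _ _ \<beta> \<kappa>])
    show "AE u in lborel. u \<ge> 0 \<longrightarrow> \<bar>log_error \<theta> u\<bar> \<le> C * exp (\<kappa> * u)" using both by eventually_elim blast
    show "AE u in lborel. u \<ge> 0 \<longrightarrow> \<epsilon> * log_error \<theta> u + C * exp (\<beta> * u) \<ge> 0" using both by eventually_elim blast
  qed (use B0 in \<open>auto simp: C_def\<close>)
qed

theorem theorem17:
  fixes \<theta> c \<delta> \<delta>' :: real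
  assumes "\<theta> \<noteq> 0" and "c > 0"
    and "0 < \<delta>" and "\<delta> < \<delta>'" and "\<delta>' < 1 / 8"
  shows "Omega (Delta \<theta>) (\<lambda>x. x powr (alpha c x + \<delta> / 2))
       \<or> Omega_pm (Delta \<theta>) (\<lambda>x. x powr (3 / 8 - \<delta>'))"
proof (rule ccontr)
  assume neg: "\<not> ?thesis"
  define \<beta> where "\<beta> = 3 / 8 - \<delta>'"
  define \<kappa> where "\<kappa> = 3 / 8 + \<delta> / 2"
  have params: "0 < \<beta>" "\<beta> < 3 / 8" "\<beta> < \<kappa>" "\<kappa> < 7 / 16" "\<kappa> + \<beta> < 3 / 4"
    using assms by (auto simp: \<beta>_def \<kappa>_def)
  have "Limsup at_top (\<lambda>x. ereal (\<bar>Delta \<theta> x\<bar> / x powr (alpha c x + \<delta> / 2))) < 1"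
    using neg by (auto simp: Omega_def not_less intro: le_less_trans)
  then have "eventually (\<lambda>x. ereal (\<bar>Delta \<theta> x\<bar> / x powr (alpha c x + \<delta> / 2)) < 1) at_top"
    by (rule Limsup_lessD)
  then have big: "eventually (\<lambda>x. \<bar>Delta \<theta> x\<bar> \<le> x powr \<kappa>) at_top"
    using eventually_gt_at_top[of 1]
  proof eventually_elim
    case (elim x)
    then have "\<bar>Delta \<theta> x\<bar> \<le> x powr (alpha c x + \<delta> / 2)" by (simp add: pos_divide_less_eq one_ereal_def)
    also have "\<dots> \<le> x powr \<kappa>" using elim assms by (intro powr_mono) (auto simp: alpha_def \<kappa>_def)
    finally show ?case .
  qed
  consider "Limsup at_top (\<lambda>x. ereal (Delta \<theta> x / x powr \<beta>)) \<le> 0" | "Liminf at_top (\<lambda>x. ereal (Delta \<theta> x / x powr \<beta>)) \<ge> 0"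
    using neg by (auto simp: Omega_pm_def \<beta>_def not_less)
  then show False
  proof cases
    case 1
    then have "Limsup at_top (\<lambda>x. ereal (Delta \<theta> x / x powr \<beta>)) < 1" by (auto intro: le_less_trans)
    then have "eventually (\<lambda>x. ereal (Delta \<theta> x / x powr \<beta>) < 1) at_top" by (rule Limsup_lessD)
    then have ev: "eventually (\<lambda>x. (-1) * Delta \<theta> x + x powr \<beta> \<ge> 0) at_top"
      using eventually_gt_at_top[of 1]
      by eventually_elim (simp add: pos_divide_less_eq one_ereal_def)
    show False by (rule Delta_not_one_sided[OF assms(1) big _ ev params]) simp
  next
    case 2
    then have "Liminf at_top (\<lambda>x. ereal (Delta \<theta> x / x powr \<beta>)) > -1" by (rule less_le_trans[rotated]) simp
    then have "eventually (\<lambda>x. ereal (Delta \<theta> x / x powr \<beta>) > -1) at_top" by (rule less_LiminfD)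
    then have ev: "eventually (\<lambda>x. 1 * Delta \<theta> x + x powr \<beta> \<ge> 0) at_top"
      using eventually_gt_at_top[of 1]
      by eventually_elim (simp add: pos_less_divide_eq one_ereal_def)
    show False by (rule Delta_not_one_sided[OF assms(1) big _ ev params]) simp
  qed
qed

end
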